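(* Let $n\ge 3$, $2<p\le 2^*=\frac{2n}{n-2}$ and $\alpha_n=e^{\frac{n-3}{n-2}}$. For any $0<\alpha\le\alpha_n$ and all $u\in C_c^\infty(\mathbb{H}^n)$ there holds $$\int_{\mathbb{H}^n}|\nabla_{\mathbb{H}^n}u|^2dV-\frac{n(n-2)}{4}\int_{\mathbb{H}^n}u^2dV-\Big(\frac{n-2}{2}\Big)^2\int_{\mathbb{H}^n}\frac{u^2}{\sinh^2\rho}dV\ \ge\ (n-2)^{-\frac{p+2}{p}}S_{n,p}\Big(\int_{\mathbb{H}^n}(\sinh\rho)^{\frac{p(n-2)}{2}-n}X^{\frac{p+2}{2}}\big(\alpha\tanh(\rho/2)\big)|u|^p\,dV\Big)^{2/p}.$$ Moreover the constant $(n-2)^{-\frac{p+2}{p}}S_{n,p}$ is sharp.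
   Context: $\mathbb{H}^n$ is the $n$-dimensional hyperbolic space (curvature $-1$) with Riemannian gradient $\nabla_{\mathbb{H}^n}$ and volume element $dV$; $\rho=\rho(x)$ is the hyperbolic distance from $x$ to a fixed point $x_0\in\mathbb{H}^n$. (In the ball model $B_1$ with metric $\big(\frac{1-|x|^2}{2}\big)^{-2}dx^2$ and $x_0=0$, $\rho(x)=\ln\frac{1+|x|}{1-|x|}$.) Functions are real-valued. $X(t)=\frac{1}{1-\ln t}$ for $t\in(0,e)$, and $X^{q}(t)=(X(t))^q$. $S_{n,p}$ denotes the best (largest) constant in the inequality $\int_{\mathbb{R}^n}|\nabla u|^2dx\ge S_{n,p}\big(\int_{\mathbb{R}^n}|x|^{\frac{p(n-2)}{2}-n}|u|^pdx\big)^{2/p}$ for all $u\in C_c^\infty(\mathbb{R}^n)$. "Sharp" means that the constant cannot be replaced by a larger one. *)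

theory Defs
  imports "HOL-Analysis.Analysis"
begin

definition partial_deriv :: "'n::finite \<Rightarrow> (real^'n \<Rightarrow> real) \<Rightarrow> real^'n \<Rightarrow> real" where
  "partial_deriv i f x = frechet_derivative f (at x) (axis i 1)"

definition grad :: "(real^'n::finite \<Rightarrow> real) \<Rightarrow> real^'n \<Rightarrow> real^'n" where
  "grad f x = (\<chi> i. partial_deriv i f x)"

primrec C_k :: "nat \<Rightarrow> (real^'n::finite \<Rightarrow> real) \<Rightarrow> bool" where
  "C_k 0 f \<longleftrightarrow> continuous_on UNIV f"
| "C_k (Suc k) f \<longleftrightarrow> f differentiable_on UNIV \<and> (\<forall>i. C_k k (partial_deriv i f))"

text \<open>A compactly supported smooth function on an open set \<open>\<Omega>\<close> is represented by its
  extension by zero, which is smooth on the whole space.\<close>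

definition test_functions :: "(real^'n::finite) set \<Rightarrow> (real^'n \<Rightarrow> real) set" where
  "test_functions \<Omega> = {u. (\<forall>k. C_k k u) \<and> compact (closure {x. u x \<noteq> 0})
                              \<and> closure {x. u x \<noteq> 0} \<subseteq> \<Omega>}"

text \<open>Hyperbolic space is the unit ball with the metric \<open>(conf_factor x)\<^sup>2 |dx|\<^sup>2\<close>.
  Hence its Riemannian gradient is the Euclidean one divided by \<open>(conf_factor x)\<^sup>2\<close>, tangent
  vectors at \<open>x\<close> have length \<open>conf_factor x * |v|\<close>, and the volume density
  (the square root of the determinant of the metric) is the \<open>n\<close>-th power of \<open>conf_factor x\<close>.\<close>

definition hyp_space :: "(real^'n::finite) set" where
  "hyp_space = ball 0 1"

definition conf_factor :: "real^'n::finite \<Rightarrow> real" where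
  "conf_factor x = 2 / (1 - (norm x)\<^sup>2)"

definition hyp_grad :: "(real^'n::finite \<Rightarrow> real) \<Rightarrow> real^'n \<Rightarrow> real^'n" where
  "hyp_grad u x = (1 / (conf_factor x)\<^sup>2) *\<^sub>R grad u x"

definition hyp_norm :: "real^'n::finite \<Rightarrow> real^'n \<Rightarrow> real" where
  "hyp_norm x v = conf_factor x * norm v"

definition hyp_volume :: "(real^'n::finite) measure" where
  "hyp_volume = density lborel
     (\<lambda>x. ennreal (indicator hyp_space x * conf_factor x ^ CARD('n)))"

definition hyp_dist :: "real^'n::finite \<Rightarrow> real^'n \<Rightarrow> real" where
  "hyp_dist x y = arcosh (1 + 2 * (norm (x - y))\<^sup>2 / ((1 - (norm x)\<^sup>2) * (1 - (norm y)\<^sup>2)))"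

lemma hyp_dist_0:
  assumes "x \<in> hyp_space"
  shows "hyp_dist x 0 = ln ((1 + norm x) / (1 - norm x))"
proof -
  define r where "r = norm x"
  have r: "0 \<le> r" "r < 1" using assms by (auto simp: r_def hyp_space_def)
  have D: "1 - r\<^sup>2 > 0" using r by (simp add: power_less_one_iff abs_square_less_1)
  have d: "1 - r\<^sup>2 = (1 - r) * (1 + r)" by (simp add: power2_eq_square algebra_simps)
  define y where "y = 1 + 2 * r\<^sup>2 / (1 - r\<^sup>2)"
  have y: "y = (1 + r\<^sup>2) / (1 - r\<^sup>2)" unfolding y_def using D by (simp add: divide_simps)
  have "y\<^sup>2 - 1 = (2 * r / (1 - r\<^sup>2))\<^sup>2"
    unfolding y using D by (simp add: power_divide divide_simps) (simp add: power2_eq_square algebra_simps)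
  then have "sqrt (y\<^sup>2 - 1) = 2 * r / (1 - r\<^sup>2)"
    using r D by simp
  then have "y + sqrt (y\<^sup>2 - 1) = (1 + r)\<^sup>2 / (1 - r\<^sup>2)"
    unfolding y by (simp add: add_divide_distrib[symmetric] power2_eq_square algebra_simps)
  also have "\<dots> = (1 + r) / (1 - r)"
    unfolding d using r by (simp add: power2_eq_square)
  finally have e: "y + sqrt (y\<^sup>2 - 1) = (1 + r) / (1 - r)" .
  have "y \<ge> 1" unfolding y_def using D by simp
  then have "arcosh y = ln ((1 + r) / (1 - r))"
    using e by (simp add: arcosh_real_def)
  then show ?thesis unfolding hyp_dist_def y_def r_def by simp
qed

definition X :: "real \<Rightarrow> real" where
  "X t = 1 / (1 - ln t)"

definition S_const :: "'n::finite itself \<Rightarrow> real \<Rightarrow> real" where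
  "S_const N p = (let n = real CARD('n) in
     Sup {C. \<forall>u \<in> test_functions (UNIV :: (real^'n) set).
       (LINT x|lborel. (norm (grad u x))\<^sup>2)
         \<ge> C * (LINT x|lborel. norm x powr (p * (n - 2) / 2 - n) * \<bar>u x\<bar> powr p) powr (2 / p)})"

definition hardy_energy :: "real^'n::finite \<Rightarrow> (real^'n \<Rightarrow> real) \<Rightarrow> real" where
  "hardy_energy x0 u = (let n = real CARD('n) in
       (LINT x|hyp_volume. (hyp_norm x (hyp_grad u x))\<^sup>2)
     - n * (n - 2) / 4 * (LINT x|hyp_volume. (u x)\<^sup>2)
     - ((n - 2) / 2)\<^sup>2 * (LINT x|hyp_volume. (u x)\<^sup>2 / (sinh (hyp_dist x x0))\<^sup>2))"

definition weighted_term :: "real \<Rightarrow> real \<Rightarrow> real^'n::finite \<Rightarrow> (real^'n \<Rightarrow> real) \<Rightarrow> real" where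
  "weighted_term p \<alpha> x0 u = (let n = real CARD('n) in
     (LINT x|hyp_volume. sinh (hyp_dist x x0) powr (p * (n - 2) / 2 - n)
        * X (\<alpha> * tanh (hyp_dist x x0 / 2)) powr ((p + 2) / 2) * \<bar>u x\<bar> powr p) powr (2 / p))"

end

theory Submission
  imports Defs "HOL-Complex_Analysis.Great_Picard" "HOL-Computational_Algebra.Polynomial"
begin

text \<open>For base point \<open>0\<close>, the ground state substitution \<open>u = (sinh \<rho>) powr (-(n-2)/2) * w\<close> turns the
  left-hand side into the integral of \<open>norm x powr (2-n) * (norm (grad w x))\<^sup>2\<close>, and the change of variables
  \<open>norm x \<mapsto> X (\<alpha> * norm x) powr (1/(n-2))\<close> along rays turns this into \<open>1/(n-2)\<close> times a Dirichlet integral whose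
  angular part has been multiplied by a factor \<open>\<ge> 1\<close>; here \<open>\<alpha> \<le> exp ((n-3)/(n-2))\<close> is needed.  The weighted
  term becomes \<open>n-2\<close> times the Euclidean one, so the inequality follows from the definition of
  \<open>S_const\<close>.  Other base points are moved to \<open>0\<close> by an inversion, which is a hyperbolic isometry.

  For radial functions the angular part vanishes and the reduction is an equality.  By scale invariance
  the support may be shrunk to fit into the image of the ball, so sharpness
  follows once \<open>S_const\<close> is approached by radial functions.  This is achieved by
  symmetrization: the energies of \<open>(f x - f y)\<^sup>2\<close> over \<open>dist x y < \<epsilon>\<close> decrease under polarization and
  converge to the Dirichlet integral after scaling, and a minimiser of the second moment among the functions
  dominated by \<open>u\<close> in these energies is fixed by all polarizations that favour the origin.\<close>

subsection \<open>Change of variables\<close>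

text \<open>The potentials \<open>n * (n - 2) / 4\<close> and
  \<open>((n - 2) / 2)\<^sup>2 / (sinh \<rho>)\<^sup>2\<close> are those for which the ground state
  solves the Euler equation, so completing the square leaves only a divergence. The sharp constant
  balances two factors: the energy acquires 1/(n-2) and the mass n-2, whose power 2/p makes it (n-2)
  powr (-1 - 2/p). The bound p <= 2n/(n-2) says that the Euclidean weight is radially nonincreasing,
  so that polarization cannot lower the mass. Two obstacles shape the rest. Both substitutions are
  singular at the base point and are made for functions supported away from it; since a point has
  zero capacity in dimension at least three, cutoffs restore the general case. Polarization and
  rearrangement destroy smoothness and give only Lipschitz functions; nonlocal energies need no weak
  derivatives and do not increase under mollification, which leads back to smooth functions. The
  energies are therefore treated on \<open>C1c\<close>, and test functions enter by
  approximation.\<close>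

text \<open>The change of variables theorem of the library requires a well-ordered index type; the
  copy \<open>'n wo\<close> of \<open>'n\<close> supplies one.\<close>

typedef (overloaded) ('n::finite) wo = "UNIV :: 'n set" by auto

lemma bij_Rep_wo: "bij Rep_wo"
  by (rule bijI') (auto simp: Rep_wo_inject intro: exI[of _ "Abs_wo y" for y] Abs_wo_inverse[symmetric])

instantiation wo :: (finite) "{finite, wellorder}"
begin

definition less_eq_wo :: "'a wo \<Rightarrow> 'a wo \<Rightarrow> bool" where
  "x \<le> y \<longleftrightarrow> to_nat (Rep_wo x) \<le> to_nat (Rep_wo y)"

definition less_wo :: "'a wo \<Rightarrow> 'a wo \<Rightarrow> bool" where
  "x < y \<longleftrightarrow> to_nat (Rep_wo x) < to_nat (Rep_wo y)"

instance
proof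
  show "finite (UNIV :: 'a wo set)"
    using bij_betw_finite[OF bij_Rep_wo] by simp
next
  fix P :: "'a wo \<Rightarrow> bool" and a
  assume step: "\<And>x. (\<And>y. y < x \<Longrightarrow> P y) \<Longrightarrow> P x"
  show "P a"
    by (induction "to_nat (Rep_wo a)" arbitrary: a rule: less_induct) (metis step less_wo_def)
qed (auto simp: less_eq_wo_def less_wo_def Rep_wo_inject)

end

definition wo_vec :: "real^'n::finite \<Rightarrow> real^'n wo" where
  "wo_vec x = (\<chi> i. x $ Rep_wo i)"

definition unwo_vec :: "real^'n wo \<Rightarrow> real^'n::finite" where
  "unwo_vec x = (\<chi> i. x $ Abs_wo i)"

lemma wo_vec_unwo_vec [simp]: "wo_vec (unwo_vec x) = x" "unwo_vec (wo_vec y) = y"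
  by (auto simp: wo_vec_def unwo_vec_def vec_eq_iff Rep_wo_inverse Abs_wo_inverse)

lemma sum_wo: "(\<Sum>i\<in>UNIV. f (Rep_wo i)) = (\<Sum>i\<in>UNIV. f i)"
  using sum.reindex_bij_betw[OF bij_Rep_wo, of f] .

lemma prod_wo: "(\<Prod>i\<in>UNIV. f (Rep_wo i)) = (\<Prod>i\<in>UNIV. f i)"
  using prod.reindex_bij_betw[OF bij_Rep_wo, of f] .

lemma wo_vec_inner [simp]: "wo_vec x \<bullet> wo_vec y = x \<bullet> y"
  unfolding inner_vec_def wo_vec_def using sum_wo[of "\<lambda>i. x $ i \<bullet> y $ i"] by simp

lemma linear_wo_vec: "linear wo_vec"
  by (rule linearI) (auto simp: wo_vec_def vec_eq_iff)

lemma linear_unwo_vec: "linear unwo_vec"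
  by (rule linearI) (auto simp: unwo_vec_def vec_eq_iff)

lemma bounded_linear_wo_vec: "bounded_linear wo_vec" and bounded_linear_unwo_vec: "bounded_linear unwo_vec"
  by (simp_all add: linear_wo_vec linear_unwo_vec linear_conv_bounded_linear[symmetric])

lemma wo_vec_measurable [measurable]: "wo_vec \<in> borel_measurable borel" "unwo_vec \<in> borel_measurable borel"
  by (auto intro!: borel_measurable_continuous_onI linear_continuous_on
      simp: bounded_linear_wo_vec bounded_linear_unwo_vec)

lemma emeasure_lborel_box_cart:
  fixes l u :: "real^'n::finite"
  assumes "\<And>i. l $ i \<le> u $ i"
  shows "emeasure lborel (box l u) = (\<Prod>i\<in>UNIV. u $ i - l $ i)"
proof -
  have "(\<Prod>b\<in>Basis. (u - l) \<bullet> b) = (\<Prod>i\<in>UNIV. u $ i - l $ i)"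
    by (simp add: axis_eq_axis cart_eq_inner_axis Basis_vec_def UNION_singleton_eq_range prod.reindex inj_on_def inner_diff_left)
  then show ?thesis
    using assms by (subst emeasure_lborel_box) (auto simp: Basis_vec_def inner_axis)
qed

text \<open>\<open>lborel\<close> is determined by its values on boxes, and relabelling coordinates
  maps boxes to boxes with the same side lengths.\<close>

lemma lborel_distr_wo_vec: "distr lborel borel wo_vec = (lborel :: (real^'n::finite wo) measure)"
proof (rule lborel_eqI[symmetric])
  fix l u :: "real^'n wo"
  assume "\<And>b. b \<in> Basis \<Longrightarrow> l \<bullet> b \<le> u \<bullet> b"
  then have le: "l $ i \<le> u $ i" for i
    by (metis axis_in_Basis_iff Basis_real_def insertI1 inner_axis inner_real_def mult.right_neutral inner_commute)
  have eq: "wo_vec -` box l u = box (unwo_vec l) (unwo_vec u)"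
    unfolding set_eq_iff vimage_def mem_box_cart mem_Collect_eq wo_vec_def unwo_vec_def vec_lambda_beta
    by (metis Rep_wo_inverse Abs_wo_inverse UNIV_I)
  have "emeasure (distr lborel borel wo_vec) (box l u) = emeasure lborel (box (unwo_vec l) (unwo_vec u))"
    by (simp add: emeasure_distr eq)
  also have "\<dots> = (\<Prod>i\<in>UNIV. unwo_vec u $ i - unwo_vec l $ i)"
    using le by (intro emeasure_lborel_box_cart) (simp add: unwo_vec_def)
  also have "(\<Prod>i\<in>UNIV. unwo_vec u $ i - unwo_vec l $ i) = (\<Prod>i\<in>UNIV. u $ i - l $ i)"
    using prod_wo[of "\<lambda>i. unwo_vec u $ i - unwo_vec l $ i"] by (simp add: unwo_vec_def Rep_wo_inverse)
  also have "\<dots> = (\<Prod>b\<in>Basis. (u - l) \<bullet> b)"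
    by (simp add: axis_eq_axis cart_eq_inner_axis Basis_vec_def UNION_singleton_eq_range prod.reindex inj_on_def inner_diff_left)
  finally show "emeasure (distr lborel borel wo_vec) (box l u) = (\<Prod>b\<in>Basis. (u - l) \<bullet> b)" .
qed simp

lemma matrix_eqI_vector: 
  fixes f :: "real^'n::finite \<Rightarrow> real^'n"
  assumes "\<And>h. A *v h = f h" shows "matrix f = A"
  using assms by (metis matrix_of_matrix_vector_mul ext)

text \<open>An orthogonal matrix sending a multiple of a coordinate vector to \<open>v\<close>
  diagonalises the map: the eigenvalue is \<open>c + d * (v \<bullet> v)\<close> along
  \<open>v\<close> and \<open>c\<close> on its complement. Reflections, radial maps and inversions
  all have derivatives of this shape, so one determinant serves all three.\<close>

lemma det_rank_one_update:
  fixes v :: "real^'n::finite"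
  shows "det (matrix (\<lambda>h. c *\<^sub>R h + (d * (v \<bullet> h)) *\<^sub>R v)) = c ^ (CARD('n) - 1) * (c + d * (v \<bullet> v))"
proof -
  \<comment> \<open>Index types are nonempty, so some coordinate can carry the exceptional
    eigenvalue.\<close>
  obtain k :: 'n where True by auto
  define e :: "real^'n" where "e = axis k (norm v)"
  have "e = norm v *\<^sub>R axis k 1" by (auto simp: e_def axis_def vec_eq_iff)
  then have "norm e = norm v" by simp
  then obtain Q where Q: "orthogonal_transformation Q" "Q e = v"
    using orthogonal_transformation_exists[of e v] by blast
  define M where "M = matrix Q"
  have lQ: "linear Q" using Q(1) by (simp add: orthogonal_transformation_linear)
  have M: "orthogonal_matrix M" using Q(1) by (simp add: M_def orthogonal_transformation_matrix)
  have Mv: "M *v x = Q x" for x using lQ by (simp add: M_def)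
  define D :: "real^'n^'n" where "D = (\<chi> i j. if i = j then (if i = k then c + d * (v \<bullet> v) else c) else 0)"
  have vv: "v \<bullet> v = norm v * norm v" by (simp add: dot_square_norm power2_eq_square)
  have Dv: "D *v y = c *\<^sub>R y + (d * (e \<bullet> y)) *\<^sub>R e" for y
  proof -
    have "(D *v y) $ i = (if i = k then c + d * (v \<bullet> v) else c) * y $ i" for i
    proof -
      have "(D *v y) $ i = (\<Sum>j\<in>UNIV. if i = j then (if i = k then c + d * (v \<bullet> v) else c) * y $ j else 0)"
        unfolding D_def matrix_vector_mult_def vec_lambda_beta by (intro sum.cong) auto
      then show ?thesis by simp
    qed
    moreover have "e \<bullet> y = norm v * y $ k"
      by (simp add: e_def inner_axis')
    moreover have "e $ i = (if i = k then norm v else 0)" for i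
      by (simp add: e_def axis_def)
    ultimately show ?thesis
      by (simp add: vec_eq_iff vv algebra_simps)
  qed
  have "(M ** D ** transpose M) *v h = c *\<^sub>R h + (d * (v \<bullet> h)) *\<^sub>R v" for h
  proof -
    have MM: "M *v (transpose M *v h) = h"
      using M by (simp add: matrix_vector_mul_assoc orthogonal_matrix_def del: transpose_matrix_vector)
    have "e \<bullet> (transpose M *v h) = v \<bullet> h"
      unfolding Q(2)[symmetric] Mv[symmetric] dot_lmul_matrix[symmetric] by (metis MM transpose_matrix_vector vector_transpose_matrix dot_lmul_matrix inner_commute)
    then have "(M ** D ** transpose M) *v h = M *v (c *\<^sub>R (transpose M *v h) + (d * (v \<bullet> h)) *\<^sub>R e)"
      by (simp add: matrix_vector_mul_assoc[symmetric] Dv del: transpose_matrix_vector)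
    also have "\<dots> = c *\<^sub>R (M *v (transpose M *v h)) + (d * (v \<bullet> h)) *\<^sub>R (M *v e)"
      by (simp add: matrix_vector_right_distrib matrix_vector_mult_scaleR)
    finally show ?thesis unfolding MM by (simp add: Mv Q(2))
  qed
  then have "matrix (\<lambda>h. c *\<^sub>R h + (d * (v \<bullet> h)) *\<^sub>R v) = M ** D ** transpose M"
    by (rule matrix_eqI_vector)
  then have "det (matrix (\<lambda>h. c *\<^sub>R h + (d * (v \<bullet> h)) *\<^sub>R v)) = det D * det (M ** transpose M)"
    by (simp add: det_mul)
  also have "\<dots> = det D" using M by (simp add: orthogonal_matrix_def det_I)
  also have "det D = (\<Prod>i\<in>UNIV. if i = k then c + d * (v \<bullet> v) else c)"
    by (subst det_diagonal) (auto simp: D_def)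
  also have "\<dots> = (c + d * (v \<bullet> v)) * (\<Prod>i\<in>UNIV - {k}. c)"
    by (subst prod.remove[of _ k]) (auto intro!: prod.cong)
  finally show ?thesis by (simp add: card_Diff_singleton mult.commute)
qed

lemma integral_change_of_variables_rank_one:
  fixes f :: "real^'n::finite \<Rightarrow> real" and g v :: "real^'n \<Rightarrow> real^'n"
  assumes S: "S \<in> sets borel"
    and der: "\<And>x. x \<in> S \<Longrightarrow> (g has_derivative (\<lambda>h. c x *\<^sub>R h + (d x * (v x \<bullet> h)) *\<^sub>R v x)) (at x)"
    and inj: "inj_on g S" and gS: "g ` S \<in> sets borel"
    and f [measurable]: "f \<in> borel_measurable borel"
    and meas [measurable]: "(\<lambda>x. indicator S x * (\<bar>c x ^ (CARD('n) - 1) * (c x + d x * (v x \<bullet> v x))\<bar> * f (g x))) \<in> borel_measurable borel"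
  shows "(LINT y|lborel. indicator (g ` S) y * f y) =
     (LINT x|lborel. indicator S x * (\<bar>c x ^ (CARD('n) - 1) * (c x + d x * (v x \<bullet> v x))\<bar> * f (g x)))"
proof -
  define G where "G = wo_vec \<circ> g \<circ> unwo_vec"
  define T where "T = wo_vec ` S"
  define J where "J x = \<bar>c x ^ (CARD('n) - 1) * (c x + d x * (v x \<bullet> v x))\<bar>" for x
  \<comment> \<open>The substitution theorem is about vector-valued functions, hence the detour
    through \<open>real^1\<close>.\<close>
  define F :: "real^'n wo \<Rightarrow> real^1" where "F y = vec (f (unwo_vec y))" for y
  have T: "T = unwo_vec -` S" unfolding T_def by (auto simp: image_iff) (metis wo_vec_unwo_vec(1))
  have Tb: "T \<in> sets borel" unfolding T using S by (metis measurable_sets_borel wo_vec_measurable(2))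
  have card: "CARD('n wo) = CARD('n)" by (rule bij_betw_same_card[OF bij_Rep_wo])
  define G' where "G' x h = c (unwo_vec x) *\<^sub>R h + (d (unwo_vec x) * (wo_vec (v (unwo_vec x)) \<bullet> h)) *\<^sub>R wo_vec (v (unwo_vec x))" for x h
  have dG: "(G has_derivative G' x) (at x within T)" if "x \<in> T" for x
  proof -
    from that have xS: "unwo_vec x \<in> S" by (auto simp: T)
    have 1: "(unwo_vec has_derivative unwo_vec) (at x within T)"
      using bounded_linear_unwo_vec by (rule bounded_linear_imp_has_derivative)
    have "((\<lambda>y. wo_vec (g (unwo_vec y))) has_derivative
      (\<lambda>h. wo_vec (c (unwo_vec x) *\<^sub>R unwo_vec h + (d (unwo_vec x) * (v (unwo_vec x) \<bullet> unwo_vec h)) *\<^sub>R v (unwo_vec x)))) (at x within T)"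
      by (rule bounded_linear.has_derivative[OF bounded_linear_wo_vec])
         (rule has_derivative_compose[OF 1 der[OF xS], unfolded o_def])
    moreover have "wo_vec (c (unwo_vec x) *\<^sub>R unwo_vec h + (d (unwo_vec x) * (v (unwo_vec x) \<bullet> unwo_vec h)) *\<^sub>R v (unwo_vec x)) = G' x h" for h
      unfolding G'_def linear_add[OF linear_wo_vec] linear_scale[OF linear_wo_vec]
      by simp (metis wo_vec_inner wo_vec_unwo_vec(1))
    ultimately show ?thesis by (simp add: G_def o_def)
  qed
  have det: "\<bar>det (matrix (G' x))\<bar> = J (unwo_vec x)" for x
    unfolding G'_def det_rank_one_update card J_def by simp
  have injG: "inj_on G T" using inj unfolding G_def T
    by (auto simp: inj_on_def) (metis wo_vec_unwo_vec)
  have GT: "G ` T = unwo_vec -` (g ` S)"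
  proof (rule set_eqI)
    fix y show "y \<in> G ` T \<longleftrightarrow> y \<in> unwo_vec -` (g ` S)"
      unfolding G_def T_def image_comp by (auto simp: image_iff) (metis wo_vec_unwo_vec(1))
  qed
  have GTb: "G ` T \<in> sets borel" unfolding GT using gS by (metis measurable_sets_borel wo_vec_measurable(2))
  note cov = has_absolute_integral_change_of_variables[OF _ dG injG, of F, unfolded det]
  have fT: "(\<lambda>x. indicator (G ` T) x * f (unwo_vec x)) \<in> borel_measurable borel" using GTb by measurable
  have gT: "(\<lambda>x. indicator T x * (J (unwo_vec x) * f (unwo_vec (G x)))) \<in> borel_measurable borel"
  proof -
    have "(\<lambda>x. indicator T x * (J (unwo_vec x) * f (unwo_vec (G x)))) =
       (\<lambda>x. indicator S (unwo_vec x) * (J (unwo_vec x) * f (g (unwo_vec x))))"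
      by (auto simp: T G_def fun_eq_iff indicator_def)
    then show ?thesis 
      using measurable_compose[OF wo_vec_measurable(2) meas] unfolding J_def[symmetric] by simp
  qed
  have Fi: "F absolutely_integrable_on A \<longleftrightarrow> (\<lambda>x. f (unwo_vec x)) absolutely_integrable_on A" for A
    unfolding F_def by (subst absolutely_integrable_on_1_iff) simp
  have Ji: "(\<lambda>x. J (unwo_vec x) *\<^sub>R F (G x)) absolutely_integrable_on A
     \<longleftrightarrow> (\<lambda>x. J (unwo_vec x) * f (unwo_vec (G x))) absolutely_integrable_on A" for A
    unfolding F_def by (subst absolutely_integrable_on_1_iff) simp
  have conv: "integral\<^sup>L lborel (\<lambda>x. indicator A x * q x) = integral A (\<lambda>x. q x)"
    if "q absolutely_integrable_on A" "(\<lambda>x. indicator A x * q x) \<in> borel_measurable borel" for A and q :: "real^'n wo \<Rightarrow> real"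
    using set_lebesgue_integral_eq_integral(2)[OF that(1)] that(2)
    by (simp add: set_lebesgue_integral_def integral_completion)
  \<comment> \<open>Without integrability both sides are \<open>0\<close> by convention. The formula
    thus holds for every measurable \<open>f\<close>, and applications have no integrability to
    check.\<close>
  have nconv: "integral\<^sup>L lborel (\<lambda>x. indicator A x * q x) = 0"
    if "\<not> q absolutely_integrable_on A" "(\<lambda>x. indicator A x * q x) \<in> borel_measurable borel" for A and q :: "real^'n wo \<Rightarrow> real"
    using that by (intro not_integrable_integral_eq) (simp add: set_integrable_def integrable_completion)
  have key: "integral\<^sup>L lborel (\<lambda>x. indicator (G ` T) x * f (unwo_vec x)) =
    integral\<^sup>L lborel (\<lambda>x. indicator T x * (J (unwo_vec x) * f (unwo_vec (G x))))"
  proof (cases "F absolutely_integrable_on (G ` T)")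
    case True
    then have a: "(\<lambda>x. J (unwo_vec x) *\<^sub>R F (G x)) absolutely_integrable_on T"
      and b: "integral T (\<lambda>x. J (unwo_vec x) *\<^sub>R F (G x)) = integral (G ` T) F"
      using cov[of "integral (G ` T) F"] Tb by auto
    have "vec (integral T (\<lambda>x. J (unwo_vec x) * f (unwo_vec (G x)))) = (vec (integral (G ` T) (\<lambda>x. f (unwo_vec x))) :: real^1)"
      using b unfolding integral_on_1_eq by (simp add: F_def)
    then have "integral T (\<lambda>x. J (unwo_vec x) * f (unwo_vec (G x))) = integral (G ` T) (\<lambda>x. f (unwo_vec x))"
      by (simp add: vec_eq_iff)
    then show ?thesis using True a fT gT unfolding Fi Ji by (simp add: conv)
  next
    case False
    then have "\<not> (\<lambda>x. J (unwo_vec x) *\<^sub>R F (G x)) absolutely_integrable_on T"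
      using cov Tb by auto
    then show ?thesis using False fT gT unfolding Fi Ji by (simp add: nconv)
  qed
  have l: "integral\<^sup>L lborel (\<lambda>x. indicator (G ` T) x * f (unwo_vec x)) = (LINT y|lborel. indicator (g ` S) y * f y)"
    unfolding lborel_distr_wo_vec[symmetric] using fT
    by (subst integral_distr) (auto simp: GT indicator_def intro!: Bochner_Integration.integral_cong)
  have r: "integral\<^sup>L lborel (\<lambda>x. indicator T x * (J (unwo_vec x) * f (unwo_vec (G x)))) =
     (LINT x|lborel. indicator S x * (J x * f (g x)))"
    unfolding lborel_distr_wo_vec[symmetric] using gT
    by (subst integral_distr) (auto simp: G_def T indicator_def intro!: Bochner_Integration.integral_cong)
  show ?thesis using key[unfolded l r] unfolding J_def .
qed

subsection \<open>Reflections\<close>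

text \<open>For unit \<open>\<nu>\<close> this is the reflection across the hyperplane
  \<open>\<nu> \<bullet> x = t\<close>.\<close>

definition mirror :: "real^'n::finite \<Rightarrow> real \<Rightarrow> real^'n \<Rightarrow> real^'n" where
  "mirror \<nu> t x = x - (2 * (\<nu> \<bullet> x - t)) *\<^sub>R \<nu>"

lemma mirror_mirror [simp]:
  assumes "norm \<nu> = 1" shows "mirror \<nu> t (mirror \<nu> t x) = x"
proof -
  have "\<nu> \<bullet> \<nu> = 1" using assms by (simp add: dot_square_norm)
  then have "\<nu> \<bullet> mirror \<nu> t x = 2 * t - \<nu> \<bullet> x"
    by (simp add: mirror_def inner_diff_right)
  then have "2 * (\<nu> \<bullet> mirror \<nu> t x - t) = - (2 * (\<nu> \<bullet> x - t))" by simp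
  then show ?thesis
    unfolding mirror_def[of \<nu> t "mirror \<nu> t x"] by (simp only: scaleR_minus_left) (simp add: mirror_def)
qed

lemma dist_mirror [simp]:
  assumes "norm \<nu> = 1" shows "dist (mirror \<nu> t x) (mirror \<nu> t y) = dist x y"
proof -
  have n: "\<nu> \<bullet> \<nu> = 1" using assms by (simp add: dot_square_norm)
  have e: "mirror \<nu> t x - mirror \<nu> t y = (x - y) - (2 * (\<nu> \<bullet> (x - y))) *\<^sub>R \<nu>"
    by (simp add: mirror_def algebra_simps)
  show ?thesis
    unfolding dist_norm e norm_eq using n
    by (simp add: inner_diff_left inner_diff_right inner_commute algebra_simps)
qed

lemma continuous_on_mirror: "continuous_on S (mirror \<nu> t)"
  unfolding mirror_def by (intro continuous_intros)

lemma mirror_measurable [measurable]: "mirror \<nu> t \<in> borel_measurable borel"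
  by (intro borel_measurable_continuous_onI continuous_on_mirror)

lemma bij_mirror: "norm \<nu> = 1 \<Longrightarrow> bij (mirror \<nu> t)"
  by (rule o_bij[where g = "mirror \<nu> t"]) (auto simp: fun_eq_iff)

text \<open>The derivative is the rank-one update with \<open>c = 1\<close> and
  \<open>d = - 2\<close>, whose determinant is \<open>- 1\<close>, so boxes keep their measure, and
  boxes determine the image measure.\<close>

lemma lborel_distr_mirror:
  assumes \<nu>: "norm \<nu> = 1"
  shows "distr lborel borel (mirror \<nu> t) = (lborel :: (real^'n::finite) measure)"
proof (rule lborel_eqI[symmetric])
  fix l u :: "real^'n"
  assume le: "\<And>b. b \<in> Basis \<Longrightarrow> l \<bullet> b \<le> u \<bullet> b"
  let ?M = "mirror \<nu> t -` box l u"
  have n: "\<nu> \<bullet> \<nu> = 1" using \<nu> by (simp add: dot_square_norm)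
  have sM [measurable]: "?M \<in> sets borel"
    by (metis measurable_sets_borel mirror_measurable box_borel)
  have rg: "range (mirror \<nu> t) = UNIV" using bij_mirror[OF \<nu>] by (simp add: bij_def)
  have "(LINT y|lborel. indicator (range (mirror \<nu> t)) y * (indicator (box l u) y :: real)) =
     (LINT x|lborel. indicator UNIV x * (\<bar>1 ^ (CARD('n) - 1) * (1 + (-2) * (\<nu> \<bullet> \<nu>))\<bar> * indicator (box l u) (mirror \<nu> t x)))"
  proof (rule integral_change_of_variables_rank_one)
    fix x :: "real^'n"
    show "(mirror \<nu> t has_derivative (\<lambda>h. 1 *\<^sub>R h + (- 2 * (\<nu> \<bullet> h)) *\<^sub>R \<nu>)) (at x)"
      unfolding mirror_def by (auto intro!: derivative_eq_intros simp: algebra_simps)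
  qed (use bij_mirror[OF \<nu>] rg in \<open>auto simp: bij_def intro!: borel_measurable_indicator\<close>)
  then have "measure lborel (box l u) = (LINT x|lborel. indicator (box l u) (mirror \<nu> t x))"
    by (simp add: rg n)
  also have "(\<lambda>x. indicator (box l u) (mirror \<nu> t x)) = (indicator ?M :: _ \<Rightarrow> real)"
    by (auto simp: indicator_def fun_eq_iff)
  finally have eq: "measure lborel (box l u) = measure lborel ?M" by simp
  \<comment> \<open>\<open>measure\<close> is \<open>0\<close> on sets of infinite measure, so the
    equality just obtained transfers to \<open>emeasure\<close> only after finiteness is
    known.\<close>
  have "bounded ?M"
  proof -
    have "?M = mirror \<nu> t ` box l u"
      using \<nu> by (auto simp: image_iff) (metis mirror_mirror)
    also have "bounded \<dots>"
      by (meson bounded_box bounded_subset compact_cbox compact_continuous_image compact_imp_bounded continuous_on_mirror box_subset_cbox image_mono)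
    finally show ?thesis .
  qed
  then have "emeasure lborel ?M < \<infinity>" by (rule emeasure_bounded_finite)
  then have "emeasure lborel ?M = emeasure lborel (box l u)"
    by (metis eq emeasure_eq_ennreal_measure emeasure_lborel_box_finite less_irrefl infinity_ennreal_def)
  then show "emeasure (distr lborel borel (mirror \<nu> t)) (box l u) = (\<Prod>b\<in>Basis. (u - l) \<bullet> b)"
    using le by (simp add: emeasure_distr emeasure_lborel_box)
qed simp

lemma integral_mirror:
  fixes f :: "real^'n::finite \<Rightarrow> real"
  assumes "norm \<nu> = 1" and [measurable]: "f \<in> borel_measurable borel"
  shows "(LINT x|lborel. f (mirror \<nu> t x)) = (LINT x|lborel. f x)"
  by (subst (2) lborel_distr_mirror[OF assms(1), of t, symmetric], subst integral_distr) auto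

lemma integrable_mirror:
  fixes f :: "real^'n::finite \<Rightarrow> real"
  assumes "norm \<nu> = 1" and [measurable]: "f \<in> borel_measurable borel"
  shows "integrable lborel (\<lambda>x. f (mirror \<nu> t x)) \<longleftrightarrow> integrable lborel f"
  by (subst (2) lborel_distr_mirror[OF assms(1), of t, symmetric], subst integrable_distr_eq) auto

lemma nn_integral_mirror:
  fixes f :: "real^'n::finite \<Rightarrow> ennreal"
  assumes "norm \<nu> = 1" and [measurable]: "f \<in> borel_measurable borel"
  shows "(\<integral>\<^sup>+x. f (mirror \<nu> t x) \<partial>lborel) = (\<integral>\<^sup>+x. f x \<partial>lborel)"
  by (subst (2) lborel_distr_mirror[OF assms(1), of t, symmetric], subst nn_integral_distr) auto

lemma nn_integral_translation:
  fixes f :: "'a::euclidean_space \<Rightarrow> ennreal"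
  assumes [measurable]: "f \<in> borel_measurable borel"
  shows "(\<integral>\<^sup>+x. f (a + x) \<partial>lborel) = (\<integral>\<^sup>+x. f x \<partial>lborel)"
  by (subst (2) lborel_distr_plus[of a, symmetric], subst nn_integral_distr) auto

lemma integral_translation:
  fixes f :: "'a::euclidean_space \<Rightarrow> real"
  assumes [measurable]: "f \<in> borel_measurable borel"
  shows "(LINT x|lborel. f (a + x)) = (LINT x|lborel. f x)"
  by (subst (2) lborel_distr_plus[of a, symmetric], subst integral_distr) auto

text \<open>The bisecting hyperplane of two points of equal norm passes through the origin. A single
  reflection can thus play the part of a rotation in the arguments by rotational symmetry.\<close>

lemma mirror_maps_sphere:
  fixes x y :: "real^'n::finite"
  assumes "norm x = norm y" "x \<noteq> y"
  obtains \<nu> where "norm \<nu> = 1" "mirror \<nu> 0 x = y"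
proof
  let ?\<nu> = "(x - y) /\<^sub>R norm (x - y)"
  show "norm ?\<nu> = 1" using assms by simp
  have "2 * (x \<bullet> (x - y)) = (norm (x - y))\<^sup>2"
    using assms(1) by (simp add: power2_norm_eq_inner norm_eq inner_diff_left inner_diff_right inner_commute)
  moreover have "?\<nu> \<bullet> x = (x \<bullet> (x - y)) / norm (x - y)"
    by (simp add: inner_commute divide_inverse mult.commute)
  ultimately have "2 * (?\<nu> \<bullet> x) = norm (x - y)"
    by (metis assms(2) eq_iff_diff_eq_0 nonzero_mult_div_cancel_left norm_eq_zero power2_eq_square times_divide_eq_right)
  then have "2 * (?\<nu> \<bullet> x) * inverse (norm (x - y)) = 1"
    using assms(2) by (metis eq_iff_diff_eq_0 norm_eq_zero right_inverse)
  then have "(2 * (?\<nu> \<bullet> x)) *\<^sub>R ?\<nu> = x - y"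
    by (simp add: mult.assoc[symmetric])
  then show "mirror ?\<nu> 0 x = y" by (simp add: mirror_def)
qed

text \<open>The ball is cut into dyadic shells. On the k-th shell the power is at most a constant
  times \<open>(1/2) powr (a * k)\<close>, and the volume decays like 2 to the power - k times the
  dimension; the integral is bounded by a geometric series of ratio \<open>q\<close>, and
  \<open>q < 1\<close> is the hypothesis on \<open>a\<close>.\<close>

lemma integrable_norm_powr_cball:
  fixes a :: real
  assumes "a > - real CARD('n::finite)"
  shows "integrable lborel (\<lambda>x::real^'n. indicator (cball 0 R) x * norm x powr a)"
proof (cases "R > 0")
  case False
  then have "(\<lambda>x. indicator (cball 0 R) x * norm (x::real^'n) powr a) = (\<lambda>_. 0)"
    by (intro ext) (auto simp: indicator_def not_less, metis norm_le_zero_iff order_trans)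
  then show ?thesis by simp
next
  case R: True
  define A where "A k = {x::real^'n. R * (1/2)^(Suc k) < norm x \<and> norm x \<le> R * (1/2)^k}" for k
  define w where "w = unit_ball_vol (real CARD('n))"
  define q where "q = (1/2::real) powr (real CARD('n) + a)"
  \<comment> \<open>The power is largest on the outer sphere of a shell if \<open>a \<ge> 0\<close>
    and near the inner one otherwise; the maximum covers both cases.\<close>
  define C where "C = (R powr a) * max 1 ((1/2) powr a)"
  have [measurable]: "A k \<in> sets borel" for k unfolding A_def by measurable
  have half: "(1/2::real)^k = (1/2) powr (real k)" for k by (simp add: powr_realpow)
  have bound: "norm x powr a \<le> C * (1/2) powr (a * k)" if "x \<in> A k" for x k
  proof -
    from that have x: "R * (1/2)^(Suc k) < norm x" "norm x \<le> R * (1/2)^k" by (auto simp: A_def)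
    have pos: "0 < norm x" using x(1) R by (smt (verit) mult_pos_pos zero_less_power half_gt_zero_iff)
    have e: "(R * (1/2)^k) powr a = R powr a * (1/2) powr (a * k)"
      using R by (simp add: powr_mult half powr_powr mult.commute)
    show ?thesis
    proof (cases "a \<ge> 0")
      case True
      then have "norm x powr a \<le> (R * (1/2)^k) powr a" using x pos by (intro powr_mono2) auto
      also have "\<dots> \<le> C * (1/2) powr (a * k)" unfolding e C_def
        by (intro mult_right_mono) (auto simp: mult_le_cancel_left1)
      finally show ?thesis .
    next
      case False
      then have "norm x powr a \<le> (R * (1/2)^(Suc k)) powr a" using x pos R by (intro powr_mono2') auto
      also have "(R * (1/2)^(Suc k)) = (R * (1/2)^k) * (1/2)" by simp
      also have "((R * (1/2)^k) * (1/2)) powr a = (R powr a * (1/2) powr (a * k)) * (1/2) powr a"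
        using R by (subst powr_mult) (auto simp: e)
      also have "\<dots> \<le> C * (1/2) powr (a * k)" unfolding C_def
        by (simp add: mult.commute mult.left_commute mult_left_mono)
      finally show ?thesis .
    qed
  qed
  have AM: "emeasure lborel (A k) \<le> ennreal (w * (R * (1/2)^k) ^ CARD('n))" for k
  proof -
    have "emeasure lborel (A k) \<le> emeasure lborel (cball (0::real^'n) (R * (1/2)^k))"
      by (intro emeasure_mono) (auto simp: A_def)
    also have "\<dots> = ennreal (w * (R * (1/2)^k) ^ CARD('n))"
      using R by (subst emeasure_cball) (auto simp: w_def)
    finally show ?thesis .
  qed
  have cover: "\<exists>k. x \<in> A k" if "x \<in> cball 0 R" "x \<noteq> 0" for x
  proof -
    define k where "k = (LEAST k. R * (1/2)^(Suc k) < norm x)"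
    have "(\<lambda>k. R * (1/2)^(Suc k)) \<longlonglongrightarrow> R * 0"
      by (intro tendsto_intros LIMSEQ_Suc LIMSEQ_power_zero) simp
    then have "eventually (\<lambda>k. R * (1/2)^(Suc k) < norm x) sequentially"
      by (rule order_tendstoD(2)) (use that(2) in auto)
    then have ex: "\<exists>k. R * (1/2)^(Suc k) < norm x" by (rule eventually_happens'[OF sequentially_bot])
    have 1: "R * (1/2)^(Suc k) < norm x" unfolding k_def by (rule LeastI_ex[OF ex])
    have 2: "norm x \<le> R * (1/2)^k"
    proof (cases k)
      case 0 then show ?thesis using that by (simp add: dist_norm)
    next
      case (Suc l)
      then have "\<not> R * (1/2)^(Suc l) < norm x" unfolding k_def by (metis lessI not_less_Least)
      then show ?thesis using Suc by simp
    qed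
    show ?thesis using 1 2 unfolding A_def by blast
  qed
  define c where "c k = C * (1/2) powr (a * k)" for k :: nat
  have C0: "C \<ge> 0" and c0: "c k \<ge> 0" for k by (auto simp: C_def c_def)
  have "(\<integral>\<^sup>+x. ennreal (norm (indicator (cball 0 R) x * norm (x::real^'n) powr a)) \<partial>lborel)
     \<le> (\<integral>\<^sup>+x. (\<Sum>k. ennreal (c k) * indicator (A k) x) \<partial>lborel)"
  proof (rule nn_integral_mono)
    fix x :: "real^'n"
    show "ennreal (norm (indicator (cball 0 R) x * norm x powr a)) \<le> (\<Sum>k. ennreal (c k) * indicator (A k) x)"
    proof (cases "x \<in> cball 0 R \<and> x \<noteq> 0")
      case True
      then obtain k where k: "x \<in> A k" using cover by blast
      have "ennreal (norm (indicator (cball 0 R) x * norm x powr a)) \<le> ennreal (c k) * indicator (A k) x"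
        using bound[OF k] k True by (simp add: c_def ennreal_leI)
      also have "F k \<le> (\<Sum>j. F j)" for F :: "nat \<Rightarrow> ennreal"
        using sum_le_suminf[of F "{k}"] by simp
      finally show ?thesis .
    qed auto
  qed
  also have "\<dots> = (\<Sum>k. ennreal (c k) * emeasure lborel (A k))"
    by (subst nn_integral_suminf) (auto simp: nn_integral_cmult)
  also have "\<dots> \<le> (\<Sum>k. ennreal ((C * w * R ^ CARD('n)) * q ^ k))"
  proof (intro suminf_le)
    fix k
    have "ennreal (c k) * emeasure lborel (A k) \<le> ennreal (c k) * ennreal (w * (R * (1/2)^k) ^ CARD('n))"
      by (intro mult_left_mono AM) auto
    also have "\<dots> = ennreal (c k * (w * (R * (1/2)^k) ^ CARD('n)))"
      using c0 by (simp add: ennreal_mult'[symmetric])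
    also have "c k * (w * (R * (1/2)^k) ^ CARD('n)) = (C * w * R ^ CARD('n)) * q ^ k"
    proof -
      have "((1/2::real)^k) ^ CARD('n) = (1/2) powr (real CARD('n) * k)"
        by (simp add: half powr_realpow[symmetric] powr_powr mult.commute)
      moreover have "q ^ k = (1/2) powr ((real CARD('n) + a) * k)"
        by (simp add: q_def powr_realpow[symmetric] powr_powr)
      ultimately show ?thesis unfolding c_def by (simp add: power_mult_distrib powr_add algebra_simps)
    qed
    finally show "ennreal (c k) * emeasure lborel (A k) \<le> ennreal ((C * w * R ^ CARD('n)) * q ^ k)" .
  qed auto
  also have "\<dots> < \<infinity>"
  proof -
    have "0 < q" "q < 1" using assms unfolding q_def using powr_less_mono2[of "real CARD('n) + a" "1/2" 1] by auto
    then have "summable (\<lambda>k. (C * w * R ^ CARD('n)) * q ^ k)" by (intro summable_mult summable_geometric) simp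
    then show ?thesis using C0 R \<open>0 < q\<close>
      by (subst suminf_ennreal2) (auto simp: w_def intro!: mult_nonneg_nonneg)
  qed
  finally show ?thesis
    by (intro integrableI_bounded borel_measurable_times borel_measurable_indicator powr_real_measurable) auto
qed

subsection \<open>Compactly supported functions of class C1\<close>

text \<open>Existence of some compact set outside which \<open>f\<close> vanishes, rather than a
  condition on the closure of the support, passes directly to products and compositions. The
  energies involve first derivatives only, and this class survives all the substitutions
  below.\<close>

definition C1c :: "(real^'n::finite) set \<Rightarrow> (real^'n \<Rightarrow> real) set" where
  "C1c \<Omega> = {f. (\<forall>x. (f has_derivative (\<lambda>h. grad f x \<bullet> h)) (at x)) \<and> continuous_on UNIV (grad f) \<and>
     (\<exists>K. compact K \<and> K \<subseteq> \<Omega> \<and> (\<forall>x. x \<notin> K \<longrightarrow> f x = 0))}"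

lemma grad_eqI:
  assumes "(f has_derivative (\<lambda>h. g \<bullet> h)) (at x)"
  shows "grad f x = g"
  unfolding grad_def partial_deriv_def frechet_derivative_at[OF assms, symmetric]
  by (simp add: vec_eq_iff inner_axis)

lemma C1cI:
  assumes d: "\<And>x. (f has_derivative (\<lambda>h. g x \<bullet> h)) (at x)" and "continuous_on UNIV g"
    and "compact K" "K \<subseteq> \<Omega>" "\<And>x. x \<notin> K \<Longrightarrow> f x = 0"
  shows "f \<in> C1c \<Omega>"
proof -
  have "grad f = g" using grad_eqI[OF d] by (intro ext)
  with assms show ?thesis unfolding C1c_def by blast
qed

lemma grad_eq_0_outside:
  fixes f :: "real^'n::finite \<Rightarrow> real"
  assumes "closed K" "\<And>x. x \<notin> K \<Longrightarrow> f x = 0" "x \<notin> K"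
  shows "(f has_derivative (\<lambda>h. 0)) (at x)" "grad f x = 0"
proof -
  show *: "(f has_derivative (\<lambda>h. 0)) (at x)"
  proof (rule has_derivative_transform_within_open[OF has_derivative_const])
    show "open (- K)" using assms(1) by auto
  qed (use assms in auto)
  show "grad f x = 0" by (rule grad_eqI) (use * in simp)
qed

lemma C1c_support:
  assumes "f \<in> C1c \<Omega>"
  shows "\<exists>K. compact K \<and> K \<subseteq> \<Omega> \<and> (\<forall>x. x \<notin> K \<longrightarrow> f x = 0 \<and> grad f x = 0)"
proof -
  obtain K where K: "compact K" "K \<subseteq> \<Omega>" "\<forall>x. x \<notin> K \<longrightarrow> f x = 0"
    using assms unfolding C1c_def by blast
  then have "grad f x = 0" if "x \<notin> K" for x
    using grad_eq_0_outside(2)[of K f x] compact_imp_closed[OF K(1)] that by simp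
  with K show ?thesis by blast
qed

lemma C1cD:
  assumes "f \<in> C1c \<Omega>"
  shows "(f has_derivative (\<lambda>h. grad f x \<bullet> h)) (at x within S)" "continuous_on S (grad f)" "continuous_on S f"
    "f \<in> borel_measurable borel" "grad f \<in> borel_measurable borel"
proof -
  show d: "(f has_derivative (\<lambda>h. grad f x \<bullet> h)) (at x within S)" for x S
    using assms has_derivative_at_withinI unfolding C1c_def by blast
  show "continuous_on S (grad f)" using assms continuous_on_subset[OF _ subset_UNIV] unfolding C1c_def by blast
  have "continuous_on UNIV f" by (rule has_derivative_continuous_on) (rule d)
  then show "continuous_on S f" using continuous_on_subset by blast
  show "f \<in> borel_measurable borel" by (rule borel_measurable_continuous_onI) fact
  show "grad f \<in> borel_measurable borel"
    by (rule borel_measurable_continuous_onI) (use assms in \<open>simp add: C1c_def\<close>)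
qed

lemma C1c_bounds:
  assumes "f \<in> C1c \<Omega>"
  obtains R M where "R > 0" "M > 0" "\<And>x. norm x > R \<Longrightarrow> f x = 0 \<and> grad f x = 0"
    "\<And>x. \<bar>f x\<bar> \<le> M" "\<And>x. norm (grad f x) \<le> M" "\<And>x y. \<bar>f x - f y\<bar> \<le> M * norm (x - y)"
proof -
  obtain K where K: "compact K" "K \<subseteq> \<Omega>" "\<And>x. x \<notin> K \<Longrightarrow> f x = 0" "\<And>x. x \<notin> K \<Longrightarrow> grad f x = 0"
    using C1c_support[OF assms] by blast
  obtain R where R: "R > 0" "\<And>x. x \<in> K \<Longrightarrow> norm x \<le> R"
    using compact_imp_bounded[OF K(1)] bounded_pos by metis
  have "compact (f ` K)" "compact (grad f ` K)"
    using K(1) C1cD[OF assms] by (auto intro: compact_continuous_image)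
  then obtain M1 M2 where M1: "M1 > 0" "\<And>x. x \<in> K \<Longrightarrow> norm (f x) \<le> M1" 
    and M2: "M2 > 0" "\<And>x. x \<in> K \<Longrightarrow> norm (grad f x) \<le> M2"
    using compact_imp_bounded bounded_pos by (metis imageI)
  define M where "M = M1 + M2"
  have g: "norm (grad f x) \<le> M" for x
    using M1(1) M2 K(4)[of x] by (cases "x \<in> K") (auto simp: M_def intro: add_increasing)
  have "\<bar>f x\<bar> \<le> M" for x
    using M1 M2(1) K(3)[of x] by (cases "x \<in> K") (auto simp: M_def intro: add_increasing2)
  moreover have "\<bar>f x - f y\<bar> \<le> M * norm (x - y)" for x y
  proof -
    have "norm (f x - f y) \<le> M * norm (x - y)"
    proof (rule differentiable_bound[of UNIV f "\<lambda>x h. grad f x \<bullet> h"])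
      fix x
      have "onorm ((\<bullet>) (grad f x)) \<le> M"
        by (rule onorm_le, unfold real_norm_def)
          (intro order_trans[OF Cauchy_Schwarz_ineq2] mult_right_mono g norm_ge_zero)
      then show "onorm (\<lambda>h. grad f x \<bullet> h) \<le> M" by simp
    qed (use C1cD(1)[OF assms] in auto)
    then show ?thesis by simp
  qed
  moreover have "f x = 0 \<and> grad f x = 0" if "norm x > R" for x
    using K(3,4) R(2) that by (meson not_le)
  ultimately show thesis using that[of R M] R(1) M1(1) M2(1) g by (auto simp: M_def)
qed

lemma C1c_subset: "\<Omega> \<subseteq> \<Omega>' \<Longrightarrow> C1c \<Omega> \<subseteq> C1c \<Omega>'"
  unfolding C1c_def by blast

text \<open>The factor \<open>g\<close> is controlled on \<open>\<Omega>\<close> only and may be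
  singular elsewhere, like powers of the norm at the origin. Since \<open>\<Omega>\<close> and the
  complement of the support of \<open>f\<close> are open and cover the space, regularity can be
  checked on each, and on the second the product is \<open>0\<close>.\<close>

lemma C1c_mult:
  assumes f: "f \<in> C1c \<Omega>" and \<Omega>: "open \<Omega>"
    and g: "\<And>x. x \<in> \<Omega> \<Longrightarrow> (g has_derivative (\<lambda>h. g' x \<bullet> h)) (at x)" "continuous_on \<Omega> g'"
  shows "(\<lambda>x. f x * g x) \<in> C1c \<Omega>" (is ?t1)
    "\<And>x. x \<in> \<Omega> \<Longrightarrow> grad (\<lambda>x. f x * g x) x = f x *\<^sub>R g' x + g x *\<^sub>R grad f x"
proof -
  obtain K where K: "compact K" "K \<subseteq> \<Omega>" "\<And>x. x \<notin> K \<Longrightarrow> f x = 0" "\<And>x. x \<notin> K \<Longrightarrow> grad f x = 0"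
    using C1c_support[OF f] by blast
  define G where "G x = f x *\<^sub>R g' x + g x *\<^sub>R grad f x" for x
  have z: "G x = 0" if "x \<notin> K" for x using K that by (simp add: G_def)
  have d: "((\<lambda>x. f x * g x) has_derivative (\<lambda>h. G x \<bullet> h)) (at x)" for x
  proof (cases "x \<in> \<Omega>")
    case True
    show ?thesis
      by (rule has_derivative_eq_rhs[OF has_derivative_mult[OF C1cD(1)[OF f] g(1)[OF True]]])
         (auto simp: G_def inner_add_left algebra_simps)
  next
    case False
    then have "x \<notin> K" using K by blast
    then show ?thesis
      using grad_eq_0_outside(1)[of K "\<lambda>x. f x * g x" x] K(3) z compact_imp_closed[OF K(1)] by simp
  qed
  have cg: "continuous_on \<Omega> g" by (rule has_derivative_continuous_on) (rule has_derivative_at_withinI[OF g(1)])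
  have "continuous_on \<Omega> G"
    unfolding G_def by (intro continuous_intros C1cD[OF f] g cg)
  moreover have "continuous_on (-K) G"
    using z by (subst continuous_on_cong[of _ _ _ "\<lambda>_. 0"]) auto
  ultimately have "continuous_on (\<Omega> \<union> -K) G"
    using \<Omega> K(1) by (intro continuous_on_open_Un) (auto simp: compact_imp_closed)
  moreover have "\<Omega> \<union> -K = UNIV" using K by auto
  ultimately have "continuous_on UNIV G" by simp
  then show ?t1 using d K(1-3) by (intro C1cI[of _ G K]) auto
  show "grad (\<lambda>x. f x * g x) x = f x *\<^sub>R g' x + g x *\<^sub>R grad f x" if "x \<in> \<Omega>" for x
    using grad_eqI[OF d] by (simp add: G_def)
qed

text \<open>The derivative of \<open>T\<close> is a symmetric map, so the chain rule applies the
  very same map to the gradient of \<open>f\<close>. The inverse \<open>T'\<close> supplies a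
  compact set outside which the composition vanishes.\<close>

lemma C1c_compose:
  fixes T :: "real^'n::finite \<Rightarrow> real^'n"
  assumes f: "f \<in> C1c \<Omega>'" and \<Omega>: "open \<Omega>" 
    and T: "\<And>x. x \<in> \<Omega> \<Longrightarrow> (T has_derivative (\<lambda>h. c x *\<^sub>R h + (d x * (v x \<bullet> h)) *\<^sub>R v x)) (at x)"
    and cont: "continuous_on \<Omega> c" "continuous_on \<Omega> d" "continuous_on \<Omega> v"
    and T': "continuous_on \<Omega>' T'" "\<And>x. x \<in> \<Omega> \<Longrightarrow> T x \<in> \<Omega>' \<and> T' (T x) = x" "\<And>y. y \<in> \<Omega>' \<Longrightarrow> T' y \<in> \<Omega> \<and> T (T' y) = y"
  shows "(\<lambda>x. if x \<in> \<Omega> then f (T x) else 0) \<in> C1c \<Omega>" (is "?F \<in> _")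
    "\<And>x. x \<in> \<Omega> \<Longrightarrow> grad (\<lambda>x. if x \<in> \<Omega> then f (T x) else 0) x =
        c x *\<^sub>R grad f (T x) + (d x * (v x \<bullet> grad f (T x))) *\<^sub>R v x"
proof -
  obtain K where K: "compact K" "K \<subseteq> \<Omega>'" "\<And>x. x \<notin> K \<Longrightarrow> f x = 0" "\<And>x. x \<notin> K \<Longrightarrow> grad f x = 0"
    using C1c_support[OF f] by blast
  define G where "G x = (if x \<in> \<Omega> then c x *\<^sub>R grad f (T x) + (d x * (v x \<bullet> grad f (T x))) *\<^sub>R v x else 0)" for x
  have K': "compact (T' ` K)" using K T'(1) by (meson compact_continuous_image continuous_on_subset)
  have K'\<Omega>: "T' ` K \<subseteq> \<Omega>" using K(2) T'(3) by blast
  have z0: "T x \<notin> K" if "x \<notin> T' ` K" "x \<in> \<Omega>" for x using that T'(2) by (metis imageI)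
  have zF: "?F x = 0" if "x \<notin> T' ` K" for x using that z0 K(3) by auto
  have zG: "G x = 0" if "x \<notin> T' ` K" for x using that z0 K(4) by (auto simp: G_def)
  have d: "(?F has_derivative (\<lambda>h. G x \<bullet> h)) (at x)" for x
  proof (cases "x \<in> \<Omega>")
    case True
    have "((\<lambda>x. f (T x)) has_derivative (\<lambda>h. grad f (T x) \<bullet> (c x *\<^sub>R h + (d x * (v x \<bullet> h)) *\<^sub>R v x))) (at x)"
      using has_derivative_compose[OF T[OF True] C1cD(1)[OF f]] by simp
    then have "((\<lambda>x. f (T x)) has_derivative (\<lambda>h. G x \<bullet> h)) (at x)"
      by (rule has_derivative_eq_rhs) (auto simp: G_def True inner_add_left inner_add_right inner_commute algebra_simps)
    then show ?thesis
      by (rule has_derivative_transform_within_open[OF _ \<Omega> True]) auto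
  next
    case False
    then have "x \<notin> T' ` K" using K'\<Omega> by blast
    then show ?thesis
      using grad_eq_0_outside(1)[of "T' ` K" ?F x, OF compact_imp_closed[OF K'] zF] zG by simp
  qed
  have cT: "continuous_on \<Omega> T" by (rule has_derivative_continuous_on) (rule has_derivative_at_withinI[OF T])
  have cf: "continuous_on \<Omega> (\<lambda>x. grad f (T x))"
    using continuous_on_compose2[OF C1cD(2)[OF f, of UNIV] cT] by simp
  have "continuous_on \<Omega> (\<lambda>x. c x *\<^sub>R grad f (T x) + (d x * (v x \<bullet> grad f (T x))) *\<^sub>R v x)"
    by (intro continuous_intros cont cf)
  then have "continuous_on \<Omega> G"
    by (subst continuous_on_cong[OF refl]) (auto simp: G_def)
  moreover have "continuous_on (- (T' ` K)) G"
    using zG by (subst continuous_on_cong[of _ _ _ "\<lambda>_. 0"]) auto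
  ultimately have "continuous_on (\<Omega> \<union> - (T' ` K)) G"
    using \<Omega> K' by (intro continuous_on_open_Un) (auto simp: compact_imp_closed)
  moreover have "\<Omega> \<union> - (T' ` K) = UNIV" using K'\<Omega> by auto
  ultimately have "continuous_on UNIV G" by simp
  then show "?F \<in> C1c \<Omega>" using d K' K'\<Omega> zF by (intro C1cI[of _ G "T' ` K"]) auto
  show "grad ?F x = c x *\<^sub>R grad f (T x) + (d x * (v x \<bullet> grad f (T x))) *\<^sub>R v x" if "x \<in> \<Omega>" for x
    using grad_eqI[OF d] that by (simp add: G_def)
qed

lemma integrable_bounded_support:
  fixes F :: "'a::euclidean_space \<Rightarrow> real"
  assumes [measurable]: "F \<in> borel_measurable borel" and "\<And>x. norm x > R \<Longrightarrow> F x = 0" "\<And>x. \<bar>F x\<bar> \<le> M"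
  shows "integrable lborel F"
proof (rule Bochner_Integration.integrable_bound)
  have "emeasure lborel (cball (0::'a) R) < \<infinity>" by (intro emeasure_bounded_finite) auto
  then show "integrable lborel (\<lambda>x::'a. M * indicator (cball 0 R) x)" by simp
  show "AE x in lborel. norm (F x) \<le> norm (M * indicator (cball 0 R) x)"
  proof (intro AE_I2)
    fix x :: 'a
    have "M \<ge> 0" using assms(3)[of 0] by linarith
    then show "norm (F x) \<le> norm (M * indicator (cball 0 R) x)"
      using assms(2)[of x] assms(3)[of x] by (auto simp: indicator_def not_le)
  qed
qed auto

lemma integrable_C1c:
  fixes F :: "real^'n::finite \<Rightarrow> real"
  assumes "f \<in> C1c \<Omega>"
  shows "integrable lborel f" "integrable lborel (\<lambda>x. (norm (grad f x))\<^sup>2)" "integrable lborel (\<lambda>x. grad f x \<bullet> e)"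
proof -
  obtain R M where RM: "R > 0" "M > 0" "\<And>x. norm x > R \<Longrightarrow> f x = 0 \<and> grad f x = 0"
    "\<And>x. \<bar>f x\<bar> \<le> M" "\<And>x. norm (grad f x) \<le> M" "\<And>x y. \<bar>f x - f y\<bar> \<le> M * norm (x - y)"
    using C1c_bounds[OF assms] by blast
  note [measurable] = C1cD(4,5)[OF assms]
  show "integrable lborel f" using RM by (intro integrable_bounded_support[of _ R M]) auto
  show "integrable lborel (\<lambda>x. (norm (grad f x))\<^sup>2)"
    using RM(3,5) by (intro integrable_bounded_support[of _ R "M\<^sup>2"]) (auto simp: power_mono)
  have "\<bar>grad f x \<bullet> e\<bar> \<le> M * norm e" for x
    by (meson Cauchy_Schwarz_ineq2 RM(5) mult_right_mono norm_ge_zero order_trans)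
  then show "integrable lborel (\<lambda>x. grad f x \<bullet> e)"
    using RM(3) by (intro integrable_bounded_support[of _ R "M * norm e"]) auto
qed

text \<open>Translation invariance of the integral, differentiated.\<close>

lemma integral_grad_eq_0:
  fixes f :: "real^'n::finite \<Rightarrow> real"
  assumes f: "f \<in> C1c \<Omega>"
  shows "(LINT x|lborel. grad f x \<bullet> e) = 0"
proof -
  obtain R M where RM: "R > 0" "M > 0" "\<And>x. norm x > R \<Longrightarrow> f x = 0 \<and> grad f x = 0"
    "\<And>x. \<bar>f x\<bar> \<le> M" "\<And>x. norm (grad f x) \<le> M" "\<And>x y. \<bar>f x - f y\<bar> \<le> M * norm (x - y)"
    using C1c_bounds[OF f] by blast
  note [measurable] = C1cD(4,5)[OF f]
  define t where "t j = 1 / real (Suc j)" for j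
  have t: "0 < t j" "t j \<le> 1" for j by (auto simp: t_def)
  have t0: "t \<longlonglongrightarrow> 0" unfolding t_def using LIMSEQ_inverse_real_of_nat by (simp add: inverse_eq_divide)
  define q where "q j x = (f (t j *\<^sub>R e + x) - f x) / t j" for j x
  have zero: "(LINT x|lborel. q j x) = 0" for j
  proof -
    have "integrable lborel (\<lambda>x. f (t j *\<^sub>R e + x))"
    proof (rule integrable_bounded_support[of _ "R + norm (t j *\<^sub>R e)" M])
      fix x :: "real^'n" assume "norm x > R + norm (t j *\<^sub>R e)"
      then show "f (t j *\<^sub>R e + x) = 0"
        using RM(3) norm_triangle_ineq4[of "t j *\<^sub>R e + x" "t j *\<^sub>R e"] by auto
    qed (use RM(4) in auto)
    then show ?thesis unfolding q_def
      using integral_translation[of f "t j *\<^sub>R e"] integrable_C1c(1)[OF f] by simp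
  qed
  have "(\<lambda>j. LINT x|lborel. q j x) \<longlonglongrightarrow> (LINT x|lborel. grad f x \<bullet> e)"
  proof (rule integral_dominated_convergence[where w = "\<lambda>x. M * norm e * indicator (cball 0 (R + norm e)) x"])
    have "emeasure lborel (cball (0::real^'n) (R + norm e)) < \<infinity>" by (intro emeasure_bounded_finite) auto
    then show "integrable lborel (\<lambda>x::real^'n. M * norm e * indicator (cball 0 (R + norm e)) x)"
      by (intro integrable_mult_right integrable_real_indicator) auto
    show "AE x in lborel. (\<lambda>j. q j x) \<longlonglongrightarrow> grad f x \<bullet> e"
    proof (intro AE_I2)
      fix x
      have "((\<lambda>s. f (s *\<^sub>R e + x)) has_derivative (\<lambda>h. grad f (0 *\<^sub>R e + x) \<bullet> (h *\<^sub>R e))) (at 0)"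
        by (rule has_derivative_compose[where f = "\<lambda>s. s *\<^sub>R e + x"]) (auto intro!: derivative_eq_intros C1cD(1)[OF f])
      then have "((\<lambda>s. f (s *\<^sub>R e + x)) has_field_derivative (grad f x \<bullet> e)) (at 0)"
        unfolding has_field_derivative_def by (rule has_derivative_eq_rhs) (auto simp: mult.commute)
      then have "((\<lambda>h. (f (h *\<^sub>R e + x) - f x) / h) \<longlongrightarrow> grad f x \<bullet> e) (at 0)"
        unfolding DERIV_def by simp
      moreover have "filterlim t (at 0) sequentially"
        using t0 t(1) by (auto simp: filterlim_at intro!: always_eventually) (metis less_irrefl)
      ultimately show "(\<lambda>j. q j x) \<longlonglongrightarrow> grad f x \<bullet> e"
        unfolding q_def by (rule filterlim_compose)
    qed
    fix j
    show "AE x in lborel. norm (q j x) \<le> M * norm e * indicator (cball 0 (R + norm e)) x"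
    proof (intro AE_I2)
      fix x
      have te: "norm (t j *\<^sub>R e) \<le> norm e" using t[of j] by (simp add: mult_left_le_one_le)
      show "norm (q j x) \<le> M * norm e * indicator (cball 0 (R + norm e)) x"
      proof (cases "norm x \<le> R + norm e")
        case True
        have "\<bar>f (t j *\<^sub>R e + x) - f x\<bar> \<le> M * (t j * norm e)"
          using RM(6)[of "t j *\<^sub>R e + x" x] t(1)[of j] by simp
        then show ?thesis using True t(1)[of j] by (simp add: q_def field_simps)
      next
        case False
        have "norm x \<le> norm (t j *\<^sub>R e + x) + norm (t j *\<^sub>R e)"
          using norm_triangle_ineq4[of "t j *\<^sub>R e + x" "t j *\<^sub>R e"] by simp
        then have "norm x > R" "norm (t j *\<^sub>R e + x) > R"
          using False te norm_ge_zero[of e] by linarith+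
        then show ?thesis using False RM(3) by (simp add: q_def)
      qed
    qed
  qed (unfold q_def, measurable)
  then show ?thesis unfolding zero by (simp add: LIMSEQ_const_iff)
qed

text \<open>The integrand is the divergence of the vector field \<open>\<phi> x *\<^sub>R x\<close>,
  a sum of partial derivatives of functions in \<open>C1c\<close>. The ground state substitution
  produces an error of precisely this form.\<close>

lemma integral_div_radial_eq_0:
  fixes \<phi> :: "real^'n::finite \<Rightarrow> real"
  assumes f: "\<phi> \<in> C1c \<Omega>"
  shows "(LINT x|lborel. grad \<phi> x \<bullet> x + real CARD('n) * \<phi> x) = 0"
    "integrable lborel (\<lambda>x. grad \<phi> x \<bullet> x + real CARD('n) * \<phi> x)"
proof -
  have fU: "\<phi> \<in> C1c UNIV" using C1c_subset f by blast
  have c: "(\<lambda>x. \<phi> x * x $ i) \<in> C1c UNIV" 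
    "grad (\<lambda>x. \<phi> x * x $ i) x = \<phi> x *\<^sub>R axis i 1 + x $ i *\<^sub>R grad \<phi> x" for i x
  proof -
    have d: "((\<lambda>x. x $ i) has_derivative (\<lambda>h. axis i 1 \<bullet> h)) (at x)" for x :: "real^'n"
      using bounded_linear_imp_has_derivative[OF bounded_linear_vec_nth, of i] by (simp add: inner_axis')
    show "(\<lambda>x. \<phi> x * x $ i) \<in> C1c UNIV" 
      "grad (\<lambda>x. \<phi> x * x $ i) x = \<phi> x *\<^sub>R axis i 1 + x $ i *\<^sub>R grad \<phi> x"
      using C1c_mult[OF fU open_UNIV d] by auto
  qed
  have e: "(\<Sum>i\<in>UNIV. grad (\<lambda>x. \<phi> x * x $ i) x \<bullet> axis i 1) = grad \<phi> x \<bullet> x + real CARD('n) * \<phi> x" for x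
    unfolding c by (simp add: inner_add_left inner_axis sum.distrib inner_vec_def[of "grad \<phi> x"] mult.commute)
  show "(LINT x|lborel. grad \<phi> x \<bullet> x + real CARD('n) * \<phi> x) = 0"
    unfolding e[symmetric] using integral_grad_eq_0[OF c(1)] integrable_C1c(3)[OF c(1)]
    by (subst Bochner_Integration.integral_sum) auto
  show "integrable lborel (\<lambda>x. grad \<phi> x \<bullet> x + real CARD('n) * \<phi> x)"
    unfolding e[symmetric] using integrable_C1c(3)[OF c(1)] by (intro Bochner_Integration.integrable_sum)
qed

section \<open>Smooth bump functions\<close>

primrec bump_poly :: "nat \<Rightarrow> real poly" where
  "bump_poly 0 = 1"
| "bump_poly (Suc m) = [:0, 0, 1:] * (bump_poly m - pderiv (bump_poly m))"

text \<open>Differentiating P(1/t) exp(-1/t) replaces P(s) by s^2 (P(s) - P'(s)), which is the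
  recursion of \<open>bump_poly\<close>. So \<open>bump m\<close> is the m-th derivative of the flat
  function \<open>bump 0\<close>, and the family is closed under differentiation.\<close>

definition bump :: "nat \<Rightarrow> real \<Rightarrow> real" where
  "bump m t = (if t > 0 then poly (bump_poly m) (1 / t) * exp (- 1 / t) else 0)"

lemma poly_times_exp_tendsto_0: "((\<lambda>s. poly q s * exp (- s)) \<longlongrightarrow> (0::real)) at_top"
proof -
  have "((\<lambda>s. \<Sum>i\<le>degree q. coeff q i * (s ^ i / exp s)) \<longlongrightarrow> (\<Sum>i\<le>degree q. coeff q i * 0)) at_top"
    by (intro tendsto_sum tendsto_mult tendsto_const tendsto_power_div_exp_0)
  moreover have "(\<Sum>i\<le>degree q. coeff q i * (s ^ i / exp s)) = poly q s * exp (- s)" for s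
    by (simp add: poly_altdef sum_distrib_right exp_minus divide_inverse mult.assoc)
  ultimately show ?thesis by simp
qed

lemma bump_derivative: "(bump m has_real_derivative bump (Suc m) t) (at t)"
proof -
  consider "t > 0" | "t < 0" | "t = 0" by linarith
  then show ?thesis
  proof cases
    case 1
    have "((\<lambda>t. poly (bump_poly m) (1 / t) * exp (- 1 / t)) has_real_derivative bump (Suc m) t) (at t)"
      using 1 by (auto intro!: derivative_eq_intros poly_DERIV[THEN DERIV_chain2]
          simp: bump_def field_simps power2_eq_square)
    then show ?thesis
      by (rule has_field_derivative_transform_within_open[of _ _ _ "{0<..}"]) (use 1 in \<open>auto simp: bump_def\<close>)
  next
    case 2
    show ?thesis
      by (rule has_field_derivative_transform_within_open[of "\<lambda>_. 0" _ _ "{..<0}"]) (use 2 in \<open>auto simp: bump_def\<close>)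
  next
    case 3
    \<comment> \<open>With s = 1/h the difference quotient at \<open>0\<close> from the right is s
      P(s) exp(-s), and \<open>pCons 0\<close> is multiplication by s.\<close>
    have "((\<lambda>s. poly (pCons 0 (bump_poly m)) s * exp (- s)) \<longlongrightarrow> 0) at_top"
      by (rule poly_times_exp_tendsto_0)
    then have "((\<lambda>h. poly (pCons 0 (bump_poly m)) (inverse h) * exp (- inverse h)) \<longlongrightarrow> 0) (at_right 0)"
      by (rule filterlim_compose[OF _ filterlim_inverse_at_top_right])
    then have r: "((\<lambda>h. bump m h / h) \<longlongrightarrow> 0) (at_right 0)"
      by (rule Lim_transform_eventually)
         (auto simp: bump_def eventually_at_filter divide_inverse)
    have l: "((\<lambda>h. bump m h / h) \<longlongrightarrow> 0) (at_left 0)"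
      by (rule Lim_transform_eventually[OF tendsto_const]) (auto simp: bump_def eventually_at_filter)
    have "((\<lambda>h. bump m h / h) \<longlongrightarrow> 0) (at 0)"
      using l r by (simp add: filterlim_at_split)
    then show ?thesis unfolding 3 DERIV_def by (simp add: bump_def)
  qed
qed

lemma continuous_on_bump: "continuous_on S (bump m)"
  using DERIV_isCont[OF bump_derivative] by (intro continuous_at_imp_continuous_on) auto

section \<open>Differentiability classes and test functions\<close>

lemma partial_deriv_eqI:
  "(f has_derivative f') (at x) \<Longrightarrow> partial_deriv i f x = f' (axis i 1)"
  unfolding partial_deriv_def using frechet_derivative_at by metis

lemma C_k_Suc_D: "C_k (Suc k) f \<Longrightarrow> C_k k f"
  by (induction k arbitrary: f) (auto intro: differentiable_imp_continuous_on)

lemma C_k_add: "C_k k f \<Longrightarrow> C_k k g \<Longrightarrow> C_k k (\<lambda>x. f x + g x)"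
proof (induction k arbitrary: f g)
  case (Suc k)
  have d: "f differentiable (at x)" "g differentiable (at x)" for x
    using Suc.prems by (auto simp: differentiable_on_def)
  have "partial_deriv i (\<lambda>x. f x + g x) = (\<lambda>x. partial_deriv i f x + partial_deriv i g x)" for i
    unfolding fun_eq_iff using partial_deriv_eqI[OF has_derivative_add[OF d[unfolded frechet_derivative_works]]]
    by (simp add: partial_deriv_def)
  then show ?case using Suc by (auto intro!: differentiable_on_add)
qed (auto intro: continuous_intros)

lemma C_k_mult: "C_k k f \<Longrightarrow> C_k k g \<Longrightarrow> C_k k (\<lambda>x. f x * g x)"
proof (induction k arbitrary: f g)
  case (Suc k)
  have d: "f differentiable (at x)" "g differentiable (at x)" for x
    using Suc.prems by (auto simp: differentiable_on_def)
  have "partial_deriv i (\<lambda>x. f x * g x) = (\<lambda>x. f x * partial_deriv i g x + partial_deriv i f x * g x)" for i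
    unfolding fun_eq_iff using partial_deriv_eqI[OF has_derivative_mult[OF d[unfolded frechet_derivative_works]]]
    by (simp add: partial_deriv_def)
  then show ?case using Suc C_k_Suc_D[OF Suc.prems(1)] C_k_Suc_D[OF Suc.prems(2)]
    by (auto intro!: differentiable_on_mult C_k_add)
qed (auto intro: continuous_intros)

lemma C_k_const: "C_k k (\<lambda>x::real^'n::finite. c)"
proof (induction k arbitrary: c)
  case (Suc k)
  have "partial_deriv i (\<lambda>x::real^'n. c) = (\<lambda>x. 0)" for i
    unfolding fun_eq_iff by (subst partial_deriv_eqI[of _ "\<lambda>_. 0"]) auto
  then show ?case using Suc by auto
qed auto

lemma C_k_component: "C_k k (\<lambda>x::real^'n::finite. x $ j)"
proof (cases k)
  case (Suc l)
  have d: "((\<lambda>x. x $ j) has_derivative (\<lambda>h. h $ j)) (at x)" for x :: "real^'n"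
    by (rule bounded_linear_imp_has_derivative[OF bounded_linear_vec_nth])
  have "partial_deriv i (\<lambda>x::real^'n. x $ j) = (\<lambda>x. axis i 1 $ j)" for i
    unfolding fun_eq_iff by (subst partial_deriv_eqI[OF d]) auto
  then show ?thesis using Suc d by (auto simp: C_k_const differentiable_on_def differentiable_def intro: has_derivative_at_withinI)
qed (auto intro: continuous_intros)

text \<open>A partial derivative of the function for \<open>m\<close> is the one for
  \<open>Suc m\<close> times \<open>(-2) * x $ i\<close>, so the induction on \<open>k\<close> has
  to leave \<open>m\<close> arbitrary.\<close>

lemma C_k_bump: "C_k k (\<lambda>x::real^'n::finite. bump m (a - (norm x)\<^sup>2))"
proof (induction k arbitrary: m)
  case 0
  show ?case
    by (simp, intro continuous_on_compose2[OF continuous_on_bump[of UNIV m]] continuous_intros) auto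
next
  case (Suc k)
  have d: "((\<lambda>x. bump m (a - (norm x)\<^sup>2)) has_derivative (\<lambda>h. bump (Suc m) (a - (norm x)\<^sup>2) * (- 2 * (x \<bullet> h)))) (at x)"
    for x :: "real^'n"
    unfolding power2_norm_eq_inner
    by (rule has_derivative_eq_rhs[OF has_derivative_compose[OF _ bump_derivative[unfolded has_field_derivative_def]]])
       (auto intro!: derivative_eq_intros simp: inner_commute)
  have "partial_deriv i (\<lambda>x::real^'n. bump m (a - (norm x)\<^sup>2)) = (\<lambda>x. bump (Suc m) (a - (norm x)\<^sup>2) * ((-2) * x $ i))" for i
    unfolding fun_eq_iff by (subst partial_deriv_eqI[OF d]) (auto simp: inner_axis)
  moreover have "C_k k (\<lambda>x::real^'n. bump (Suc m) (a - (norm x)\<^sup>2) * ((-2) * x $ i))" for i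
    by (intro C_k_mult Suc.IH C_k_const C_k_component)
  ultimately show ?case using d
    by (auto simp: differentiable_on_def differentiable_def intro: has_derivative_at_withinI)
qed

lemma C_k_has_grad:
  fixes f :: "real^'n::finite \<Rightarrow> real"
  assumes "C_k (Suc 0) f"
  shows "(f has_derivative (\<lambda>h. grad f x \<bullet> h)) (at x)" "continuous_on UNIV (grad f)"
proof -
  have D: "(f has_derivative frechet_derivative f (at x)) (at x)"
    using assms by (simp add: frechet_derivative_works[symmetric] differentiable_on_def)
  then interpret linear "frechet_derivative f (at x)" by (rule has_derivative_linear)
  have "frechet_derivative f (at x) h = grad f x \<bullet> h" for h
  proof -
    have "frechet_derivative f (at x) h = frechet_derivative f (at x) (\<Sum>i\<in>UNIV. h $ i *\<^sub>R axis i 1)"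
      using basis_expansion[of h] by (simp add: scalar_mult_eq_scaleR)
    also have "\<dots> = grad f x \<bullet> h"
      by (simp add: sum scale inner_vec_def grad_def partial_deriv_def mult.commute)
    finally show ?thesis .
  qed
  then have "frechet_derivative f (at x) = (\<lambda>h. grad f x \<bullet> h)" by (intro ext)
  then show "(f has_derivative (\<lambda>h. grad f x \<bullet> h)) (at x)" using D by simp
  show "continuous_on UNIV (grad f)"
    unfolding grad_def using assms by (intro continuous_on_vec_lambda) auto
qed

lemma test_functions_subset_C1c: "test_functions (\<Omega> :: (real^'n::finite) set) \<subseteq> C1c \<Omega>"
proof
  fix f assume f: "f \<in> test_functions \<Omega>"
  then have "C_k (Suc 0) f" unfolding test_functions_def by blast
  note d = C_k_has_grad[OF this]
  have "f x = 0" if "x \<notin> closure {x. f x \<noteq> 0}" for x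
    using that closure_subset[of "{x. f x \<noteq> 0}"] by auto
  moreover have "compact (closure {x. f x \<noteq> 0})" "closure {x. f x \<noteq> 0} \<subseteq> \<Omega>"
    using f unfolding test_functions_def by blast+
  ultimately show "f \<in> C1c \<Omega>" by (intro C1cI[OF d])
qed

lemma test_functionsI:
  assumes "\<And>k. C_k k f" "compact K" "K \<subseteq> \<Omega>" "\<And>x. x \<notin> K \<Longrightarrow> f x = 0"
  shows "f \<in> test_functions \<Omega>"
proof -
  have "closure {x. f x \<noteq> 0} \<subseteq> K"
    using assms by (intro closure_minimal) (auto simp: compact_imp_closed)
  then show ?thesis using assms unfolding test_functions_def
    by (auto simp: compact_eq_bounded_closed intro: bounded_subset)
qed

subsection \<open>Mollification\<close>

lemma integrable_continuous_bounded_support: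
  fixes F :: "'a::euclidean_space \<Rightarrow> 'b::{banach, second_countable_topology}"
  assumes "continuous_on UNIV F" "\<And>x. norm x > R \<Longrightarrow> F x = 0"
  shows "integrable lborel F"
proof -
  have "integrable lborel (\<lambda>x. indicator (cball 0 R) x *\<^sub>R F x)"
    by (rule borel_integrable_compact) (auto intro: continuous_on_subset[OF assms(1)])
  moreover have "indicator (cball 0 R) x *\<^sub>R F x = F x" for x
    using assms(2)[of x] by (auto simp: indicator_def)
  ultimately show ?thesis by simp
qed

definition mollifier :: "real \<Rightarrow> real^'n::finite \<Rightarrow> real" where
  "mollifier \<delta> x = bump 0 (\<delta>\<^sup>2 - (norm x)\<^sup>2) / (LINT y|lborel. bump 0 (\<delta>\<^sup>2 - (norm (y::real^'n))\<^sup>2))"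

text \<open>Convolution written with \<open>x + z\<close>, which agrees with the usual one because
  \<open>mollifier\<close> is even. In this form \<open>f\<close> appears through its translates,
  which suits the estimates of increments.\<close>

definition mollify :: "real \<Rightarrow> (real^'n::finite \<Rightarrow> 'b::{banach, second_countable_topology}) \<Rightarrow> real^'n \<Rightarrow> 'b" where
  "mollify \<delta> f x = (LINT z|lborel. mollifier \<delta> z *\<^sub>R f (x + z))"

lemma bump_0_bounds: "0 \<le> bump 0 t" "bump 0 t \<le> 1" "bump 0 t > 0 \<longleftrightarrow> t > 0"
  by (auto simp: bump_def)

context
  fixes \<delta> :: real
  assumes \<delta>: "\<delta> > 0"
begin

lemma bump_norm_eq_0: "bump 0 (\<delta>\<^sup>2 - (norm x)\<^sup>2) = 0 \<longleftrightarrow> norm x \<ge> \<delta>"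
proof -
  have "norm x \<ge> \<delta> \<longleftrightarrow> \<not> \<delta>\<^sup>2 - (norm x)\<^sup>2 > 0"
    using \<delta> by (metis abs_le_square_iff abs_norm_cancel abs_of_pos diff_gt_0_iff_gt not_less)
  then show ?thesis by (simp add: bump_def del: diff_gt_0_iff_gt)
qed

lemma continuous_bump_norm: "continuous_on S (\<lambda>x::real^'n::finite. bump m (\<delta>\<^sup>2 - (norm x)\<^sup>2))"
  using C_k_bump[of 0 m "\<delta>\<^sup>2"] by (auto intro: continuous_on_subset)

lemma bump_mass:
  "integrable lborel (\<lambda>x::real^'n::finite. bump 0 (\<delta>\<^sup>2 - (norm x)\<^sup>2))" (is "integrable _ ?b")
  "(LINT x|lborel. bump 0 (\<delta>\<^sup>2 - (norm (x::real^'n))\<^sup>2)) > 0"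
proof -
  show i: "integrable lborel ?b"
    by (rule integrable_bounded_support[of _ \<delta> 1])
       (auto simp: bump_norm_eq_0 bump_0_bounds intro!: borel_measurable_continuous_onI continuous_bump_norm)
  have "(LINT x|lborel. ?b x) \<noteq> 0"
  proof
    assume "(LINT x|lborel. ?b x) = 0"
    then have "AE x in lborel. ?b x = 0"
      using integral_nonneg_eq_0_iff_AE[OF i] bump_0_bounds(1) by auto
    then have "AE x in lborel. x \<notin> ball (0::real^'n) \<delta>" 
      by eventually_elim (simp add: bump_norm_eq_0)
    then have "emeasure lborel (ball (0::real^'n) \<delta>) = 0"
      by (subst (asm) AE_iff_measurable[OF _ refl]) (auto simp: ball_def)
    moreover have "0 < unit_ball_vol (real CARD('n)) * \<delta> ^ CARD('n)"
      using \<delta> by (intro mult_pos_pos) auto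
    then have "emeasure lborel (ball (0::real^'n) \<delta>) > 0"
      using \<delta> by (simp add: emeasure_ball)
    ultimately show False by simp
  qed
  then show "(LINT x|lborel. ?b x) > 0"
    using Bochner_Integration.integral_nonneg[of lborel ?b, OF bump_0_bounds(1)] by linarith
qed

lemma mollifier_nonneg: "mollifier \<delta> x \<ge> 0"
  using bump_mass(2) bump_0_bounds(1) by (simp add: mollifier_def less_imp_le)

lemma mollifier_eq_0: "norm x \<ge> \<delta> \<Longrightarrow> mollifier \<delta> x = 0"
  by (simp add: mollifier_def bump_norm_eq_0)

lemma mollifier_continuous: "continuous_on S (mollifier \<delta> :: real^'n::finite \<Rightarrow> real)"
  unfolding mollifier_def using bump_mass(2)[where 'n = 'n] by (intro continuous_intros continuous_bump_norm) auto

lemma mollifier_measurable [measurable]: "mollifier \<delta> \<in> borel_measurable borel"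
  by (intro borel_measurable_continuous_onI mollifier_continuous)

lemma C_k_mollifier: "C_k k (mollifier \<delta>)"
  unfolding mollifier_def divide_inverse by (intro C_k_mult C_k_const C_k_bump)

lemma mollifier_integrable: "integrable lborel (mollifier \<delta> :: real^'n::finite \<Rightarrow> real)"
  and mollifier_integral: "(LINT x|lborel. mollifier \<delta> (x::real^'n)) = 1"
  unfolding mollifier_def using bump_mass[where 'n = 'n] by auto

lemma mollifier_minus: "mollifier \<delta> (- x) = mollifier \<delta> x" "mollifier \<delta> (x - y) = mollifier \<delta> (y - x)"
  by (simp_all add: mollifier_def norm_minus_commute)

lemma integrable_mollifier_times:
  fixes f :: "real^'n::finite \<Rightarrow> 'b::{banach, second_countable_topology}"
  assumes f: "continuous_on UNIV f"
  shows "integrable lborel (\<lambda>z. mollifier \<delta> z *\<^sub>R f (x + z))"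
  by (rule integrable_continuous_bounded_support[where R = \<delta>])
     (auto intro!: continuous_intros mollifier_continuous continuous_on_compose2[OF f] simp: mollifier_eq_0)

lemma mollify_eq_0:
  assumes "\<And>z. norm z \<le> \<delta> \<Longrightarrow> f (x + z) = 0" shows "mollify \<delta> f x = 0"
proof -
  have "mollifier \<delta> z *\<^sub>R f (x + z) = 0" for z
    using assms[of z] mollifier_eq_0[of z] by (cases "norm z \<le> \<delta>") auto
  then have "(\<lambda>z. mollifier \<delta> z *\<^sub>R f (x + z)) = (\<lambda>z. 0)" by (rule ext)
  then show ?thesis by (simp only: mollify_def) simp
qed

lemma mollify_close:
  fixes f :: "real^'n::finite \<Rightarrow> 'b::{banach, second_countable_topology}"
  assumes f: "continuous_on UNIV f" and e: "\<And>z. norm z \<le> \<delta> \<Longrightarrow> norm (f (x + z) - f x) \<le> e"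
  shows "norm (mollify \<delta> f x - f x) \<le> e"
proof -
  have "mollify \<delta> f x - f x = (LINT z|lborel. mollifier \<delta> z *\<^sub>R f (x + z)) - (LINT z|lborel. mollifier \<delta> (z::real^'n) *\<^sub>R f x)"
    by (simp add: mollify_def integral_scaleR_left[OF mollifier_integrable] mollifier_integral)
  also have "\<dots> = (LINT z|lborel. mollifier \<delta> z *\<^sub>R (f (x + z) - f x))"
    using mollifier_integrable by (subst Bochner_Integration.integral_diff[symmetric])
      (auto simp: scaleR_diff_right intro!: integrable_mollifier_times f)
  also have "norm \<dots> \<le> (LINT z|lborel. e * mollifier \<delta> (z::real^'n))"
  proof (rule Bochner_Integration.integral_norm_bound[THEN order_trans], rule integral_mono)
    show "integrable lborel (\<lambda>z. norm (mollifier \<delta> z *\<^sub>R (f (x + z) - f x)))"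
      unfolding scaleR_diff_right using mollifier_integrable
      by (intro integrable_norm Bochner_Integration.integrable_diff integrable_mollifier_times f) auto
    fix z :: "real^'n"
    show "norm (mollifier \<delta> z *\<^sub>R (f (x + z) - f x)) \<le> e * mollifier \<delta> z"
      using mult_right_mono[OF e[of z] mollifier_nonneg[of z]] mollifier_nonneg[of z] mollifier_eq_0[of z]
      by (cases "norm z \<le> \<delta>") (auto simp: mult.commute)
  qed (use mollifier_integrable in auto)
  finally show ?thesis by (simp add: mollifier_integral)
qed

end

text \<open>Differentiation under the integral sign, for either sign of the integration variable, so that it
  applies both to the mollifier and to the mollified function.\<close>

lemma has_derivative_integral_param:
  fixes \<psi> w :: "real^'n::finite \<Rightarrow> real" and G :: "real^'n \<Rightarrow> real^'n"
  assumes w: "continuous_on UNIV w" "\<And>t. norm t > R \<Longrightarrow> w t = 0"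
    and d: "\<And>x. (\<psi> has_derivative (\<lambda>h. G x \<bullet> h)) (at x)" and G: "continuous_on UNIV G"
  shows "((\<lambda>x. LINT t|lborel. w t * \<psi> (x + \<sigma> *\<^sub>R t)) has_derivative
     (\<lambda>h. (LINT t|lborel. w t *\<^sub>R G (x + \<sigma> *\<^sub>R t)) \<bullet> h)) (at x)"
proof -
  \<comment> \<open>A box containing the support of \<open>w\<close> brings the integral into the
    form that \<open>leibniz_rule\<close> treats.\<close>
  obtain B where B: "cball 0 R \<subseteq> cbox (-B) (B::real^'n)"
    by (metis bounded_cball bounded_subset_cbox_symmetric)
  have c\<psi>: "continuous_on UNIV \<psi>" 
    by (rule has_derivative_continuous_on) (rule has_derivative_at_withinI[OF d])
  have lint: "(LINT t|lborel. w t *\<^sub>R q t) = integral (cbox (-B) B) (\<lambda>t. w t *\<^sub>R q t)"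
    if "continuous_on UNIV q" for q :: "real^'n \<Rightarrow> 'c::euclidean_space"
  proof -
    have "integrable lborel (\<lambda>t. indicator (cbox (-B) B) t *\<^sub>R (w t *\<^sub>R q t))"
      by (rule borel_integrable_compact) (auto intro!: continuous_intros continuous_on_subset[OF w(1)] continuous_on_subset[OF that])
    then have "set_integrable lborel (cbox (-B) B) (\<lambda>t. w t *\<^sub>R q t)"
      unfolding set_integrable_def .
    note set_borel_integral_eq_integral(2)[OF this]
    moreover have "indicator (cbox (-B) B) t *\<^sub>R (w t *\<^sub>R q t) = w t *\<^sub>R q t" for t
    proof (cases "norm t > R")
      case False
      then have "t \<in> cbox (-B) B" using B by (auto simp: subset_iff)
      then show ?thesis by simp
    qed (simp add: w)
    ultimately show ?thesis by (simp only: set_lebesgue_integral_def)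
  qed
  have cG: "continuous_on UNIV (\<lambda>t. G (x + \<sigma> *\<^sub>R t))" for x
    by (intro continuous_on_compose2[OF G] continuous_intros) auto
  have c\<psi>': "continuous_on UNIV (\<lambda>t. \<psi> (x + \<sigma> *\<^sub>R t))" for x
    by (intro continuous_on_compose2[OF c\<psi>] continuous_intros) auto
  \<comment> \<open>The derivative is handled as a bounded linear map through
    \<open>blinfun_inner_right\<close>, because differentiation under the integral asks for joint
    continuity in that normed space.\<close>
  have "((\<lambda>x. integral (cbox (-B) B) (\<lambda>t. w t *\<^sub>R \<psi> (x + \<sigma> *\<^sub>R t))) has_derivative
      integral (cbox (-B) B) (\<lambda>t. blinfun_inner_right (w t *\<^sub>R G (x + \<sigma> *\<^sub>R t)))) (at x within UNIV)"
  proof (rule leibniz_rule)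
    fix x t
    have "((\<lambda>x. \<psi> (x + \<sigma> *\<^sub>R t)) has_derivative (\<lambda>h. G (x + \<sigma> *\<^sub>R t) \<bullet> h)) (at x)"
      by (rule has_derivative_compose[OF _ d]) (auto intro!: derivative_eq_intros)
    then have "((\<lambda>x. w t *\<^sub>R \<psi> (x + \<sigma> *\<^sub>R t)) has_derivative (\<lambda>h. w t *\<^sub>R (G (x + \<sigma> *\<^sub>R t) \<bullet> h))) (at x)"
      by (rule has_derivative_scaleR_right)
    then show "((\<lambda>x. w t *\<^sub>R \<psi> (x + \<sigma> *\<^sub>R t)) has_derivative blinfun_inner_right (w t *\<^sub>R G (x + \<sigma> *\<^sub>R t))) (at x within UNIV)"
      by (simp, elim has_derivative_eq_rhs) (simp add: fun_eq_iff)
  next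
    fix x show "(\<lambda>t. w t *\<^sub>R \<psi> (x + \<sigma> *\<^sub>R t)) integrable_on cbox (-B) B"
      by (intro integrable_continuous continuous_intros continuous_on_subset[OF w(1)] continuous_on_subset[OF c\<psi>']) auto
  next
    have "continuous_on (UNIV \<times> cbox (-B) B) (\<lambda>p. blinfun_inner_right (w (snd p) *\<^sub>R G (fst p + \<sigma> *\<^sub>R snd p)))"
      by (intro continuous_intros bounded_linear.continuous_on[OF bounded_linear_blinfun_inner_right]
          continuous_on_compose2[OF w(1)] continuous_on_compose2[OF G]) auto
    then show "continuous_on (UNIV \<times> cbox (-B) B) (\<lambda>(x, t). blinfun_inner_right (w t *\<^sub>R G (x + \<sigma> *\<^sub>R t)))"
      by (simp add: case_prod_beta)
  qed auto
  moreover have "integral (cbox (-B) B) (\<lambda>t. blinfun_inner_right (w t *\<^sub>R G (x + \<sigma> *\<^sub>R t))) =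
      blinfun_inner_right (integral (cbox (-B) B) (\<lambda>t. w t *\<^sub>R G (x + \<sigma> *\<^sub>R t)))"
    by (rule integral_linear[OF _ bounded_linear_blinfun_inner_right, unfolded o_def])
       (intro integrable_continuous continuous_intros continuous_on_subset[OF w(1)] continuous_on_subset[OF cG], auto)
  ultimately show ?thesis
    using lint[OF cG] lint[OF c\<psi>'] by simp
qed

text \<open>All derivatives fall on \<open>\<psi>\<close>, so \<open>f\<close> has only to be
  continuous. The smoothness hypothesis holds for every \<open>k\<close> and therefore passes to the
  partial derivatives of \<open>\<psi>\<close> in the induction.\<close>

lemma C_k_convolution:
  fixes \<psi> f :: "real^'n::finite \<Rightarrow> real"
  assumes f: "continuous_on UNIV f" "\<And>t. norm t > R \<Longrightarrow> f t = 0" and "\<And>k. C_k k \<psi>"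
  shows "C_k k (\<lambda>x. LINT t|lborel. f t * \<psi> (x - t))"
  using assms(3)
proof (induction k arbitrary: \<psi>)
  case 0
  note d = C_k_has_grad[OF 0]
  have "continuous_on UNIV (\<lambda>x. LINT t|lborel. f t * \<psi> (x + (-1) *\<^sub>R t))"
    by (rule has_derivative_continuous_on) (rule has_derivative_at_withinI[OF has_derivative_integral_param[OF f d]])
  then show ?case by simp
next
  case (Suc k)
  note d = C_k_has_grad[OF Suc.prems]
  note D = has_derivative_integral_param[OF f d, where \<sigma> = "-1", simplified]
  have "partial_deriv i (\<lambda>x. LINT t|lborel. f t * \<psi> (x - t)) = (\<lambda>x. LINT t|lborel. f t * partial_deriv i \<psi> (x - t))" for i
  proof
    fix x
    have "integrable lborel (\<lambda>t. f t *\<^sub>R grad \<psi> (x - t))"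
      by (rule integrable_continuous_bounded_support[where R = R])
         (auto intro!: continuous_intros f continuous_on_compose2[OF d(2)])
    then have "(LINT t|lborel. f t *\<^sub>R grad \<psi> (x - t)) \<bullet> axis i 1 = (LINT t|lborel. (f t *\<^sub>R grad \<psi> (x - t)) \<bullet> axis i 1)"
      by (simp only: integral_inner_left)
    then show "partial_deriv i (\<lambda>x. LINT t|lborel. f t * \<psi> (x - t)) x = (LINT t|lborel. f t * partial_deriv i \<psi> (x - t))"
      using partial_deriv_eqI[OF D] by (simp add: inner_axis grad_def)
  qed
  moreover have "C_k k (\<lambda>x. LINT t|lborel. f t * partial_deriv i \<psi> (x - t))" for i
  proof (rule Suc.IH)
    fix k show "C_k k (partial_deriv i \<psi>)" using Suc.prems[of "Suc k"] by simp
  qed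
  moreover have "(\<lambda>x. LINT t|lborel. f t * \<psi> (x - t)) differentiable_on UNIV"
    using D by (auto simp: differentiable_on_def differentiable_def intro: has_derivative_at_withinI)
  ultimately show ?case by simp
qed

lemma C_k_mollify:
  fixes f :: "real^'n::finite \<Rightarrow> real"
  assumes \<delta>: "\<delta> > 0" and f: "continuous_on UNIV f" "\<And>t. norm t > R \<Longrightarrow> f t = 0"
  shows "C_k k (mollify \<delta> f)"
proof -
  have "mollify \<delta> f x = (LINT t|lborel. f t * mollifier \<delta> (x - t))" for x
  proof -
    have [measurable]: "f \<in> borel_measurable borel" using f(1) by (rule borel_measurable_continuous_onI)
    note [measurable] = mollifier_measurable[OF \<delta>, where 'a = 'n]
    \<comment> \<open>Translation moves the variable \<open>x\<close> from \<open>f\<close>, which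
      is only continuous, to the smooth mollifier.\<close>
    have "(LINT t|lborel. f (x + t) * mollifier \<delta> (x - (x + t))) = (LINT t|lborel. f t * mollifier \<delta> (x - t))"
      by (rule integral_translation[of "\<lambda>t. f t * mollifier \<delta> (x - t)"]) measurable
    then show ?thesis by (simp add: mollify_def mollifier_minus[OF \<delta>] mult.commute)
  qed
  then have "mollify \<delta> f = (\<lambda>x. LINT t|lborel. f t * mollifier \<delta> (x - t))" by (rule ext)
  then show ?thesis using C_k_convolution[OF f C_k_mollifier[OF \<delta>]] by simp
qed

lemma mollify_has_derivative:
  fixes f :: "real^'n::finite \<Rightarrow> real"
  assumes \<delta>: "\<delta> > 0" and f: "f \<in> C1c \<Omega>"
  shows "(mollify \<delta> f has_derivative (\<lambda>h. mollify \<delta> (grad f) x \<bullet> h)) (at x)"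
  using has_derivative_integral_param[OF mollifier_continuous[OF \<delta>] mollifier_eq_0[OF \<delta> less_imp_le] C1cD(1)[OF f] C1cD(2)[OF f], where \<sigma> = 1 and x = x]
  by (simp add: mollify_def[abs_def])

text \<open>Reflections in hyperplanes through the origin preserve the mollifier and the radial
  function, and one of them maps \<open>x\<close> to \<open>y\<close>.\<close>

lemma mollify_radial:
  fixes f :: "real^'n::finite \<Rightarrow> real"
  assumes \<delta>: "\<delta> > 0" and f: "continuous_on UNIV f" and rad: "\<And>x y. norm x = norm y \<Longrightarrow> f x = f y"
    and "norm x = norm y"
  shows "mollify \<delta> f x = mollify \<delta> f y"
proof (cases "x = y")
  case False
  have [measurable]: "f \<in> borel_measurable borel" using f by (rule borel_measurable_continuous_onI)
  note [measurable] = mollifier_measurable[OF \<delta>, where 'a = 'n]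
  obtain \<nu> where \<nu>: "norm \<nu> = 1" "mirror \<nu> 0 x = y" using mirror_maps_sphere[OF assms(4) False] .
  have n: "norm (mirror \<nu> 0 z) = norm z" for z
    using dist_mirror[OF \<nu>(1), where x = z and y = 0 and t = 0] by (simp add: mirror_def)
  have a: "mirror \<nu> 0 x + mirror \<nu> 0 z = mirror \<nu> 0 (x + z)" for z
    by (simp add: mirror_def algebra_simps)
  have "mollify \<delta> f y = (LINT z|lborel. mollifier \<delta> (mirror \<nu> 0 z) *\<^sub>R f (mirror \<nu> 0 x + mirror \<nu> 0 z))"
    unfolding mollify_def \<nu>(2)[symmetric] by (rule integral_mirror[OF \<nu>(1), symmetric]) measurable
  also have "\<dots> = mollify \<delta> f x"
    unfolding mollify_def a using rad[OF n] by (simp add: mollifier_def n)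
  finally show ?thesis ..
qed simp

lemma uniformly_continuous_bounded_support:
  fixes f :: "'a::euclidean_space \<Rightarrow> 'b::real_normed_vector"
  assumes f: "continuous_on UNIV f" "\<And>x. norm x > R \<Longrightarrow> f x = 0" and e: "e > 0"
  shows "\<exists>d>0. \<forall>x z. norm z \<le> d \<longrightarrow> norm (f (x + z) - f x) \<le> e"
proof -
  have "uniformly_continuous_on (cball 0 (R + 1)) f"
    using f(1) by (intro compact_uniformly_continuous) (auto intro: continuous_on_subset)
  then obtain d where d: "d > 0" "\<And>x y. x \<in> cball 0 (R+1) \<Longrightarrow> y \<in> cball 0 (R+1) \<Longrightarrow> dist y x < d \<Longrightarrow> dist (f y) (f x) < e"
    using e unfolding uniformly_continuous_on_def by metis
  have "norm (f (x + z) - f x) \<le> e" if z: "norm z \<le> min (d/2) 1" for x z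
  proof (cases "norm x > R \<and> norm (x + z) > R")
    case False
    have "norm x \<le> norm (x + z) + norm z" using norm_triangle_ineq4[of "x + z" z] by simp
    moreover have "norm (x + z) \<le> norm x + norm z" by (rule norm_triangle_ineq)
    ultimately have "x \<in> cball 0 (R+1)" "x + z \<in> cball 0 (R+1)" using False z by auto
    moreover have "dist (x + z) x < d" using z d(1) by (simp add: dist_norm)
    ultimately show ?thesis using d(2)[of x "x + z"] by (simp add: dist_norm)
  qed (use f(2) e in simp)
  then show ?thesis using d(1) by (intro exI[of _ "min (d/2) 1"]) auto
qed

text \<open>A common compact set for the supports makes dominated convergence available for every
  functional of the approximating sequence.\<close>

lemma C1c_approximation:
  fixes f :: "real^'n::finite \<Rightarrow> real"
  assumes f: "f \<in> C1c \<Omega>" and \<Omega>: "open \<Omega>"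
  obtains F K where "compact K" "K \<subseteq> \<Omega>" "\<And>j. F j \<in> test_functions \<Omega>"
    "\<And>j x. x \<notin> K \<Longrightarrow> F j x = 0 \<and> grad (F j) x = 0" "\<And>x. x \<notin> K \<Longrightarrow> f x = 0 \<and> grad f x = 0"
    "\<And>j x. \<bar>F j x - f x\<bar> \<le> 1 / Suc j" "\<And>j x. norm (grad (F j) x - grad f x) \<le> 1 / Suc j"
proof -
  obtain K0 where K0: "compact K0" "K0 \<subseteq> \<Omega>" "\<And>x. x \<notin> K0 \<Longrightarrow> f x = 0 \<and> grad f x = 0"
    using C1c_support[OF f] by blast
  obtain R M where R: "\<And>x. norm x > R \<Longrightarrow> f x = 0 \<and> grad f x = 0"
    using C1c_bounds[OF f] by metis
  obtain r where r: "r > 0" "\<And>x y. x \<in> K0 \<Longrightarrow> y \<in> - \<Omega> \<Longrightarrow> r \<le> dist x y"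
  proof -
    have "\<exists>r>0. \<forall>x\<in>K0. \<forall>y\<in>- \<Omega>. r \<le> dist x y"
      using K0 \<Omega> by (intro separate_compact_closed) auto
    then show thesis using that by blast
  qed
  \<comment> \<open>Half the distance to the complement of \<open>\<Omega>\<close> leaves room,
    within one compact set, for every mollification radius \<open>d j \<le> r/2\<close>.\<close>
  define K where "K = {x + y | x y. x \<in> K0 \<and> y \<in> cball 0 (r/2)}"
  have K: "compact K" unfolding K_def by (rule compact_sums[OF K0(1) compact_cball])
  have K\<Omega>: "K \<subseteq> \<Omega>"
  proof
    fix x assume "x \<in> K"
    then obtain a b where ab: "a \<in> K0" "norm b \<le> r/2" "x = a + b" by (auto simp: K_def)
    then have "dist a x < r" using r(1) by (simp add: dist_norm)
    then show "x \<in> \<Omega>" using r(2)[OF ab(1), of x] by auto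
  qed
  have K0K: "x + z \<notin> K0" if "x \<notin> K" "norm z \<le> r/2" for x z
  proof
    assume "x + z \<in> K0"
    then have "(x + z) + (- z) \<in> K" using that(2) unfolding K_def by (intro CollectI exI[of _ "x + z"] exI[of _ "- z"]) auto
    with that(1) show False by simp
  qed
  have "\<exists>d>0. d \<le> r/2 \<and> (\<forall>x z. norm z \<le> d \<longrightarrow> norm (f (x + z) - f x) \<le> 1 / Suc j \<and> norm (grad f (x + z) - grad f x) \<le> 1 / Suc j)" for j
  proof -
    obtain d1 where d1: "d1 > 0" "\<And>x z. norm z \<le> d1 \<Longrightarrow> norm (f (x + z) - f x) \<le> 1 / Suc j"
      using uniformly_continuous_bounded_support[of f R "1 / Suc j"] C1cD(3)[OF f] R by auto
    obtain d2 where d2: "d2 > 0" "\<And>x z. norm z \<le> d2 \<Longrightarrow> norm (grad f (x + z) - grad f x) \<le> 1 / Suc j"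
      using uniformly_continuous_bounded_support[of "grad f" R "1 / Suc j"] C1cD(2)[OF f] R by auto
    show ?thesis using d1 d2 r(1) by (intro exI[of _ "min (min d1 d2) (r/2)"]) auto
  qed
  then obtain d where d: "\<And>j. d j > 0" "\<And>j. d j \<le> r/2"
    "\<And>j x z. norm z \<le> d j \<Longrightarrow> norm (f (x + z) - f x) \<le> 1 / Suc j"
    "\<And>j x z. norm z \<le> d j \<Longrightarrow> norm (grad f (x + z) - grad f x) \<le> 1 / Suc j" by metis
  define F where "F j = mollify (d j) f" for j
  have gF: "grad (F j) x = mollify (d j) (grad f) x" for j x
    unfolding F_def by (rule grad_eqI[OF mollify_has_derivative[OF d(1) f]])
  have z: "F j x = 0 \<and> grad (F j) x = 0" if "x \<notin> K" for j x
  proof -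
    have "f (x + z) = 0 \<and> grad f (x + z) = 0" if "norm z \<le> d j" for z
      using K0(3) K0K[OF \<open>x \<notin> K\<close>] that d(2)[of j] by (meson order_trans)
    then show ?thesis unfolding gF unfolding F_def by (auto intro!: mollify_eq_0[OF d(1)])
  qed
  show thesis
  proof (rule that[OF K K\<Omega>])
    show "F j \<in> test_functions \<Omega>" for j
    proof (rule test_functionsI[OF _ K K\<Omega>])
      show "C_k k (F j)" for k
        unfolding F_def using R by (intro C_k_mollify[OF d(1) C1cD(3)[OF f]]) auto
    qed (use z in auto)
    have "norm (F j x - f x) \<le> 1 / Suc j" for j x
      unfolding F_def by (rule mollify_close[where f = f, OF d(1) C1cD(3)[OF f] d(3)])
    then show "\<bar>F j x - f x\<bar> \<le> 1 / Suc j" for j x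
      by (simp only: real_norm_def)
    show "norm (grad (F j) x - grad f x) \<le> 1 / Suc j" for j x
      unfolding gF by (rule mollify_close[where f = "grad f", OF d(1) C1cD(2)[OF f] d(4)])
    show "f x = 0 \<and> grad f x = 0" if "x \<notin> K" for x
      using K0(3)[of "x + 0"] K0K[OF that, of 0] r(1) by simp
  qed (use z in auto)
qed

subsection \<open>Polarization\<close>

lemma integral_pos_continuous:
  fixes F :: "'a::euclidean_space \<Rightarrow> real"
  assumes "continuous_on UNIV F" "\<And>x. F x \<ge> 0" "integrable lborel F" "F a > 0"
  shows "(LINT x|lborel. F x) > 0"
proof -
  have "(LINT x|lborel. F x) \<noteq> 0"
  proof
    assume "(LINT x|lborel. F x) = 0"
    then have "AE x in lborel. F x = 0"
      using integral_nonneg_eq_0_iff_AE[OF assms(3)] assms(2) by auto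
    moreover have "open {x. F x > 0}"
      using open_Collect_less[OF continuous_on_const assms(1)] by simp
    then obtain r where r: "r > 0" "ball a r \<subseteq> {x. F x > 0}"
      using assms(4) by (auto simp: open_contains_ball)
    ultimately have "AE x in lborel. x \<notin> ball a r"
      by (auto elim!: eventually_mono)
    then have "emeasure lborel (ball a r) = 0"
      by (subst (asm) AE_iff_measurable[OF _ refl]) (auto simp: ball_def)
    moreover have "0 < unit_ball_vol (real DIM('a)) * r ^ DIM('a)"
      using r(1) by (intro mult_pos_pos) auto
    then have "emeasure lborel (ball a r) > 0"
      using r(1) by (simp add: emeasure_ball)
    ultimately show False by simp
  qed
  moreover have "(LINT x|lborel. F x) \<ge> 0" using assms(2) by (rule Bochner_Integration.integral_nonneg)
  ultimately show ?thesis by linarith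
qed

text \<open>The kernel depends on the distance only and is nonincreasing in it, which is what a
  two-point rearrangement requires. Values in \<open>ennreal\<close> make the energy meaningful for
  every measurable function.\<close>

definition nonlocal_energy :: "real \<Rightarrow> (real^'n::finite \<Rightarrow> real) \<Rightarrow> ennreal" where
  "nonlocal_energy \<epsilon> f =
     (\<integral>\<^sup>+x. \<integral>\<^sup>+y. ennreal ((if dist x y < \<epsilon> then 1 else 0) * (f x - f y)\<^sup>2) \<partial>lborel \<partial>lborel)"

definition weighted_mass :: "real \<Rightarrow> real \<Rightarrow> (real^'n::finite \<Rightarrow> real) \<Rightarrow> real" where
  "weighted_mass a p f = (LINT x|lborel. norm x powr a * \<bar>f x\<bar> powr p)"

text \<open>Two-point rearrangement: of the two values at a pair of mirror points the larger one is
  put on the side \<open>\<nu> \<bullet> x \<le> t\<close>, which contains the origin when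
  \<open>t > 0\<close>.\<close>

definition polarize :: "real^'n::finite \<Rightarrow> real \<Rightarrow> (real^'n \<Rightarrow> real) \<Rightarrow> real^'n \<Rightarrow> real" where
  "polarize \<nu> t f x = (if \<nu> \<bullet> x \<le> t then max (f x) (f (mirror \<nu> t x)) else min (f x) (f (mirror \<nu> t x)))"

text \<open>The sign of the last product decides the comparison: reflecting one of two points takes
  it no nearer to the other if both lie on the same side of the hyperplane, and no farther if they
  lie on opposite sides.\<close>

lemma norm_diff_mirror:
  assumes "norm \<nu> = 1"
  shows "(norm (x - mirror \<nu> t y))\<^sup>2 = (norm (x - y))\<^sup>2 + 4 * (\<nu> \<bullet> x - t) * (\<nu> \<bullet> y - t)"
proof -
  have n: "\<nu> \<bullet> \<nu> = 1" using assms by (simp add: dot_square_norm)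
  define s where "s = \<nu> \<bullet> y - t"
  have e: "x - mirror \<nu> t y = (x - y) + (2 * s) *\<^sub>R \<nu>" by (simp add: mirror_def s_def)
  have "(norm (x - mirror \<nu> t y))\<^sup>2 = (norm (x - y))\<^sup>2 + 4 * s * (\<nu> \<bullet> (x - y)) + 4 * s * s"
    unfolding power2_norm_eq_inner e
    by (simp only: inner_add_left[of "x - y"] inner_add_right[of _ "x - y"] inner_scaleR_left inner_scaleR_right n)
       (simp add: inner_commute distrib_left)
  also have "\<dots> = (norm (x - y))\<^sup>2 + 4 * (\<nu> \<bullet> x - t) * s"
    by (simp add: s_def inner_diff_right algebra_simps)
  finally show ?thesis by (simp add: s_def)
qed

lemma norm_mirror:
  assumes "norm \<nu> = 1"
  shows "(norm (mirror \<nu> t y))\<^sup>2 = (norm y)\<^sup>2 - 4 * t * (\<nu> \<bullet> y - t)"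
  using norm_diff_mirror[OF assms, of 0 t y] by simp

lemma norm_le_norm_mirror:
  assumes "norm \<nu> = 1" "t > 0" "\<nu> \<bullet> x \<le> t"
  shows "norm x \<le> norm (mirror \<nu> t x)"
proof (rule power2_le_imp_le)
  have "4 * t * (\<nu> \<bullet> x - t) \<le> 0" using assms by (intro mult_nonneg_nonpos) auto
  then show "(norm x)\<^sup>2 \<le> (norm (mirror \<nu> t x))\<^sup>2" unfolding norm_mirror[OF assms(1)] by linarith
qed simp

lemma norm_mirror_le_norm:
  assumes "norm \<nu> = 1" "t > 0" "\<nu> \<bullet> x \<ge> t"
  shows "norm (mirror \<nu> t x) \<le> norm x"
proof (rule power2_le_imp_le)
  have "4 * t * (\<nu> \<bullet> x - t) \<ge> 0" using assms by (intro mult_nonneg_nonneg) auto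
  then show "(norm (mirror \<nu> t x))\<^sup>2 \<le> (norm x)\<^sup>2" unfolding norm_mirror[OF assms(1)] by linarith
qed simp

lemma inner_mirror: "norm \<nu> = 1 \<Longrightarrow> \<nu> \<bullet> mirror \<nu> t x = 2 * t - \<nu> \<bullet> x"
  by (simp add: mirror_def inner_diff_right dot_square_norm)

lemma mirror_fixed: "\<nu> \<bullet> x = t \<Longrightarrow> mirror \<nu> t x = x"
  by (simp add: mirror_def)

context
  fixes \<nu> :: "real^'n::finite" and t :: real
  assumes \<nu>: "norm \<nu> = 1"
begin

text \<open>On the hyperplane both case distinctions select their first branch, which is consistent
  because such a point is its own mirror image.\<close>

lemma polarize_mirror:
  "polarize \<nu> t f (mirror \<nu> t x) =
     (if \<nu> \<bullet> x \<le> t then min (f x) (f (mirror \<nu> t x)) else max (f x) (f (mirror \<nu> t x)))"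
  using mirror_fixed[of \<nu> x t] by (auto simp: polarize_def inner_mirror[OF \<nu>] \<nu> min.commute max.commute)

lemma polarize_measurable: 
  assumes [measurable]: "f \<in> borel_measurable borel"
  shows "polarize \<nu> t f \<in> borel_measurable borel"
  unfolding polarize_def[abs_def] by measurable

lemma dist_mirror_le:
  assumes "(\<nu> \<bullet> x \<le> t) \<longleftrightarrow> (\<nu> \<bullet> y \<le> t)"
  shows "dist x y \<le> dist x (mirror \<nu> t y)"
proof -
  have "(\<nu> \<bullet> x - t) * (\<nu> \<bullet> y - t) \<ge> 0"
    using assms by (cases "\<nu> \<bullet> x \<le> t") (auto intro: mult_nonneg_nonneg mult_nonpos_nonpos)
  then have "(dist x y)\<^sup>2 \<le> (dist x (mirror \<nu> t y))\<^sup>2"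
    unfolding dist_norm norm_diff_mirror[OF \<nu>] mult.assoc by linarith
  then show ?thesis by (rule power2_le_imp_le) simp
qed

lemma dist_mirror_ge:
  assumes "(\<nu> \<bullet> x \<le> t) \<longleftrightarrow> \<not> (\<nu> \<bullet> y \<le> t)"
  shows "dist x (mirror \<nu> t y) \<le> dist x y"
proof -
  have "(\<nu> \<bullet> x - t) * (\<nu> \<bullet> y - t) \<le> 0"
    using assms by (cases "\<nu> \<bullet> x \<le> t") (auto intro: mult_nonneg_nonpos mult_nonpos_nonneg)
  then have "(dist x (mirror \<nu> t y))\<^sup>2 \<le> (dist x y)\<^sup>2"
    unfolding dist_norm norm_diff_mirror[OF \<nu>] mult.assoc by linarith
  then show ?thesis by (rule power2_le_imp_le) simp
qed

lemma dist_mirror_left: "dist (mirror \<nu> t x) y = dist x (mirror \<nu> t y)"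
  using dist_mirror[OF \<nu>, of t x "mirror \<nu> t y"] by (simp add: \<nu>)

lemma polarize_nonneg: "(\<And>x. f x \<ge> 0) \<Longrightarrow> polarize \<nu> t f x \<ge> 0"
  by (simp add: polarize_def max_def min_def)

text \<open>For points on the same side the values pair up as they stand. For points on opposite
  sides \<open>x\<close> is also compared with the image of \<open>y\<close>, which by
  \<open>dist_mirror_ge\<close> is no farther away.\<close>

lemma polarize_lipschitz:
  assumes L: "\<And>x y. \<bar>f x - f y\<bar> \<le> L * dist x y" and "L \<ge> 0"
  shows "\<bar>polarize \<nu> t f x - polarize \<nu> t f y\<bar> \<le> L * dist x y"
proof -
  let ?m = "mirror \<nu> t"
  have 1: "\<bar>f x - f y\<bar> \<le> L * dist x y" "\<bar>f (?m x) - f (?m y)\<bar> \<le> L * dist x y"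
    using L[of x y] L[of "?m x" "?m y"] by (simp_all add: dist_mirror[OF \<nu>])
  show ?thesis
  proof (cases "(\<nu> \<bullet> x \<le> t) \<longleftrightarrow> (\<nu> \<bullet> y \<le> t)")
    case True
    then show ?thesis using 1 unfolding polarize_def by (auto simp: max_def min_def)
  next
    case False
    then have "dist x (?m y) \<le> dist x y" by (intro dist_mirror_ge) auto
    then have le: "L * dist x (?m y) \<le> L * dist x y" using \<open>L \<ge> 0\<close> by (rule mult_left_mono)
    have "\<bar>f x - f (?m y)\<bar> \<le> L * dist x y" "\<bar>f (?m x) - f y\<bar> \<le> L * dist x y"
      using L[of x "?m y"] L[of "?m x" y] le by (simp_all add: dist_mirror_left)
    then show ?thesis using 1 False unfolding polarize_def by (auto simp: max_def min_def)
  qed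
qed

lemma polarize_support:
  assumes f: "\<And>x. f x \<ge> 0" "\<And>x. norm x > R \<Longrightarrow> f x = 0" and "t > 0" and x: "norm x > R"
  shows "polarize \<nu> t f x = 0"
proof (cases "\<nu> \<bullet> x \<le> t")
  case True
  then have "norm x \<le> norm (mirror \<nu> t x)" by (rule norm_le_norm_mirror[OF \<nu> \<open>t > 0\<close>])
  then show ?thesis using True f x by (simp add: polarize_def)
next
  case False
  then show ?thesis using f(2)[OF x] f(1)[of "mirror \<nu> t x"] by (simp add: polarize_def)
qed

text \<open>The energy is written in four ways, reflecting neither, either or both variables. The
  sum collects all interactions between two mirror pairs under one integral, so that the effect of
  polarization can be compared pointwise.\<close>

lemma nonlocal_energy_four:
  assumes [measurable]: "f \<in> borel_measurable borel"
  shows "4 * nonlocal_energy \<epsilon> f = (\<integral>\<^sup>+x. \<integral>\<^sup>+y. ennreal (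
      (if dist x y < \<epsilon> then 1 else 0) * ((f x - f y)\<^sup>2 + (f (mirror \<nu> t x) - f (mirror \<nu> t y))\<^sup>2)
    + (if dist x (mirror \<nu> t y) < \<epsilon> then 1 else 0) * ((f (mirror \<nu> t x) - f y)\<^sup>2 + (f x - f (mirror \<nu> t y))\<^sup>2)) \<partial>lborel \<partial>lborel)"
proof -
  let ?m = "mirror \<nu> t"
  define G where "G x y = ennreal ((if dist x y < \<epsilon> then 1 else 0) * (f x - f y)\<^sup>2)" for x y
  have [measurable]: "case_prod G \<in> borel_measurable (lborel \<Otimes>\<^sub>M lborel)" unfolding G_def by measurable
  have [measurable]: "(\<lambda>y. G x y) \<in> borel_measurable borel" for x unfolding G_def by measurable
  have N: "nonlocal_energy \<epsilon> f = (\<integral>\<^sup>+x. \<integral>\<^sup>+y. G x y \<partial>lborel \<partial>lborel)"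
    by (simp add: nonlocal_energy_def G_def)
  have i: "(\<integral>\<^sup>+y. G x (?m y) \<partial>lborel) = (\<integral>\<^sup>+y. G x y \<partial>lborel)" for x
    by (rule nn_integral_mirror[OF \<nu>]) measurable
  have o: "(\<integral>\<^sup>+x. \<integral>\<^sup>+y. G (?m x) y \<partial>lborel \<partial>lborel) = nonlocal_energy \<epsilon> f"
    unfolding N by (rule nn_integral_mirror[OF \<nu>, of "\<lambda>x. \<integral>\<^sup>+y. G x y \<partial>lborel"]) measurable
  have m1: "(\<lambda>x. \<integral>\<^sup>+y. G (h x) (k y) \<partial>lborel) \<in> borel_measurable borel" 
    and m2: "(\<lambda>y. G z (k y)) \<in> borel_measurable borel"
    if [measurable]: "h \<in> borel_measurable borel" "k \<in> borel_measurable borel" for h k :: "real^'n \<Rightarrow> real^'n" and z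
    unfolding G_def by measurable
  have "4 * nonlocal_energy \<epsilon> f = (\<integral>\<^sup>+x. \<integral>\<^sup>+y. G x y \<partial>lborel \<partial>lborel) + (\<integral>\<^sup>+x. \<integral>\<^sup>+y. G (?m x) (?m y) \<partial>lborel \<partial>lborel)
     + ((\<integral>\<^sup>+x. \<integral>\<^sup>+y. G (?m x) y \<partial>lborel \<partial>lborel) + (\<integral>\<^sup>+x. \<integral>\<^sup>+y. G x (?m y) \<partial>lborel \<partial>lborel))"
    unfolding i o N[symmetric] by (simp add: distrib_right[symmetric] numeral_eq_Suc mult_2 flip: mult_2)
  also have "\<dots> = (\<integral>\<^sup>+x. \<integral>\<^sup>+y. (G x y + G (?m x) (?m y)) + (G (?m x) y + G x (?m y)) \<partial>lborel \<partial>lborel)"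
    using m1[of id id] m1[of ?m ?m] m1[of ?m id] m1[of id ?m] m2
    by (simp add: nn_integral_add)
  also have "\<dots> = (\<integral>\<^sup>+x. \<integral>\<^sup>+y. ennreal (
      (if dist x y < \<epsilon> then 1 else 0) * ((f x - f y)\<^sup>2 + (f (?m x) - f (?m y))\<^sup>2)
    + (if dist x (?m y) < \<epsilon> then 1 else 0) * ((f (?m x) - f y)\<^sup>2 + (f x - f (?m y))\<^sup>2)) \<partial>lborel \<partial>lborel)"
    by (intro nn_integral_cong) (auto simp: G_def dist_mirror[OF \<nu>] dist_mirror_left ennreal_plus[symmetric] algebra_simps simp del: ennreal_plus)
  finally show ?thesis .
qed

lemma nonlocal_energy_polarize:
  assumes [measurable]: "f \<in> borel_measurable borel"
  shows "nonlocal_energy \<epsilon> (polarize \<nu> t f) \<le> nonlocal_energy \<epsilon> f"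
proof -
  note [measurable] = polarize_measurable[OF assms]
  \<comment> \<open>Polarization at most exchanges the two values of a mirror pair, so sums and
    products within a pair are kept, and hence the sums of squares. Only the mixed products vary,
    and they enter with the factor \<open>k1 - k2\<close>.\<close>
  have key: "k1 * ((A - B)\<^sup>2 + (A' - B')\<^sup>2) + k2 * ((A' - B)\<^sup>2 + (A - B')\<^sup>2)
      \<le> k1 * ((a - b)\<^sup>2 + (a' - b')\<^sup>2) + k2 * ((a' - b)\<^sup>2 + (a - b')\<^sup>2)"
    if s: "A + A' = a + a'" "A * A' = a * a'" "B + B' = b + b'" "B * B' = b * b'"
      and m: "(k1 - k2) * (A * B + A' * B' - (a * b + a' * b')) \<ge> 0"
    for k1 k2 A A' B B' a a' b b' :: real
  proof -
    have sq: "A\<^sup>2 + A'\<^sup>2 = a\<^sup>2 + a'\<^sup>2" "B\<^sup>2 + B'\<^sup>2 = b\<^sup>2 + b'\<^sup>2"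
      using s by algebra+
    have pr: "A' * B + A * B' = (a + a') * (b + b') - (A * B + A' * B')" using s by algebra
    have "k1 * ((A - B)\<^sup>2 + (A' - B')\<^sup>2) + k2 * ((A' - B)\<^sup>2 + (A - B')\<^sup>2)
      = (k1 + k2) * ((A\<^sup>2 + A'\<^sup>2) + (B\<^sup>2 + B'\<^sup>2)) - 2 * k1 * (A * B + A' * B') - 2 * k2 * (A' * B + A * B')"
      by (simp add: power2_eq_square algebra_simps)
    also have "\<dots> = (k1 + k2) * ((a\<^sup>2 + a'\<^sup>2) + (b\<^sup>2 + b'\<^sup>2)) - 2 * k1 * (a * b + a' * b') - 2 * k2 * (a' * b + a * b')
         - 2 * ((k1 - k2) * (A * B + A' * B' - (a * b + a' * b')))"
      unfolding sq pr by (simp add: algebra_simps)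
    also have "\<dots> \<le> (k1 + k2) * ((a\<^sup>2 + a'\<^sup>2) + (b\<^sup>2 + b'\<^sup>2)) - 2 * k1 * (a * b + a' * b') - 2 * k2 * (a' * b + a * b')"
      using m by simp
    also have "\<dots> = k1 * ((a - b)\<^sup>2 + (a' - b')\<^sup>2) + k2 * ((a' - b)\<^sup>2 + (a - b')\<^sup>2)"
      by (simp add: power2_eq_square algebra_simps)
    finally show ?thesis .
  qed
  \<comment> \<open>Rearrangement inequality for two pairs: aligned products are largest, opposed
    ones smallest.\<close>
  have re: "a * b + a' * b' \<le> max a a' * max b b' + min a a' * min b b'"
    "max a a' * min b b' + min a a' * max b b' \<le> a * b + a' * b'" for a a' b b' :: real
    using mult_nonneg_nonneg[of "a - a'" "b - b'"] mult_nonneg_nonneg[of "a' - a" "b' - b"]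
      mult_nonneg_nonneg[of "a - a'" "b' - b"] mult_nonneg_nonneg[of "a' - a" "b - b'"]
    by (auto simp: max_def min_def algebra_simps)
  have "4 * nonlocal_energy \<epsilon> (polarize \<nu> t f) \<le> 4 * nonlocal_energy \<epsilon> f"
    unfolding nonlocal_energy_four[OF assms] nonlocal_energy_four[OF polarize_measurable[OF assms]]
  proof (intro nn_integral_mono ennreal_leI key)
    fix x y
    let ?m = "mirror \<nu> t" and ?P = "polarize \<nu> t f"
    let ?k1 = "if dist x y < \<epsilon> then 1 else 0 :: real" and ?k2 = "if dist x (?m y) < \<epsilon> then 1 else 0 :: real"
    show "?P x + ?P (?m x) = f x + f (?m x)" "?P x * ?P (?m x) = f x * f (?m x)"
      "?P y + ?P (?m y) = f y + f (?m y)" "?P y * ?P (?m y) = f y * f (?m y)"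
      unfolding polarize_mirror by (auto simp: polarize_def max_def min_def)
    show "(?k1 - ?k2) * (?P x * ?P y + ?P (?m x) * ?P (?m y) - (f x * f y + f (?m x) * f (?m y))) \<ge> 0"
    proof (cases "(\<nu> \<bullet> x \<le> t) \<longleftrightarrow> (\<nu> \<bullet> y \<le> t)")
      case True
      then have "?k1 - ?k2 \<ge> 0" using dist_mirror_le[OF True] by auto
      moreover have "f x * f y + f (?m x) * f (?m y) \<le> ?P x * ?P y + ?P (?m x) * ?P (?m y)"
        using re(1)[of "f x" "f y" "f (?m x)" "f (?m y)"] True unfolding polarize_mirror polarize_def[of _ _ _ x] polarize_def[of _ _ _ y] by (auto simp: add.commute)
      ultimately show ?thesis by simp
    next
      case False
      then have "?k1 - ?k2 \<le> 0" using dist_mirror_ge[of x y] by auto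
      moreover have "?P x * ?P y + ?P (?m x) * ?P (?m y) \<le> f x * f y + f (?m x) * f (?m y)"
        using re(2)[where a = "f x" and b = "f y" and a' = "f (?m x)" and b' = "f (?m y)"] False unfolding polarize_mirror polarize_def[of _ _ _ x] polarize_def[of _ _ _ y] by (auto simp: add.commute)
      ultimately show ?thesis by (simp add: mult_nonpos_nonpos)
    qed
  qed
  then show ?thesis by (subst (asm) ennreal_mult_le_mult_iff) auto
qed

end


section \<open>Weighted mass and second moment under polarization\<close>

lemma integrable_norm_powr_times:
  fixes g :: "real^'n::finite \<Rightarrow> real"
  assumes a: "a > - real CARD('n)" and [measurable]: "g \<in> borel_measurable borel"
    and R: "\<And>x. norm x > R \<Longrightarrow> g x = 0" and M: "\<And>x. \<bar>g x\<bar> \<le> M"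
  shows "integrable lborel (\<lambda>x. norm x powr a * g x)"
proof (rule Bochner_Integration.integrable_bound)
  show "integrable lborel (\<lambda>x::real^'n. M * (indicator (cball 0 R) x * norm x powr a))"
    by (intro integrable_mult_right integrable_norm_powr_cball a)
  show "AE x in lborel. norm (norm x powr a * g x) \<le> norm (M * (indicator (cball 0 R) x * norm x powr a))"
  proof (intro AE_I2)
    fix x
    have "M \<ge> 0" using M[of 0] by linarith
    then show "norm (norm x powr a * g x) \<le> norm (M * (indicator (cball 0 R) x * norm x powr a))"
      using R[of x] mult_left_mono[OF M[of x], of "norm x powr a"]
      by (cases "norm x > R") (auto simp: indicator_def abs_mult mult.commute)
  qed
qed measurable

lemma AE_norm_pos: "AE x in lborel. norm (x::real^'n::finite) > 0"
  using AE_lborel_singleton[of "0::real^'n"] by eventually_elim simp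

lemma powr_antimono:
  assumes "a \<le> (0::real)" "0 < r" "r \<le> s" shows "s powr a \<le> r powr a"
  using assms by (intro powr_mono2') auto

lemma integral_mirror_add:
  fixes g :: "real^'n::finite \<Rightarrow> real"
  assumes "norm \<nu> = 1" "integrable lborel g"
  shows "integrable lborel (\<lambda>x. g x + g (mirror \<nu> t x))"
    "(LINT x|lborel. g x + g (mirror \<nu> t x)) = 2 * (LINT x|lborel. g x)"
proof -
  have [measurable]: "g \<in> borel_measurable borel" using borel_measurable_integrable[OF assms(2)] by simp
  have "integrable lborel (\<lambda>x. g (mirror \<nu> t x))" using assms by (subst integrable_mirror) auto
  then show "integrable lborel (\<lambda>x. g x + g (mirror \<nu> t x))"
    "(LINT x|lborel. g x + g (mirror \<nu> t x)) = 2 * (LINT x|lborel. g x)"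
    using assms by (auto simp: integral_mirror)
qed

lemma rearrange2:
  fixes a a' w w' :: real
  assumes "w' \<le> w"
  shows "w * a + w' * a' \<le> w * max a a' + w' * min a a'"
proof (cases "a \<le> a'")
  case True
  have "(w - w') * (a' - a) \<ge> 0" using assms True by simp
  then show ?thesis using True by (simp add: max_def min_def algebra_simps)
qed (simp add: max_def min_def)

text \<open>Since \<open>a \<le> 0\<close>, the weight is larger at the mirror point nearer to the
  origin, and polarization with \<open>t > 0\<close> puts the larger value there;
  \<open>rearrange2\<close> compares the two pairings.\<close>

lemma weighted_mass_polarize:
  fixes f :: "real^'n::finite \<Rightarrow> real"
  assumes \<nu>: "norm \<nu> = 1" and t: "t > 0" and a: "a \<le> 0" "a > - real CARD('n)" and p: "p > 0"
    and [measurable]: "f \<in> borel_measurable borel" and f: "\<And>x. f x \<ge> 0" "\<And>x. norm x > R \<Longrightarrow> f x = 0" "\<And>x. f x \<le> M"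
  shows "weighted_mass a p f \<le> weighted_mass a p (polarize \<nu> t f)"
proof -
  let ?P = "polarize \<nu> t f" and ?m = "mirror \<nu> t"
  have [measurable]: "?P \<in> borel_measurable borel" by (rule polarize_measurable[OF \<nu>]) measurable
  have P: "?P x \<ge> 0" "norm x > R \<Longrightarrow> ?P x = 0" "?P x \<le> M" for x
    using polarize_nonneg[OF \<nu>, of f] polarize_support[OF \<nu>, of f R] f t by (auto simp: polarize_def max_def min_def)
  have int: "integrable lborel (\<lambda>x. norm x powr a * \<bar>g x\<bar> powr p)"
    if [measurable]: "g \<in> borel_measurable borel" and "\<And>x. g x \<ge> 0" "\<And>x. norm x > R \<Longrightarrow> g x = 0" "\<And>x. g x \<le> M" for g :: "real^'n \<Rightarrow> real"
    using that p by (intro integrable_norm_powr_times[of a _ R "M powr p"] a) (auto intro!: powr_mono2)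
  note F = integral_mirror_add[OF \<nu> int[of f], of t] and G = integral_mirror_add[OF \<nu> int[of ?P], of t]
  have "2 * weighted_mass a p f = (LINT x|lborel. norm x powr a * \<bar>f x\<bar> powr p + norm (?m x) powr a * \<bar>f (?m x)\<bar> powr p)"
    using F f unfolding weighted_mass_def by simp
  also have "\<dots> \<le> (LINT x|lborel. norm x powr a * \<bar>?P x\<bar> powr p + norm (?m x) powr a * \<bar>?P (?m x)\<bar> powr p)"
  proof (rule integral_mono_AE)
    \<comment> \<open>At the origin the weight is \<open>0\<close>, as \<open>0 powr a = 0\<close>,
      against the monotonicity used below. The points that are the origin or are reflected to it
      form a null set and are left out.\<close>
    have "AE x in distr lborel borel ?m. norm x > 0"
      unfolding lborel_distr_mirror[OF \<nu>] by (rule AE_norm_pos)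
    then have ae: "AE x in lborel. norm (?m x) > 0"
      by (rule AE_distrD[rotated]) measurable
    show "AE x in lborel. norm x powr a * \<bar>f x\<bar> powr p + norm (?m x) powr a * \<bar>f (?m x)\<bar> powr p
       \<le> norm x powr a * \<bar>?P x\<bar> powr p + norm (?m x) powr a * \<bar>?P (?m x)\<bar> powr p"
      using AE_norm_pos ae
    proof eventually_elim
      case (elim x)
      have mm: "max (f x) (f (?m x)) powr p = max (f x powr p) (f (?m x) powr p)"
        "min (f x) (f (?m x)) powr p = min (f x powr p) (f (?m x) powr p)"
        using powr_mono2[of p "f x" "f (?m x)"] powr_mono2[of p "f (?m x)" "f x"] f(1) p
        by (auto simp: max_def min_def)
      show ?case
      proof (cases "\<nu> \<bullet> x \<le> t")
        case True
        then have "norm x \<le> norm (?m x)" by (rule norm_le_norm_mirror[OF \<nu> t])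
        then have "norm (?m x) powr a \<le> norm x powr a" using elim a by (intro powr_antimono)
        from rearrange2[OF this, of "f x powr p" "f (?m x) powr p"] show ?thesis
          unfolding abs_of_nonneg[OF P(1)] abs_of_nonneg[OF f(1)]
          unfolding polarize_mirror[OF \<nu>] polarize_def[of _ _ _ x]
          using True by (simp add: mm)
      next
        case False
        then have "norm (?m x) \<le> norm x" using norm_mirror_le_norm[OF \<nu> t, of x] by simp
        then have "norm x powr a \<le> norm (?m x) powr a" using elim a by (intro powr_antimono)
        from rearrange2[OF this, of "f (?m x) powr p" "f x powr p"] show ?thesis
          unfolding abs_of_nonneg[OF P(1)] abs_of_nonneg[OF f(1)]
          unfolding polarize_mirror[OF \<nu>] polarize_def[of _ _ _ x]
          using False by (simp add: mm max.commute min.commute add.commute)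
      qed
    qed
  qed (use F G f P in auto)
  also have "\<dots> = 2 * weighted_mass a p ?P"
    using G P unfolding weighted_mass_def by simp
  finally show ?thesis by simp
qed

text \<open>Over a mirror pair the moment drops by \<open>4 * t * (\<nu> \<bullet> x - t) * (f x -
  polarize \<nu> t f x)\<close>, which is never negative. It is positive at the given point, hence
  near it by continuity, and so the integral is strictly positive.\<close>

lemma second_moment_polarize:
  fixes f :: "real^'n::finite \<Rightarrow> real"
  assumes \<nu>: "norm \<nu> = 1" and t: "t > 0" 
    and cont: "continuous_on UNIV f" "continuous_on UNIV (polarize \<nu> t f)"
    and f: "\<And>x. f x \<ge> 0" "\<And>x. norm x > R \<Longrightarrow> f x = 0"
    and x: "\<nu> \<bullet> x < t" "f x < f (mirror \<nu> t x)"
  shows "(LINT x|lborel. f x * (norm x)\<^sup>2) > (LINT x|lborel. polarize \<nu> t f x * (norm x)\<^sup>2)"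
proof -
  let ?P = "polarize \<nu> t f" and ?m = "mirror \<nu> t"
  have P: "norm x > R \<Longrightarrow> ?P x = 0" for x using polarize_support[OF \<nu>, of f R] f t by auto
  have i: "integrable lborel (\<lambda>x. f x * (norm x)\<^sup>2)" "integrable lborel (\<lambda>x. ?P x * (norm x)\<^sup>2)"
    using f P by (auto intro!: integrable_continuous_bounded_support[where R = R] continuous_intros cont)
  note F = integral_mirror_add[OF \<nu> i(1), of t] and G = integral_mirror_add[OF \<nu> i(2), of t]
  define D where "D x = (f x * (norm x)\<^sup>2 + f (?m x) * (norm (?m x))\<^sup>2) - (?P x * (norm x)\<^sup>2 + ?P (?m x) * (norm (?m x))\<^sup>2)" for x
  have D: "D x = 4 * t * (\<nu> \<bullet> x - t) * (f x - ?P x)" for x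
  proof -
    have e: "?P (?m x) = f x + f (?m x) - ?P x"
      unfolding polarize_mirror[OF \<nu>] by (auto simp: polarize_def max_def min_def)
    show ?thesis unfolding D_def e norm_mirror[OF \<nu>] by (simp add: algebra_simps)
  qed
  have D0: "D y \<ge> 0" for y
  proof (cases "\<nu> \<bullet> y \<le> t")
    case True
    then show ?thesis unfolding D using t
      by (intro mult_nonpos_nonpos[OF mult_nonneg_nonpos]) (auto simp: polarize_def)
  next
    case False
    then show ?thesis unfolding D using t
      by (intro mult_nonneg_nonneg[OF mult_nonneg_nonneg]) (auto simp: polarize_def)
  qed
  have "(LINT x|lborel. D x) > 0"
  proof (rule integral_pos_continuous)
    show "continuous_on UNIV D"
      unfolding D_def using continuous_on_mirror[of UNIV \<nu> t]
      by (intro continuous_intros cont continuous_on_compose2[OF cont(1)] continuous_on_compose2[OF cont(2)]) auto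
    show "D x > 0" unfolding D using t x by (intro mult_neg_neg[OF mult_pos_neg]) (auto simp: polarize_def)
    show "integrable lborel D" unfolding D_def using F(1) G(1) by auto
  qed (rule D0)
  moreover have "(LINT x|lborel. D x) = 2 * (LINT x|lborel. f x * (norm x)\<^sup>2) - 2 * (LINT x|lborel. ?P x * (norm x)\<^sup>2)"
    unfolding D_def using F G by simp
  ultimately show ?thesis by simp
qed

text \<open>Fatou's lemma, applied once for each variable.\<close>

lemma nonlocal_energy_pointwise_limit:
  fixes f :: "real^'n::finite \<Rightarrow> real"
  assumes [measurable]: "\<And>j. F j \<in> borel_measurable borel" and lim: "\<And>x. (\<lambda>j. F j x) \<longlonglongrightarrow> f x"
    and le: "\<And>j. nonlocal_energy \<epsilon> (F j) \<le> C"
  shows "nonlocal_energy \<epsilon> f \<le> C"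
proof -
  define k where "k x y = (if dist x y < \<epsilon> then 1 else 0 :: real)" for x y :: "real^'n"
  have [measurable]: "case_prod k \<in> borel_measurable (borel \<Otimes>\<^sub>M borel)" unfolding k_def by measurable
  have [measurable]: "k x \<in> borel_measurable borel" for x unfolding k_def by measurable
  have "nonlocal_energy \<epsilon> f = (\<integral>\<^sup>+x. \<integral>\<^sup>+y. liminf (\<lambda>j. ennreal (k x y * (F j x - F j y)\<^sup>2)) \<partial>lborel \<partial>lborel)"
    unfolding nonlocal_energy_def k_def
    by (intro nn_integral_cong lim_imp_Liminf[symmetric] tendsto_ennrealI tendsto_intros lim) auto
  also have "\<dots> \<le> (\<integral>\<^sup>+x. liminf (\<lambda>j. \<integral>\<^sup>+y. ennreal (k x y * (F j x - F j y)\<^sup>2) \<partial>lborel) \<partial>lborel)"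
    by (intro nn_integral_mono nn_integral_liminf) measurable
  also have "\<dots> \<le> liminf (\<lambda>j. \<integral>\<^sup>+x. \<integral>\<^sup>+y. ennreal (k x y * (F j x - F j y)\<^sup>2) \<partial>lborel \<partial>lborel)"
    by (intro nn_integral_liminf) measurable
  also have "\<dots> = liminf (\<lambda>j. nonlocal_energy \<epsilon> (F j))" unfolding nonlocal_energy_def k_def ..
  also have "\<dots> \<le> liminf (\<lambda>j::nat. C)" using le by (intro Liminf_mono always_eventually) auto
  also have "\<dots> = C" by (simp add: Liminf_const)
  finally show ?thesis .
qed

lemma weighted_mass_tendsto:
  fixes f :: "real^'n::finite \<Rightarrow> real"
  assumes a: "a > - real CARD('n)" and p: "p > 0"
    and meas: "\<And>j. F j \<in> borel_measurable borel" "f \<in> borel_measurable borel"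
    and lim: "\<And>x. (\<lambda>j. F j x) \<longlonglongrightarrow> f x"
    and R: "\<And>j x. norm x > R \<Longrightarrow> F j x = 0" and L: "\<And>j x. \<bar>F j x\<bar> \<le> L"
  shows "(\<lambda>j. weighted_mass a p (F j)) \<longlonglongrightarrow> weighted_mass a p f"
  unfolding weighted_mass_def
proof (rule integral_dominated_convergence[where w = "\<lambda>x. norm x powr a * (L powr p * indicator (cball 0 R) x)"])
  show "integrable lborel (\<lambda>x::real^'n. norm x powr a * (L powr p * indicator (cball 0 R) x))"
  proof (rule integrable_norm_powr_times[OF a])
    show "(\<lambda>x::real^'n. L powr p * indicator (cball 0 R) x) \<in> borel_measurable borel"
      by (intro borel_measurable_times borel_measurable_const borel_measurable_indicator borel_closed closed_cball)
    show "L powr p * indicator (cball 0 R) x = 0" if "norm x > R" for x :: "real^'n" using that by simp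
    show "\<bar>L powr p * indicator (cball 0 R) x\<bar> \<le> L powr p" for x :: "real^'n"
      by (simp add: indicator_def)
  qed
  show "AE x in lborel. (\<lambda>n. norm x powr a * \<bar>F n x\<bar> powr p) \<longlonglongrightarrow> norm x powr a * \<bar>f x\<bar> powr p"
  proof (intro AE_I2 tendsto_mult tendsto_const)
    fix x show "(\<lambda>n. \<bar>F n x\<bar> powr p) \<longlonglongrightarrow> \<bar>f x\<bar> powr p"
      by (rule tendsto_powr'[OF tendsto_rabs[OF lim] tendsto_const]) (use p in auto)
  qed
  show "AE x in lborel. norm (norm x powr a * \<bar>F n x\<bar> powr p) \<le> norm x powr a * (L powr p * indicator (cball 0 R) x)" for n
    using R[of _ n] L[of n] p by (intro AE_I2) (auto simp: indicator_def abs_mult intro!: mult_left_mono powr_mono2)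
qed (use meas in measurable)

text \<open>The minimiser of the second moment in a class that is closed under pointwise limits and
  under all polarizations is invariant under these, hence radially decreasing.\<close>

lemma radial_rearrangement:
  fixes u :: "real^'n::finite \<Rightarrow> real"
  assumes u: "u \<in> C1c \<Omega>" and a: "a \<le> 0" "a > - real CARD('n)" and p: "p > 0"
  shows "\<exists>(f :: real^'n \<Rightarrow> real) R L. R > 0 \<and> L > 0 \<and> (\<forall>x y. \<bar>f x - f y\<bar> \<le> L * dist x y) \<and> (\<forall>x. 0 \<le> f x) \<and> (\<forall>x. f x \<le> L) \<and>
    (\<forall>x. norm x > R \<longrightarrow> f x = 0) \<and> (\<forall>\<epsilon>. nonlocal_energy \<epsilon> f \<le> nonlocal_energy \<epsilon> u) \<and>
    weighted_mass a p u \<le> weighted_mass a p f \<and> (\<forall>x y. norm x = norm y \<longrightarrow> f y \<le> f x)"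
proof -
  obtain R L where RL: "R > 0" "L > 0" "\<And>x. norm x > R \<Longrightarrow> u x = 0 \<and> grad u x = 0"
    "\<And>x. \<bar>u x\<bar> \<le> L" "\<And>x y. \<bar>u x - u y\<bar> \<le> L * norm (x - y)"
    using C1c_bounds[OF u] by metis
  note [measurable] = C1cD(4)[OF u]
  \<comment> \<open>Each condition is preserved by pointwise limits and by polarizations with
    \<open>t > 0\<close>. The common Lipschitz constant, bound and support give compactness by
    Arzela-Ascoli.\<close>
  define K where "K = {f :: real^'n \<Rightarrow> real. (\<forall>x y. \<bar>f x - f y\<bar> \<le> L * dist x y) \<and> (\<forall>x. 0 \<le> f x \<and> f x \<le> L) \<and> (\<forall>x. norm x > R \<longrightarrow> f x = 0)
     \<and> (\<forall>\<epsilon>. nonlocal_energy \<epsilon> f \<le> nonlocal_energy \<epsilon> u) \<and> weighted_mass a p u \<le> weighted_mass a p f}"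
  have KD: "\<bar>f x - f y\<bar> \<le> L * dist x y" "0 \<le> f x" "f x \<le> L" "norm x > R \<Longrightarrow> f x = 0"
    "nonlocal_energy \<epsilon> f \<le> nonlocal_energy \<epsilon> u" "weighted_mass a p u \<le> weighted_mass a p f" if "f \<in> K" for f x y \<epsilon>
    using that unfolding K_def by blast+
  have Kc: "continuous_on UNIV f" if "f \<in> K" for f
    by (rule lipschitz_on_continuous_on[of L], rule lipschitz_onI) (use KD[OF that] RL(2) in \<open>auto simp: dist_real_def\<close>)
  have Km: "f \<in> borel_measurable borel" if "f \<in> K" for f by (rule borel_measurable_continuous_onI[OF Kc[OF that]])
  define I where "I f = (LINT x|lborel. f x * (norm (x::real^'n))\<^sup>2)" for f
  have I0: "I f \<ge> 0" if "f \<in> K" for f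
    unfolding I_def using KD(2)[OF that] by (intro Bochner_Integration.integral_nonneg mult_nonneg_nonneg) auto
  \<comment> \<open>The class asks for nonnegative functions, for which polarization keeps the
    support in the ball. Passing to the absolute value does not raise the energies and keeps the
    mass.\<close>
  have uK: "(\<lambda>x. \<bar>u x\<bar>) \<in> K"
  proof -
    have "nonlocal_energy \<epsilon> (\<lambda>x. \<bar>u x\<bar>) \<le> nonlocal_energy \<epsilon> u" for \<epsilon>
      unfolding nonlocal_energy_def
      by (intro nn_integral_mono ennreal_leI mult_left_mono) (auto simp: abs_le_square_iff[symmetric] abs_triangle_ineq3)
    moreover have "\<bar>\<bar>u x\<bar> - \<bar>u y\<bar>\<bar> \<le> L * dist x y" for x y
      using RL(5)[of x y] by (simp add: dist_norm)
    ultimately show ?thesis using RL(3,4) unfolding K_def by (simp add: weighted_mass_def)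
  qed
  define m where "m = Inf (I ` K)"
  have bdd: "bdd_below (I ` K)" using I0 by (intro bdd_belowI[of _ 0]) auto
  have m: "m \<le> I f" if "f \<in> K" for f unfolding m_def using bdd that by (intro cInf_lower) auto
  have "\<exists>f\<in>K. I f < m + 1 / Suc j" for j :: nat
    
  proof -
    have "\<exists>y\<in>I ` K. y < m + 1 / Suc j"
      using uK unfolding m_def by (intro cInf_lessD) auto
    then show ?thesis by blast
  qed
  then obtain F where F: "\<And>j. F j \<in> K" "\<And>j. I (F j) < m + 1 / Suc j" by metis
  obtain g k where gk: "strict_mono (k :: nat \<Rightarrow> nat)" 
    "\<And>e. 0 < e \<Longrightarrow> \<exists>N. \<forall>n x. n \<ge> N \<and> x \<in> cball (0::real^'n) R \<longrightarrow> norm (F (k n) x - g x) < e"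
  proof (rule Arzela_Ascoli[of "cball (0::real^'n) R" F L])
    show "norm (F n x) \<le> L" for n x using KD(2,3)[OF F(1)] by simp
    show "\<exists>d>0. \<forall>n y. y \<in> cball 0 R \<and> norm (x - y) < d \<longrightarrow> norm (F n x - F n y) < e" if "0 < e" for x e
    proof (intro exI[of _ "e / L"] conjI allI impI)
      fix n y assume "y \<in> cball 0 R \<and> norm (x - y) < e / L"
      then have "L * dist x y < e" using RL(2) by (simp add: dist_norm field_simps)
      then show "norm (F n x - F n y) < e" using KD(1)[OF F(1), of n x y] by simp
    qed (use that RL(2) in simp)
  qed auto
  define f where "f x = (if norm x \<le> R then g x else 0)" for x
  define G where "G n = F (k n)" for n
  have GK: "G n \<in> K" for n using F(1) by (simp add: G_def)
  note [measurable] = Km[OF GK]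
  have lim: "(\<lambda>n. G n x) \<longlonglongrightarrow> f x" for x
  proof (cases "norm x \<le> R")
    case True
    then show ?thesis using gk(2) unfolding LIMSEQ_iff G_def f_def by auto (meson mem_cball_0)
  next
    case False
    then show ?thesis using KD(4)[OF GK] by (simp add: f_def)
  qed
  have [measurable]: "f \<in> borel_measurable borel" using lim by (rule borel_measurable_LIMSEQ_real) auto
  have fb: "0 \<le> f x" "f x \<le> L" for x
    using LIMSEQ_le_const[OF lim] LIMSEQ_le_const2[OF lim] KD(2,3)[OF GK] by blast+
  have fK: "f \<in> K"
  proof -
    have "\<bar>f x - f y\<bar> \<le> L * dist x y" for x y
      by (rule LIMSEQ_le_const2[of "\<lambda>n. \<bar>G n x - G n y\<bar>"]) (use KD(1)[OF GK] lim in \<open>auto intro!: tendsto_intros\<close>)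
    moreover have "nonlocal_energy \<epsilon> f \<le> nonlocal_energy \<epsilon> u" for \<epsilon>
      by (rule nonlocal_energy_pointwise_limit[OF _ lim KD(5)[OF GK]]) measurable
    moreover have "(\<lambda>n. weighted_mass a p (G n)) \<longlonglongrightarrow> weighted_mass a p f"
      using KD(2,3)[OF GK] by (intro weighted_mass_tendsto[where L = L, OF a(2) p _ _ lim KD(4)[OF GK]]) auto
    then have "weighted_mass a p u \<le> weighted_mass a p f"
      by (rule LIMSEQ_le_const) (use KD(6)[OF GK] in auto)
    ultimately show ?thesis using fb unfolding K_def by (auto simp: f_def)
  qed
  have "(\<lambda>n. I (G n)) \<longlonglongrightarrow> I f"
    unfolding I_def
  proof (rule integral_dominated_convergence[where w = "\<lambda>x. L * R\<^sup>2 * indicator (cball 0 R) x"])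
    show "integrable lborel (\<lambda>x::real^'n. L * R\<^sup>2 * indicator (cball 0 R) x)"
      by (intro integrable_mult_right integrable_real_indicator emeasure_bounded_finite) auto
    show "AE x in lborel. norm (G n x * (norm x)\<^sup>2) \<le> L * R\<^sup>2 * indicator (cball 0 R) x" for n
      using KD(2,3,4)[OF GK[of n]] RL(2) by (intro AE_I2) (auto simp: indicator_def abs_mult intro!: mult_mono power_mono)
  qed (auto intro!: tendsto_intros lim)
  moreover have "(\<lambda>n. m + 1 / Suc (k n)) \<longlonglongrightarrow> m + 0"
    using LIMSEQ_subseq_LIMSEQ[OF LIMSEQ_inverse_real_of_nat gk(1)]
    by (intro tendsto_intros) (simp add: o_def inverse_eq_divide)
  ultimately have "I f \<le> m + 0"
    using F(2) by (intro LIMSEQ_le) (auto simp: G_def intro: less_imp_le)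
  then have fm: "I f \<le> I h" if "h \<in> K" for h using m[OF that] by simp
  have mono: "f y \<le> f x" if xy: "norm x < norm y" for x y
  proof (rule ccontr)
    assume "\<not> f y \<le> f x"
    then have lt: "f x < f y" by simp
    \<comment> \<open>\<open>\<nu>\<close> and \<open>t\<close> describe the hyperplane bisecting
      \<open>x\<close> and \<open>y\<close>. As \<open>x\<close> is nearer to the origin,
      \<open>t\<close> is positive; polarization would exchange the values \<open>f x < f y\<close>
      and push the second moment below its minimum.\<close>
    define d where "d = norm (y - x)"
    define \<nu> where "\<nu> = (y - x) /\<^sub>R d"
    define t where "t = ((norm y)\<^sup>2 - (norm x)\<^sup>2) / (2 * d)"
    have d: "d > 0" using xy by (auto simp: d_def)
    have \<nu>: "norm \<nu> = 1" using d by (simp add: \<nu>_def d_def)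
    have t: "t > 0" using xy d by (auto simp: t_def intro!: divide_pos_pos power_strict_mono)
    have nx: "\<nu> \<bullet> x - t = - d / 2"
    proof -
      have "d * (\<nu> \<bullet> x - t) = (y - x) \<bullet> x - ((norm y)\<^sup>2 - (norm x)\<^sup>2) / 2"
      proof -
        have e: "\<nu> \<bullet> x = ((y - x) \<bullet> x) / d" by (simp add: \<nu>_def divide_inverse mult.commute)
        show ?thesis unfolding e t_def using d by (simp add: field_simps)
      qed
      also have "\<dots> = - (d * d) / 2"
        unfolding d_def power2_eq_square[symmetric] power2_norm_eq_inner
        by (simp add: inner_diff_left inner_diff_right inner_commute field_simps)
      finally have "d * (\<nu> \<bullet> x - t) = d * (- d / 2)" by simp
      then show ?thesis using d by (subst (asm) mult_left_cancel) auto
    qed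
    have my: "mirror \<nu> t x = y" unfolding mirror_def nx using d by (simp add: \<nu>_def)
    have "polarize \<nu> t f \<in> K"
      unfolding K_def mem_Collect_eq
    proof (intro conjI allI impI)
      show "\<bar>polarize \<nu> t f x - polarize \<nu> t f y\<bar> \<le> L * dist x y" for x y
        using RL(2) by (intro polarize_lipschitz[where f = f, OF \<nu> KD(1)[OF fK]]) simp
      show "0 \<le> polarize \<nu> t f x" for x by (rule polarize_nonneg[where f = f, OF \<nu> KD(2)[OF fK]])
      show "polarize \<nu> t f x \<le> L" for x using KD(3)[OF fK] by (auto simp: polarize_def min_def)
      show "polarize \<nu> t f x = 0" if "norm x > R" for x
        by (rule polarize_support[where f = f, OF \<nu> KD(2)[OF fK] KD(4)[OF fK] t that])
      show "nonlocal_energy \<epsilon> (polarize \<nu> t f) \<le> nonlocal_energy \<epsilon> u" for \<epsilon>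
        by (rule order_trans[OF nonlocal_energy_polarize[OF \<nu> Km[OF fK]] KD(5)[OF fK]])
      show "weighted_mass a p u \<le> weighted_mass a p (polarize \<nu> t f)"
        by (rule order_trans[OF KD(6)[OF fK] weighted_mass_polarize[where f = f, OF \<nu> t a p Km[OF fK] KD(2)[OF fK] KD(4)[OF fK] KD(3)[OF fK]]])
    qed
    note P = this
    have "I (polarize \<nu> t f) < I f"
      unfolding I_def
      by (rule second_moment_polarize[where f = f and x = x, OF \<nu> t Kc[OF fK] Kc[OF P] KD(2)[OF fK] KD(4)[OF fK]])
         (use nx d lt my in auto)
    with fm[OF P] show False by simp
  qed
  have le: "f y \<le> f x" if "norm x = norm y" for x y
  proof (cases "y = 0")
    case False
    \<comment> \<open>The comparison \<open>mono\<close> is for strictly different norms, so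
      \<open>y\<close> is pushed slightly outwards and continuity of \<open>f\<close> gives the case
      of equal norms.\<close>
    have "f ((1 + 1 / Suc j) *\<^sub>R y) \<le> f x" for j :: nat
      using False that by (intro mono) (auto simp: field_simps)
    moreover have "(\<lambda>j. f ((1 + 1 / Suc j) *\<^sub>R y)) \<longlonglongrightarrow> f ((1 + 0) *\<^sub>R y)"
    proof (rule continuous_on_tendsto_compose[OF Kc[OF fK]])
      show "(\<lambda>j. (1 + 1 / real (Suc j)) *\<^sub>R y) \<longlonglongrightarrow> (1 + 0) *\<^sub>R y"
        using LIMSEQ_inverse_real_of_nat by (intro tendsto_intros) (simp add: inverse_eq_divide)
    qed auto
    ultimately have "f ((1 + 0) *\<^sub>R y) \<le> f x" by (intro LIMSEQ_le_const2) auto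
    then show ?thesis by simp
  qed (use that in auto)
  show ?thesis
    by (intro exI[of _ f] exI[of _ R] exI[of _ L] conjI allI impI RL KD[OF fK] le)
qed

subsection \<open>The Dirichlet integral as a limit of nonlocal energies\<close>

definition dirichlet :: "(real^'n::finite \<Rightarrow> real) \<Rightarrow> real" where
  "dirichlet f = (LINT x|lborel. (norm (grad f x))\<^sup>2)"

lemma nn_integral_affine:
  fixes f :: "'a::euclidean_space \<Rightarrow> ennreal"
  assumes [measurable]: "f \<in> borel_measurable borel" and "c \<noteq> 0"
  shows "(\<integral>\<^sup>+x. f x \<partial>lborel) = ennreal (\<bar>c\<bar> ^ DIM('a)) * (\<integral>\<^sup>+x. f (t + c *\<^sub>R x) \<partial>lborel)"
  by (subst lborel_affine[OF assms(2), of t])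
     (simp add: nn_integral_density nn_integral_distr nn_integral_cmult)

lemma integral_affine:
  fixes f :: "'a::euclidean_space \<Rightarrow> real"
  assumes [measurable]: "f \<in> borel_measurable borel" and "c \<noteq> 0"
  shows "(LINT x|lborel. f x) = \<bar>c\<bar> ^ DIM('a) * (LINT x|lborel. f (t + c *\<^sub>R x))"
  by (subst lborel_affine[OF assms(2), of t])
     (simp add: integral_density integral_distr)

text \<open>Second moment of the unit ball in a fixed direction. \<open>SOME k. True\<close> picks
  an arbitrary axis, all of them being equivalent by symmetry.\<close>

definition unit_ball_moment :: "'n::finite itself \<Rightarrow> ennreal" where
  "unit_ball_moment _ = (\<integral>\<^sup>+h. ennreal ((if norm h < 1 then 1 else 0) * (axis (SOME k. True) 1 \<bullet> (h::real^'n))\<^sup>2) \<partial>lborel)"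

text \<open>A reflection carries the reference axis to the direction of \<open>g\<close>, and the
  squared inner product is homogeneous of degree two in \<open>g\<close>.\<close>

lemma nn_integral_unit_ball_inner_sq:
  fixes g :: "real^'n::finite"
  shows "(\<integral>\<^sup>+h. ennreal ((if norm h < 1 then 1 else 0) * (g \<bullet> h)\<^sup>2) \<partial>lborel) =
     unit_ball_moment TYPE('n) * ennreal ((norm g)\<^sup>2)"
proof -
  let ?e = "axis (SOME k. True) 1 :: real^'n"
  define e' where "e' = g /\<^sub>R norm g"
  define q where "q e h = ennreal ((if norm h < 1 then 1 else 0) * (e \<bullet> h)\<^sup>2)" for e h :: "real^'n"
  have [measurable]: "q e \<in> borel_measurable borel" for e unfolding q_def by measurable
  have U: "unit_ball_moment TYPE('n) = (\<integral>\<^sup>+h. q ?e h \<partial>lborel)" by (simp add: unit_ball_moment_def q_def)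
  show ?thesis
  proof (cases "g = 0")
    case False
    then have ne: "norm ?e = norm e'" by (simp add: e'_def)
    have "(\<integral>\<^sup>+h. q e' h \<partial>lborel) = unit_ball_moment TYPE('n)"
    proof (cases "?e = e'")
      case False
      then obtain \<nu> where \<nu>: "norm \<nu> = 1" "mirror \<nu> 0 ?e = e'" using mirror_maps_sphere[OF ne] by blast
      have "norm (mirror \<nu> 0 h) = norm h" for h
        using dist_mirror[OF \<nu>(1), where x = h and y = 0 and t = 0] by (simp add: mirror_def)
      moreover have "e' \<bullet> mirror \<nu> 0 h = ?e \<bullet> h" for h
      proof -
        have "\<nu> \<bullet> \<nu> = 1" using \<nu>(1) by (simp add: dot_square_norm)
        then have "mirror \<nu> 0 ?e \<bullet> mirror \<nu> 0 h = ?e \<bullet> h"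
          by (simp add: mirror_def inner_diff_left inner_diff_right inner_commute)
        then show ?thesis using \<nu>(2) by simp
      qed
      ultimately have "q e' (mirror \<nu> 0 h) = q ?e h" for h by (simp add: q_def)
      then show ?thesis unfolding U using nn_integral_mirror[OF \<nu>(1), of "q e'" 0] by simp
    qed (simp add: U)
    moreover have "q g h = ennreal ((norm g)\<^sup>2) * q e' h" for h
    proof -
      have "g \<bullet> h = norm g * (e' \<bullet> h)" using False by (simp add: e'_def)
      then show ?thesis by (simp add: q_def ennreal_mult'[symmetric] power_mult_distrib)
    qed
    ultimately show ?thesis
      by (simp add: q_def[symmetric] nn_integral_cmult) (simp add: mult.commute)
  qed simp
qed

lemma unit_ball_moment_pos_finite: "unit_ball_moment TYPE('n::finite) \<noteq> 0" "unit_ball_moment TYPE('n) \<noteq> \<infinity>"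
proof -
  let ?e = "axis (SOME k. True) 1 :: real^'n"
  define q where "q h = (if norm h < 1 then 1 else 0) * (?e \<bullet> h)\<^sup>2" for h
  \<comment> \<open>A continuous minorant of \<open>q\<close>, so that positivity at one point
    forces a positive integral.\<close>
  define b where "b h = bump 0 (1\<^sup>2 - (norm h)\<^sup>2) * (?e \<bullet> h)\<^sup>2" for h
  have [measurable]: "q \<in> borel_measurable borel" unfolding q_def by measurable
  have "integrable lborel q"
  proof (rule integrable_bounded_support[of _ 1 1])
    fix h :: "real^'n"
    have "\<bar>?e \<bullet> h\<bar> \<le> 1" if "norm h < 1"
      using Cauchy_Schwarz_ineq2[of ?e h] that by simp
    then show "\<bar>q h\<bar> \<le> 1" unfolding q_def by (auto simp: abs_square_le_1)
  qed (auto simp: q_def)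
  then show "unit_ball_moment TYPE('n) \<noteq> \<infinity>"
    unfolding unit_ball_moment_def q_def[symmetric] by (subst nn_integral_eq_integral) (auto simp: q_def)
  have cb: "continuous_on UNIV b" unfolding b_def by (intro continuous_intros continuous_bump_norm) simp
  have b0: "b h \<ge> 0" for h using bump_0_bounds(1) by (simp add: b_def)
  have ib: "integrable lborel b"
  proof (rule integrable_continuous_bounded_support[OF cb])
    fix h :: "real^'n" assume "norm h > 1"
    then have "bump 0 (1\<^sup>2 - (norm h)\<^sup>2) = 0" by (subst bump_norm_eq_0) auto
    then show "b h = 0" by (simp only: b_def mult_zero_left)
  qed
  have "0 < (LINT h|lborel. b h)"
  proof (rule integral_pos_continuous[OF cb b0 ib])
    show "b ((1/2) *\<^sub>R ?e) > 0" by (auto simp: b_def bump_0_bounds(3) power2_eq_square)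
  qed
  then have "0 < ennreal (LINT h|lborel. b h)" by simp
  also have "\<dots> = (\<integral>\<^sup>+h. ennreal (b h) \<partial>lborel)" using ib b0 by (intro nn_integral_eq_integral[symmetric]) auto
  also have "\<dots> \<le> unit_ball_moment TYPE('n)"
    unfolding unit_ball_moment_def q_def[symmetric]
  proof (intro nn_integral_mono ennreal_leI)
    fix h :: "real^'n"
    show "b h \<le> q h"
      using bump_0_bounds(2)[of "1 - (norm h)\<^sup>2"] bump_norm_eq_0[of 1 h] by (auto simp: b_def q_def mult_left_le_one_le bump_0_bounds(1))
  qed
  finally show "unit_ball_moment TYPE('n) \<noteq> 0" by simp
qed

text \<open>This is \<open>nonlocal_energy\<close> after the substitution y = x + \<epsilon> h,
  divided by the powers of \<epsilon> that it produces: the domain of \<open>h\<close> becomes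
  fixed, and the integrand converges as \<epsilon> tends to \<open>0\<close>.\<close>

definition difference_energy :: "real \<Rightarrow> (real^'n::finite \<Rightarrow> real) \<Rightarrow> ennreal" where
  "difference_energy \<epsilon> f =
    (\<integral>\<^sup>+x. \<integral>\<^sup>+h. ennreal ((if norm h < 1 then 1 else 0) * ((f (x + \<epsilon> *\<^sub>R h) - f x) / \<epsilon>)\<^sup>2) \<partial>lborel \<partial>lborel)"

lemma nonlocal_energy_eq_difference:
  fixes f :: "real^'n::finite \<Rightarrow> real"
  assumes [measurable]: "f \<in> borel_measurable borel" and \<epsilon>: "\<epsilon> > 0"
  shows "nonlocal_energy \<epsilon> f = ennreal (\<epsilon> ^ CARD('n) * \<epsilon>\<^sup>2) * difference_energy \<epsilon> f"
proof -
  have "(\<integral>\<^sup>+y. ennreal ((if dist x y < \<epsilon> then 1 else 0) * (f x - f y)\<^sup>2) \<partial>lborel) =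
    ennreal (\<epsilon> ^ CARD('n) * \<epsilon>\<^sup>2) * (\<integral>\<^sup>+h. ennreal ((if norm h < 1 then 1 else 0) * ((f (x + \<epsilon> *\<^sub>R h) - f x) / \<epsilon>)\<^sup>2) \<partial>lborel)" for x
  proof -
    have "(\<integral>\<^sup>+y. ennreal ((if dist x y < \<epsilon> then 1 else 0) * (f x - f y)\<^sup>2) \<partial>lborel) =
      ennreal (\<epsilon> ^ CARD('n)) * (\<integral>\<^sup>+h. ennreal ((if dist x (x + \<epsilon> *\<^sub>R h) < \<epsilon> then 1 else 0) * (f x - f (x + \<epsilon> *\<^sub>R h))\<^sup>2) \<partial>lborel)"
      using \<epsilon> by (subst nn_integral_affine[of _ \<epsilon> x]) auto
    also have "\<dots> = ennreal (\<epsilon> ^ CARD('n)) * (\<integral>\<^sup>+h. ennreal (\<epsilon>\<^sup>2) * ennreal ((if norm h < 1 then 1 else 0) * ((f (x + \<epsilon> *\<^sub>R h) - f x) / \<epsilon>)\<^sup>2) \<partial>lborel)"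
      using \<epsilon> by (intro arg_cong2[where f = "(*)"] refl nn_integral_cong)
        (auto simp: dist_norm ennreal_mult'[symmetric] power_divide power2_commute)
    also have "\<dots> = ennreal (\<epsilon> ^ CARD('n) * \<epsilon>\<^sup>2) * (\<integral>\<^sup>+h. ennreal ((if norm h < 1 then 1 else 0) * ((f (x + \<epsilon> *\<^sub>R h) - f x) / \<epsilon>)\<^sup>2) \<partial>lborel)"
      using \<epsilon> by (subst nn_integral_cmult) (auto simp: ennreal_mult mult.assoc)
    finally show ?thesis .
  qed
  then show ?thesis unfolding nonlocal_energy_def difference_energy_def
    by (simp add: nn_integral_cmult)
qed

lemma difference_energy_limit:
  fixes f :: "real^'n::finite \<Rightarrow> real"
  assumes f: "f \<in> C1c \<Omega>"
  shows "(\<lambda>j. difference_energy (1 / Suc j) f) \<longlonglongrightarrow> unit_ball_moment TYPE('n) * ennreal (dirichlet f)"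
proof -
  obtain R M where RM: "R > 0" "M > 0" "\<And>x. norm x > R \<Longrightarrow> f x = 0 \<and> grad f x = 0"
    "\<And>x. \<bar>f x\<bar> \<le> M" "\<And>x. norm (grad f x) \<le> M" "\<And>x y. \<bar>f x - f y\<bar> \<le> M * norm (x - y)"
    using C1c_bounds[OF f] by blast
  note [measurable] = C1cD(4,5)[OF f]
  define t where "t j = 1 / real (Suc j)" for j
  have t: "0 < t j" "t j \<le> 1" for j by (auto simp: t_def)
  have t0: "t \<longlonglongrightarrow> 0" unfolding t_def using LIMSEQ_inverse_real_of_nat by (simp add: inverse_eq_divide)
  have tf: "filterlim t (at 0) sequentially"
    using t0 t(1) by (auto simp: filterlim_at intro!: always_eventually) (metis less_irrefl)
  define q where "q j x h = (if norm h < 1 then 1 else 0) * ((f (x + t j *\<^sub>R h) - f x) / t j)\<^sup>2" for j and x h :: "real^'n"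
  have [measurable]: "case_prod (q j) \<in> borel_measurable (lborel \<Otimes>\<^sub>M lborel)" "q j x \<in> borel_measurable borel" for j x
    unfolding q_def by measurable
  \<comment> \<open>Difference quotients are bounded by the Lipschitz constant times
    \<open>norm h\<close>, and steps shorter than 1 keep the support within radius
    \<open>R + 1\<close>.\<close>
  define w where "w x h = (M\<^sup>2 * indicator (cball 0 (R + 1)) x) * indicator (ball 0 1) h" for x h :: "real^'n"
  have wm: "w x \<in> borel_measurable borel" for x
    unfolding w_def
    by (intro borel_measurable_times borel_measurable_const borel_measurable_indicator borel_open open_ball)
  have qw: "q j x h \<le> w x h" for j x h
  proof (cases "norm h < 1")
    case True
    have "norm (t j *\<^sub>R h) \<le> 1" using t[of j] True by (simp add: mult_le_one)
    then have n: "norm x \<le> norm (x + t j *\<^sub>R h) + 1"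
      using norm_triangle_ineq4[of "x + t j *\<^sub>R h" "t j *\<^sub>R h"] by simp
    show ?thesis
    proof (cases "norm x \<le> R + 1")
      case x: True
      have "\<bar>f (x + t j *\<^sub>R h) - f x\<bar> \<le> M * (t j * norm h)"
        using RM(6)[of "x + t j *\<^sub>R h" x] t(1)[of j] by simp
      also have "\<dots> \<le> M * (t j * 1)" using True RM(2) t(1)[of j] by (intro mult_left_mono) auto
      finally have "\<bar>(f (x + t j *\<^sub>R h) - f x) / t j\<bar> \<le> M" using t(1)[of j] by (simp add: field_simps)
      then have "((f (x + t j *\<^sub>R h) - f x) / t j)\<^sup>2 \<le> M\<^sup>2" by (metis abs_le_square_iff abs_of_pos RM(2))
      then show ?thesis using True x by (simp add: q_def w_def)
    next
      case False
      then show ?thesis using n RM(3)[of x] RM(3)[of "x + t j *\<^sub>R h"] by (simp add: q_def w_def)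
    qed
  qed (simp add: q_def w_def)
  have eb: "emeasure lborel (ball (0::real^'n) 1) < \<infinity>" "emeasure lborel (cball (0::real^'n) (R + 1)) < \<infinity>"
    by (rule emeasure_bounded_finite, simp)+
  have wint: "(\<integral>\<^sup>+h. ennreal (w x h) \<partial>lborel) = ennreal (M\<^sup>2 * indicator (cball 0 (R + 1)) x) * emeasure lborel (ball (0::real^'n) 1)" for x
  proof -
    have "ennreal (w x h) = ennreal (M\<^sup>2 * indicator (cball 0 (R + 1)) x) * indicator (ball 0 1) h" for h
      by (simp add: w_def indicator_def)
    then show ?thesis by (simp only:) (subst nn_integral_cmult, auto intro!: borel_measurable_indicator)
  qed
  have qlim: "(\<lambda>j. q j x h) \<longlonglongrightarrow> (if norm h < 1 then 1 else 0) * (grad f x \<bullet> h)\<^sup>2" for x h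
  proof -
    have "((\<lambda>s. f (x + s *\<^sub>R h)) has_derivative (\<lambda>r. grad f (x + 0 *\<^sub>R h) \<bullet> (r *\<^sub>R h))) (at 0)"
      by (rule has_derivative_compose[where f = "\<lambda>s. x + s *\<^sub>R h"]) (auto intro!: derivative_eq_intros C1cD(1)[OF f])
    then have "((\<lambda>s. f (x + s *\<^sub>R h)) has_field_derivative (grad f x \<bullet> h)) (at 0)"
      unfolding has_field_derivative_def by (rule has_derivative_eq_rhs) (auto simp: mult.commute)
    then have "((\<lambda>s. (f (x + s *\<^sub>R h) - f x) / s) \<longlongrightarrow> grad f x \<bullet> h) (at 0)"
      unfolding DERIV_def by simp
    then have "(\<lambda>j. (f (x + t j *\<^sub>R h) - f x) / t j) \<longlonglongrightarrow> grad f x \<bullet> h"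
      by (rule filterlim_compose[OF _ tf])
    then show ?thesis unfolding q_def by (intro tendsto_intros)
  qed
  have inner: "(\<lambda>j. \<integral>\<^sup>+h. ennreal (q j x h) \<partial>lborel) \<longlonglongrightarrow> unit_ball_moment TYPE('n) * ennreal ((norm (grad f x))\<^sup>2)" for x
    unfolding nn_integral_unit_ball_inner_sq[symmetric]
  proof (rule nn_integral_dominated_convergence[where w = "\<lambda>h. ennreal (w x h)"])
    show "(\<integral>\<^sup>+h. ennreal (w x h) \<partial>lborel) < \<infinity>"
      unfolding wint using eb(1) by (simp add: ennreal_mult_less_top)
    show "AE h in lborel. (\<lambda>j. ennreal (q j x h)) \<longlonglongrightarrow> ennreal ((if norm h < 1 then 1 else 0) * (grad f x \<bullet> h)\<^sup>2)"
      by (intro AE_I2 tendsto_ennrealI qlim)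
  qed (use qw wm in \<open>auto intro!: ennreal_leI\<close>)
  have "(\<lambda>j. \<integral>\<^sup>+x. \<integral>\<^sup>+h. ennreal (q j x h) \<partial>lborel \<partial>lborel) \<longlonglongrightarrow> (\<integral>\<^sup>+x. unit_ball_moment TYPE('n) * ennreal ((norm (grad f x))\<^sup>2) \<partial>lborel)"
  proof (rule nn_integral_dominated_convergence[where w = "\<lambda>x. \<integral>\<^sup>+h. ennreal (w x h) \<partial>lborel"])
    show "(\<integral>\<^sup>+x. \<integral>\<^sup>+h. ennreal (w x h) \<partial>lborel \<partial>lborel) < \<infinity>"
    proof -
      have S: "cball (0::real^'n) (R + 1) \<in> sets lborel" by simp
      have im: "(\<lambda>x::real^'n. ennreal (M\<^sup>2) * indicator (cball 0 (R + 1)) x) \<in> borel_measurable lborel"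
        by (intro borel_measurable_times_ennreal borel_measurable_const borel_measurable_indicator S)
      have "ennreal (M\<^sup>2 * indicator (cball 0 (R + 1)) x) = ennreal (M\<^sup>2) * indicator (cball 0 (R + 1)) x" for x :: "real^'n"
        by (simp add: indicator_def)
      then have "(\<integral>\<^sup>+x. \<integral>\<^sup>+h. ennreal (w x h) \<partial>lborel \<partial>lborel) =
         ennreal (M\<^sup>2) * emeasure lborel (cball (0::real^'n) (R + 1)) * emeasure lborel (ball (0::real^'n) 1)"
        unfolding wint
        by (simp only: nn_integral_multc[OF im] nn_integral_cmult_indicator[OF S])
      then show ?thesis using eb by (simp add: ennreal_mult_less_top)
    qed
    show "(\<lambda>x. \<integral>\<^sup>+h. ennreal (w x h) \<partial>lborel) \<in> borel_measurable lborel" unfolding wint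
      by (intro borel_measurable_times_ennreal borel_measurable_const measurable_compose[OF _ measurable_ennreal]
          borel_measurable_times borel_measurable_indicator) simp
    show "AE x in lborel. (\<integral>\<^sup>+h. ennreal (q j x h) \<partial>lborel) \<le> (\<integral>\<^sup>+h. ennreal (w x h) \<partial>lborel)" for j
      by (intro AE_I2 nn_integral_mono ennreal_leI qw)
    show "AE x in lborel. (\<lambda>j. \<integral>\<^sup>+h. ennreal (q j x h) \<partial>lborel) \<longlonglongrightarrow> unit_ball_moment TYPE('n) * ennreal ((norm (grad f x))\<^sup>2)"
      by (intro AE_I2 inner)
  qed measurable
  moreover have "(\<integral>\<^sup>+x. unit_ball_moment TYPE('n) * ennreal ((norm (grad f x))\<^sup>2) \<partial>lborel) = unit_ball_moment TYPE('n) * ennreal (dirichlet f)"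
    unfolding dirichlet_def using integrable_C1c(2)[OF f]
    by (subst nn_integral_cmult) (auto simp: nn_integral_eq_integral)
  ultimately show ?thesis unfolding difference_energy_def q_def t_def by simp
qed

text \<open>The powers of \<epsilon> and the moment of the unit ball are the same positive finite
  factors on both sides, so the comparison of the nonlocal energies survives in the limit.\<close>

lemma dirichlet_mono_nonlocal:
  fixes f g :: "real^'n::finite \<Rightarrow> real"
  assumes f: "f \<in> C1c \<Omega>" and g: "g \<in> C1c \<Omega>'" and le: "\<And>\<epsilon>. \<epsilon> > 0 \<Longrightarrow> nonlocal_energy \<epsilon> f \<le> nonlocal_energy \<epsilon> g"
  shows "dirichlet f \<le> dirichlet g"
proof -
  have "difference_energy (1 / Suc j) f \<le> difference_energy (1 / Suc j) g" for j :: nat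
    using le[of "1 / Suc j"] C1cD(4)[OF f] C1cD(4)[OF g]
    by (simp add: nonlocal_energy_eq_difference ennreal_mult_le_mult_iff)
  then have "unit_ball_moment TYPE('n) * ennreal (dirichlet f) \<le> unit_ball_moment TYPE('n) * ennreal (dirichlet g)"
    by (intro LIMSEQ_le[OF difference_energy_limit[OF f] difference_energy_limit[OF g]]) auto
  then have "ennreal (dirichlet f) \<le> ennreal (dirichlet g)"
    using unit_ball_moment_pos_finite[where 'n = 'n] by (subst (asm) ennreal_mult_le_mult_iff) auto
  moreover have "dirichlet g \<ge> 0" unfolding dirichlet_def by (intro Bochner_Integration.integral_nonneg) auto
  ultimately show ?thesis by (simp add: ennreal_le_iff)
qed

text \<open>Jensen's inequality for the probability density \<open>mollifier \<delta>\<close>.\<close>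

lemma nonlocal_energy_mollify:
  fixes f :: "real^'n::finite \<Rightarrow> real"
  assumes \<delta>: "\<delta> > 0" and f: "continuous_on UNIV f"
  shows "nonlocal_energy \<epsilon> (mollify \<delta> f) \<le> nonlocal_energy \<epsilon> f"
proof -
  have [measurable]: "f \<in> borel_measurable borel" using f by (rule borel_measurable_continuous_onI)
  note [measurable] = mollifier_measurable[OF \<delta>, where 'a = 'n]
  let ?\<phi> = "mollifier \<delta> :: real^'n \<Rightarrow> real"
  define k where "k x y = (if dist x y < \<epsilon> then 1 else 0 :: real)" for x y :: "real^'n"
  have k0: "k x y \<ge> 0" for x y by (simp add: k_def)
  have [measurable]: "case_prod k \<in> borel_measurable (borel \<Otimes>\<^sub>M borel)" "k x \<in> borel_measurable borel" for x
    unfolding k_def by measurable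
  have J: "(mollify \<delta> f x - mollify \<delta> f y)\<^sup>2 \<le> (LINT z|lborel. ?\<phi> z * (f (x + z) - f (y + z))\<^sup>2)"
    and I: "integrable lborel (\<lambda>z. ?\<phi> z * (f (x + z) - f (y + z))\<^sup>2)" for x y
  proof -
    define g where "g z = f (x + z) - f (y + z)" for z
    have cg: "continuous_on UNIV g" unfolding g_def
      by (intro continuous_intros continuous_on_compose2[OF f]) auto
    have i1: "integrable lborel (\<lambda>z. ?\<phi> z * g z)"
      using integrable_mollifier_times[OF \<delta> cg, of 0] by simp
    have "continuous_on UNIV (\<lambda>z. (g z)\<^sup>2)" by (intro continuous_intros cg)
    then show i2: "integrable lborel (\<lambda>z. ?\<phi> z * (f (x + z) - f (y + z))\<^sup>2)"
      using integrable_mollifier_times[OF \<delta>, of "\<lambda>z. (g z)\<^sup>2" 0] by (simp add: g_def)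
    define m where "m = (LINT z|lborel. ?\<phi> z * g z)"
    have "mollify \<delta> f x - mollify \<delta> f y = m"
      unfolding mollify_def m_def g_def
      using integrable_mollifier_times[OF \<delta> f, of x] integrable_mollifier_times[OF \<delta> f, of y]
      by (simp add: right_diff_distrib)
    \<comment> \<open>Jensen's inequality for the square is the nonnegativity of this
      variance.\<close>
    moreover have "0 \<le> (LINT z|lborel. ?\<phi> z * (g z - m)\<^sup>2)"
      using mollifier_nonneg[OF \<delta>, where 'a = 'n] by (intro Bochner_Integration.integral_nonneg mult_nonneg_nonneg) auto
    moreover have "(LINT z|lborel. ?\<phi> z * (g z - m)\<^sup>2) = (LINT z|lborel. ?\<phi> z * (g z)\<^sup>2 - 2 * m * (?\<phi> z * g z) + m\<^sup>2 * ?\<phi> z)"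
      by (intro Bochner_Integration.integral_cong refl) (simp add: power2_eq_square algebra_simps)
    moreover have "\<dots> = (LINT z|lborel. ?\<phi> z * (g z)\<^sup>2) - 2 * m * m + m\<^sup>2 * 1"
      using i1 i2[unfolded g_def[symmetric]] mollifier_integrable[OF \<delta>, where 'n = 'n] mollifier_integral[OF \<delta>, where 'n = 'n]
      by (simp add: m_def)
    ultimately show "(mollify \<delta> f x - mollify \<delta> f y)\<^sup>2 \<le> (LINT z|lborel. ?\<phi> z * (f (x + z) - f (y + z))\<^sup>2)"
      by (simp add: g_def power2_eq_square)
  qed
  have "nonlocal_energy \<epsilon> (mollify \<delta> f) \<le>
     (\<integral>\<^sup>+x. \<integral>\<^sup>+y. \<integral>\<^sup>+z. ennreal (?\<phi> z) * ennreal (k x y * (f (x + z) - f (y + z))\<^sup>2) \<partial>lborel \<partial>lborel \<partial>lborel)"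
    unfolding nonlocal_energy_def k_def[symmetric]
  proof (intro nn_integral_mono)
    fix x y
    have "ennreal (k x y * (mollify \<delta> f x - mollify \<delta> f y)\<^sup>2) \<le> ennreal (LINT z|lborel. k x y * (?\<phi> z * (f (x + z) - f (y + z))\<^sup>2))"
      using mult_left_mono[OF J k0] by (intro ennreal_leI) simp
    also have "\<dots> = (\<integral>\<^sup>+z. ennreal (k x y * (?\<phi> z * (f (x + z) - f (y + z))\<^sup>2)) \<partial>lborel)"
      using I[of x y] k0 mollifier_nonneg[OF \<delta>, where 'a = 'n]
      by (intro nn_integral_eq_integral[symmetric] AE_I2 mult_nonneg_nonneg) auto
    also have "\<dots> = (\<integral>\<^sup>+z. ennreal (?\<phi> z) * ennreal (k x y * (f (x + z) - f (y + z))\<^sup>2) \<partial>lborel)"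
      using mollifier_nonneg[OF \<delta>, where 'a = 'n] by (intro nn_integral_cong) (simp add: ennreal_mult'[symmetric] mult.left_commute)
    finally show "ennreal (k x y * (mollify \<delta> f x - mollify \<delta> f y)\<^sup>2) \<le> \<dots>" .
  qed
  \<comment> \<open>The order of integration is changed until \<open>z\<close> is outermost; for
    fixed \<open>z\<close> the remaining double integral is invariant under the common translation
    by \<open>z\<close>.\<close>
  also have "\<dots> = (\<integral>\<^sup>+x. \<integral>\<^sup>+z. \<integral>\<^sup>+y. ennreal (?\<phi> z) * ennreal (k x y * (f (x + z) - f (y + z))\<^sup>2) \<partial>lborel \<partial>lborel \<partial>lborel)"
    by (intro nn_integral_cong lborel_pair.Fubini') measurable
  also have "\<dots> = (\<integral>\<^sup>+z. \<integral>\<^sup>+x. \<integral>\<^sup>+y. ennreal (?\<phi> z) * ennreal (k x y * (f (x + z) - f (y + z))\<^sup>2) \<partial>lborel \<partial>lborel \<partial>lborel)"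
    by (intro lborel_pair.Fubini') measurable
  also have "\<dots> = (\<integral>\<^sup>+z. ennreal (?\<phi> z) * nonlocal_energy \<epsilon> f \<partial>lborel)"
  proof (intro nn_integral_cong)
    fix z :: "real^'n"
    define G where "G x y = ennreal (k x y * (f x - f y)\<^sup>2)" for x y
    have [measurable]: "case_prod G \<in> borel_measurable (lborel \<Otimes>\<^sub>M lborel)" "G x \<in> borel_measurable borel" for x
      unfolding G_def by measurable
    have sh: "ennreal (k x y * (f (x + z) - f (y + z))\<^sup>2) = G (z + x) (z + y)" for x y
      by (simp add: G_def k_def dist_norm add.commute)
    have "(\<integral>\<^sup>+x. \<integral>\<^sup>+y. G (z + x) (z + y) \<partial>lborel \<partial>lborel) = (\<integral>\<^sup>+x. \<integral>\<^sup>+y. G (z + x) y \<partial>lborel \<partial>lborel)"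
      by (intro nn_integral_cong nn_integral_translation) measurable
    also have "\<dots> = (\<integral>\<^sup>+x. \<integral>\<^sup>+y. G x y \<partial>lborel \<partial>lborel)"
      by (rule nn_integral_translation[of "\<lambda>x. \<integral>\<^sup>+y. G x y \<partial>lborel"]) measurable
    also have "\<dots> = nonlocal_energy \<epsilon> f" by (simp add: nonlocal_energy_def G_def k_def)
    finally show "(\<integral>\<^sup>+x. \<integral>\<^sup>+y. ennreal (?\<phi> z) * ennreal (k x y * (f (x + z) - f (y + z))\<^sup>2) \<partial>lborel \<partial>lborel) = ennreal (?\<phi> z) * nonlocal_energy \<epsilon> f"
      unfolding sh by (simp add: nn_integral_cmult)
  qed
  also have "\<dots> = nonlocal_energy \<epsilon> f"
    using mollifier_integrable[OF \<delta>, where 'n = 'n] mollifier_integral[OF \<delta>, where 'n = 'n] mollifier_nonneg[OF \<delta>, where 'a = 'n]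
    by (simp add: nn_integral_multc nn_integral_eq_integral)
  finally show ?thesis .
qed

lemma weighted_mass_nonneg: "weighted_mass a p f \<ge> 0"
  unfolding weighted_mass_def by (intro Bochner_Integration.integral_nonneg) auto

text \<open>The rearranged function is only Lipschitz, so it is mollified. This keeps it radial and
  does not raise the nonlocal energies, which control the Dirichlet integral of the smooth result,
  while the mass converges. The strict inequality absorbs the error.\<close>

lemma radial_competitor:
  fixes u :: "real^'n::finite \<Rightarrow> real"
  assumes u: "u \<in> C1c \<Omega>" and a: "a \<le> 0" "a > - real CARD('n)" and p: "p > 0" and q: "q > 0"
    and C: "dirichlet u < C * weighted_mass a p u powr q" "C \<ge> 0"
  obtains v :: "real^'n \<Rightarrow> real" where "v \<in> C1c UNIV" "\<And>x y. norm x = norm y \<Longrightarrow> v x = v y" "dirichlet v < C * weighted_mass a p v powr q"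
proof -
  obtain f :: "real^'n \<Rightarrow> real" and R L where *: "R > 0 \<and> L > 0 \<and> (\<forall>x y. \<bar>f x - f y\<bar> \<le> L * dist x y) \<and> (\<forall>x. 0 \<le> f x) \<and> (\<forall>x. f x \<le> L) \<and>
    (\<forall>x. norm x > R \<longrightarrow> f x = 0) \<and> (\<forall>\<epsilon>. nonlocal_energy \<epsilon> f \<le> nonlocal_energy \<epsilon> u) \<and>
    weighted_mass a p u \<le> weighted_mass a p f \<and> (\<forall>x y. norm x = norm y \<longrightarrow> f y \<le> f x)"
    using radial_rearrangement[OF u a p] by (elim exE) (rule that)
  have f: "R > 0" "L > 0" "\<And>x y. \<bar>f x - f y\<bar> \<le> L * dist x y" "\<And>x. f x \<ge> 0" "\<And>x. f x \<le> L"
    "\<And>x. norm x > R \<Longrightarrow> f x = 0"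
    "\<And>\<epsilon>. nonlocal_energy \<epsilon> f \<le> nonlocal_energy \<epsilon> u" "weighted_mass a p u \<le> weighted_mass a p f"
    and rad: "\<And>x y. norm x = norm y \<Longrightarrow> f y \<le> f x"
    using * by blast+
  have cf: "continuous_on UNIV f"
    by (rule lipschitz_on_continuous_on[of L], rule lipschitz_onI) (use f in \<open>auto simp: dist_real_def\<close>)
  define d where "d j = 1 / real (Suc j)" for j
  have d: "d j > 0" "d j \<le> 1" for j by (auto simp: d_def)
  define F where "F j = mollify (d j) f" for j
  have close: "\<bar>F j x - f x\<bar> \<le> L * d j" for j x
  proof -
    have "norm (mollify (d j) f x - f x) \<le> L * d j"
    proof (rule mollify_close[OF d(1) cf])
      fix z :: "real^'n" assume "norm z \<le> d j"
      then show "norm (f (x + z) - f x) \<le> L * d j"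
        using f(3)[of "x + z" x] f(2) by (auto simp: dist_norm intro: order_trans mult_left_mono)
    qed
    then show ?thesis by (simp add: F_def)
  qed
  have z: "F j x = 0" if "norm x > R + 1" for j x
    unfolding F_def
  proof (rule mollify_eq_0[OF d(1)])
    fix z :: "real^'n" assume "norm z \<le> d j"
    then have "norm (x + z) > R"
      using that d(2)[of j] norm_triangle_ineq4[of "x + z" z] by simp
    then show "f (x + z) = 0" by (rule f(6))
  qed
  have "F j \<in> test_functions UNIV" for j
  proof (rule test_functionsI)
    show "C_k k (F j)" for k unfolding F_def using f(6) by (intro C_k_mollify[OF d(1) cf]) auto
    show "F j x = 0" if "x \<notin> cball 0 (R + 1)" for x using z that by simp
  qed auto
  then have F1: "F j \<in> C1c UNIV" for j using test_functions_subset_C1c by blast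
  have D: "dirichlet (F j) \<le> dirichlet u" for j
    unfolding F_def
    by (rule dirichlet_mono_nonlocal[OF F1[unfolded F_def] u]) (rule order_trans[OF nonlocal_energy_mollify[OF d(1) cf] f(7)])
  have d0: "d \<longlonglongrightarrow> 0" unfolding d_def using LIMSEQ_inverse_real_of_nat by (simp add: inverse_eq_divide)
  have lim: "(\<lambda>j. F j x) \<longlonglongrightarrow> f x" for x
  proof (rule LIM_zero_cancel, rule Lim_null_comparison[OF always_eventually])
    show "\<forall>j. norm (F j x - f x) \<le> L * d j" using close by simp
    show "(\<lambda>j. L * d j) \<longlonglongrightarrow> 0" using tendsto_mult[OF tendsto_const d0, of L] by simp
  qed
  have bd: "\<bar>F j x\<bar> \<le> 2 * L" for j x
    using close[of j x] f(4,5)[of x] mult_left_mono[OF d(2)[of j] less_imp_le[OF f(2)]] by linarith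
  have "(\<lambda>j. weighted_mass a p (F j)) \<longlonglongrightarrow> weighted_mass a p f"
    by (rule weighted_mass_tendsto[OF a(2) p _ _ lim z bd]) (use C1cD(4)[OF F1] borel_measurable_continuous_onI[OF cf] in auto)
  then have "(\<lambda>j. C * weighted_mass a p (F j) powr q) \<longlonglongrightarrow> C * weighted_mass a p f powr q"
    using q by (intro tendsto_mult tendsto_const tendsto_powr') (auto simp: weighted_mass_nonneg)
  moreover have "dirichlet u < C * weighted_mass a p f powr q"
  proof -
    have "C * weighted_mass a p u powr q \<le> C * weighted_mass a p f powr q"
      using f(8) q C(2) weighted_mass_nonneg[of a p u] by (intro mult_left_mono powr_mono2) auto
    with C(1) show ?thesis by linarith
  qed
  ultimately have "eventually (\<lambda>j. dirichlet u < C * weighted_mass a p (F j) powr q) sequentially"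
    by (rule order_tendstoD)
  then obtain j where "dirichlet u < C * weighted_mass a p (F j) powr q"
    using eventually_happens'[OF sequentially_bot] by blast
  then have "dirichlet (F j) < C * weighted_mass a p (F j) powr q" using D[of j] by linarith
  moreover have "F j x = F j y" if "norm x = norm y" for x y
    unfolding F_def by (rule mollify_radial[OF d(1) cf _ that]) (metis rad antisym)
  ultimately show thesis by (intro that[of "F j"] F1)
qed

subsection \<open>Radial maps\<close>

lemma integral_change_of_variables_open:
  fixes f :: "real^'n::finite \<Rightarrow> real" and g v :: "real^'n \<Rightarrow> real^'n"
  assumes S: "open S" and gS: "open (g ` S)"
    and der: "\<And>x. x \<in> S \<Longrightarrow> (g has_derivative (\<lambda>h. c x *\<^sub>R h + (d x * (v x \<bullet> h)) *\<^sub>R v x)) (at x)"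
    and inj: "inj_on g S" and cont: "continuous_on S c" "continuous_on S d" "continuous_on S v"
    and f [measurable]: "f \<in> borel_measurable borel"
  shows "(LINT y|lborel. indicator (g ` S) y * f y) =
     (LINT x|lborel. indicator S x * (\<bar>c x ^ (CARD('n) - 1) * (c x + d x * (v x \<bullet> v x))\<bar> * f (g x)))"
proof (rule integral_change_of_variables_rank_one[OF _ der inj _ f])
  let ?J = "\<lambda>x. \<bar>c x ^ (CARD('n) - 1) * (c x + d x * (v x \<bullet> v x))\<bar>"
  show Sb: "S \<in> sets borel" "g ` S \<in> sets borel" using S gS by auto
  have cg: "continuous_on S g"
    by (rule has_derivative_continuous_on) (rule has_derivative_at_withinI[OF der])
  have [measurable]: "(\<lambda>x. indicator S x *\<^sub>R g x) \<in> borel_measurable borel"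
    by (rule borel_measurable_continuous_on_indicator[OF Sb(1) cg])
  have [measurable]: "(\<lambda>x. indicator S x *\<^sub>R ?J x) \<in> borel_measurable borel"
    by (intro borel_measurable_continuous_on_indicator[OF Sb(1)] continuous_intros cont)
  have "(\<lambda>x. (indicator S x *\<^sub>R ?J x) * f (indicator S x *\<^sub>R g x)) \<in> borel_measurable borel"
    by measurable
  also have "(\<lambda>x. (indicator S x *\<^sub>R ?J x) * f (indicator S x *\<^sub>R g x)) = (\<lambda>x. indicator S x * (?J x * f (g x)))"
    by (auto simp: fun_eq_iff indicator_def)
  finally show "(\<lambda>x. indicator S x * (?J x * f (g x))) \<in> borel_measurable borel" .
qed

lemma integrable_mult_support:
  fixes A F :: "real^'n::finite \<Rightarrow> real"
  assumes \<Omega>: "open \<Omega>" "compact K" "K \<subseteq> \<Omega>" and A: "continuous_on \<Omega> A" and F: "continuous_on UNIV F"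
    and z: "\<And>x. x \<notin> K \<Longrightarrow> F x = 0"
  shows "integrable lborel (\<lambda>x. A x * F x)"
proof -
  have "continuous_on \<Omega> (\<lambda>x. A x * F x)" by (intro continuous_intros A continuous_on_subset[OF F]) auto
  moreover have "continuous_on (-K) (\<lambda>x. A x * F x)"
    using z by (subst continuous_on_cong[of _ _ _ "\<lambda>_. 0"]) auto
  ultimately have "continuous_on (\<Omega> \<union> -K) (\<lambda>x. A x * F x)"
    using \<Omega> by (intro continuous_on_open_Un) (auto simp: compact_imp_closed)
  moreover have "\<Omega> \<union> -K = UNIV" using \<Omega>(3) by auto
  ultimately have c: "continuous_on UNIV (\<lambda>x. A x * F x)" by simp
  obtain R where "\<And>x. x \<in> K \<Longrightarrow> norm x \<le> R"
    using compact_imp_bounded[OF \<Omega>(2)] bounded_iff by blast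
  then have "x \<notin> K" if "norm x > R" for x using that by (meson not_le)
  then show ?thesis using z by (intro integrable_continuous_bounded_support[OF c, of R]) simp
qed

lemma has_derivative_norm_inner: "x \<noteq> 0 \<Longrightarrow> (norm has_derivative (\<lambda>h. (1 / norm x) * (x \<bullet> h))) (at (x::real^'n::finite))"
  by (rule has_derivative_eq_rhs[OF has_derivative_norm]) (auto simp: sgn_div_norm inner_commute divide_inverse)

lemma has_derivative_comp_radial:
  assumes "(f has_derivative (\<lambda>h. a * (x \<bullet> h))) (at x)" "(\<phi> has_real_derivative b) (at (f x))"
  shows "((\<lambda>x. \<phi> (f x)) has_derivative (\<lambda>h. (b * a) * (x \<bullet> h))) (at x)"
  using has_derivative_compose[OF assms(1) assms(2)[unfolded has_field_derivative_def]]
  by (rule has_derivative_eq_rhs) auto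

lemma has_derivative_mult_radial:
  assumes "(f has_derivative (\<lambda>h. a * (x \<bullet> h))) (at x)" "(g has_derivative (\<lambda>h. b * (x \<bullet> h))) (at x)"
  shows "((\<lambda>x. f x * g x :: real) has_derivative (\<lambda>h. (f x * b + g x * a) * (x \<bullet> h))) (at x)"
  by (rule has_derivative_eq_rhs[OF has_derivative_mult[OF assms]]) (auto simp: algebra_simps)

definition radial_map :: "(real \<Rightarrow> real) \<Rightarrow> real^'n::finite \<Rightarrow> real^'n" where
  "radial_map \<rho> x = (\<rho> (norm x) / norm x) *\<^sub>R x"

text \<open>A radial map stretches tangential directions by the quotient of
  \<open>\<rho> (norm x)\<close> and \<open>norm x\<close>, and the radial direction by
  \<open>\<rho>'\<close>. The rank-one coefficient is the difference of these factors divided by the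
  square of the norm.\<close>

lemma has_derivative_radial_map:
  fixes x :: "real^'n::finite"
  assumes x: "x \<noteq> 0" and \<rho>: "(\<rho> has_real_derivative \<rho>') (at (norm x))"
  shows "(radial_map \<rho> has_derivative (\<lambda>h. (\<rho> (norm x) / norm x) *\<^sub>R h
      + ((\<rho>' - \<rho> (norm x) / norm x) / (norm x)\<^sup>2 * (x \<bullet> h)) *\<^sub>R x)) (at x)"
proof -
  let ?r = "norm x"
  have "((\<lambda>r. \<rho> r / r) has_real_derivative (\<rho>' * ?r - \<rho> ?r) / (?r * ?r)) (at ?r)"
    using x by (auto intro!: derivative_eq_intros \<rho>)
  from has_derivative_comp_radial[OF has_derivative_norm_inner[OF x] this]
  have "((\<lambda>x. \<rho> (norm x) / norm x) has_derivative (\<lambda>h. ((\<rho>' * ?r - \<rho> ?r) / (?r * ?r) * (1 / ?r)) * (x \<bullet> h))) (at x)" .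
  from has_derivative_scaleR[OF this has_derivative_ident]
  show ?thesis unfolding radial_map_def[abs_def]
    by (rule has_derivative_eq_rhs) (use x in \<open>auto simp: fun_eq_iff field_simps power2_eq_square\<close>)
qed

lemma norm_radial_map: "x \<noteq> 0 \<Longrightarrow> \<rho> (norm x) \<ge> 0 \<Longrightarrow> norm (radial_map \<rho> x) = \<rho> (norm x)"
  by (simp add: radial_map_def)

lemma radial_map_inverse:
  assumes "x \<noteq> 0" "\<rho> (norm x) > 0" "\<sigma> (\<rho> (norm x)) = norm x"
  shows "radial_map \<sigma> (radial_map \<rho> x) = x"
  using assms norm_radial_map[of x \<rho>] by (simp add: radial_map_def[of \<sigma>]) (simp add: radial_map_def)

text \<open>The gradient of a radial function is parallel to \<open>x\<close>, expressed here as the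
  equality case of the Cauchy-Schwarz inequality.\<close>

lemma radial_gradient:
  fixes z :: "real^'n::finite \<Rightarrow> real"
  assumes "(z has_derivative (\<lambda>h. g \<bullet> h)) (at x)" and rad: "\<And>x y. norm x = norm y \<Longrightarrow> z x = z y" and x: "x \<noteq> 0"
  shows "(x \<bullet> g)\<^sup>2 = (norm x)\<^sup>2 * (norm g)\<^sup>2"
proof -
  text \<open>Perpendicular to \<open>x\<close>, the function is even along lines.\<close>
  define h where "h = g - ((x \<bullet> g) / (x \<bullet> x)) *\<^sub>R x"
  have xx: "x \<bullet> x \<noteq> 0" using x by simp
  have hx: "x \<bullet> h = 0" using xx by (simp add: h_def inner_diff_right)
  have d: "((\<lambda>s. z (x + s *\<^sub>R h)) has_real_derivative g \<bullet> h) (at 0)"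
  proof -
    have "((\<lambda>s. z (x + s *\<^sub>R h)) has_derivative (\<lambda>s. g \<bullet> (s *\<^sub>R h))) (at 0)"
      by (rule has_derivative_compose[where f = "\<lambda>s. x + s *\<^sub>R h"]) (use assms(1) in \<open>auto intro!: derivative_eq_intros\<close>)
    then show ?thesis unfolding has_field_derivative_def by (rule has_derivative_eq_rhs) auto
  qed
  have "((\<lambda>s. z (x + (- s) *\<^sub>R h)) has_real_derivative (g \<bullet> h) * (-1)) (at 0)"
    by (rule DERIV_chain2[of "\<lambda>s. z (x + s *\<^sub>R h)" _ uminus]) (use d in \<open>auto intro!: derivative_eq_intros\<close>)
  moreover have "z (x + (- s) *\<^sub>R h) = z (x + s *\<^sub>R h)" for s
  proof (rule rad)
    have "h \<bullet> x = 0" using hx by (simp add: inner_commute)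
    then show "norm (x + (- s) *\<^sub>R h) = norm (x + s *\<^sub>R h)"
      unfolding norm_eq using hx by (simp add: inner_add_left inner_add_right inner_diff_left inner_diff_right)
  qed
  ultimately have "((\<lambda>s. z (x + s *\<^sub>R h)) has_real_derivative (g \<bullet> h) * (-1)) (at 0)" by (simp only:)
  from DERIV_unique[OF d this] have "g \<bullet> h = - (g \<bullet> h)" by simp
  then have "g \<bullet> h = 0" by simp
  then have "g \<bullet> g = ((x \<bullet> g) / (x \<bullet> x)) * (x \<bullet> g)" by (simp add: h_def inner_diff_right inner_commute)
  then show ?thesis unfolding power2_norm_eq_inner using xx by (simp add: power2_eq_square field_simps)
qed

subsection \<open>The energies in Euclidean coordinates\<close>

lemma conf_factor_pos: "norm x < 1 \<Longrightarrow> conf_factor x > 0"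
  by (simp add: conf_factor_def abs_square_less_1)

lemma conf_factor_has_derivative:
  assumes "norm x < 1"
  shows "(conf_factor has_derivative (\<lambda>h. (conf_factor x)\<^sup>2 * (x \<bullet> h))) (at x)"
proof -
  have "1 - x \<bullet> x \<noteq> 0" using assms by (simp add: power2_norm_eq_inner[symmetric] abs_square_eq_1)
  then show ?thesis unfolding conf_factor_def[abs_def] power2_norm_eq_inner
    by (auto intro!: derivative_eq_intros simp: inner_commute power_divide field_simps power2_eq_square)
qed

lemma continuous_on_conf_factor: "continuous_on (ball 0 1) conf_factor"
  by (rule has_derivative_continuous_on) (rule has_derivative_at_withinI[OF conf_factor_has_derivative], simp)

lemma conf_factor_measurable [measurable]: "conf_factor \<in> borel_measurable borel"
  unfolding conf_factor_def[abs_def] by measurable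

lemma integral_hyp_volume:
  fixes f :: "real^'n::finite \<Rightarrow> real"
  assumes [measurable]: "f \<in> borel_measurable borel"
  shows "(LINT x|hyp_volume. f x) = (LINT x|lborel. indicator (ball 0 1) x * (conf_factor x ^ CARD('n) * f x))"
proof -
  have "(LINT x|hyp_volume. f x) = (LINT x|lborel. (indicator hyp_space x * conf_factor x ^ CARD('n)) *\<^sub>R f x)"
    unfolding hyp_volume_def
    by (rule integral_density) (auto simp: hyp_space_def indicator_def conf_factor_pos less_imp_le)
  then show ?thesis by (simp add: hyp_space_def mult.assoc)
qed

lemma sinh_hyp_dist_0:
  assumes "norm x < 1" shows "sinh (hyp_dist x 0) = conf_factor x * norm x"
proof -
  have "x \<in> hyp_space" using assms by (simp add: hyp_space_def)
  moreover have "(1 + norm x) / (1 - norm x) > 0" using assms by (intro divide_pos_pos) (auto intro: add_pos_nonneg)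
  ultimately have "sinh (hyp_dist x 0) = ((1 + norm x) / (1 - norm x) - (1 - norm x) / (1 + norm x)) / 2"
    by (simp add: hyp_dist_0 sinh_ln_real)
  also have "\<dots> = ((1 + norm x)\<^sup>2 - (1 - norm x)\<^sup>2) / ((1 - norm x) * (1 + norm x)) / 2"
    using assms by (subst diff_frac_eq) (auto simp: power2_eq_square add_nonneg_eq_0_iff)
  also have "(1 + norm x)\<^sup>2 - (1 - norm x)\<^sup>2 = 4 * norm x" by (simp add: power2_eq_square algebra_simps)
  also have "(1 - norm x) * (1 + norm x) = 1 - (norm x)\<^sup>2" by (simp add: power2_eq_square algebra_simps)
  also have "4 * norm x / (1 - (norm x)\<^sup>2) / 2 = conf_factor x * norm x"
  proof -
    have "4 * a / D / 2 = 2 / D * a" for a D :: real by (cases "D = 0") (auto simp: field_simps)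
    then show ?thesis by (simp only: conf_factor_def)
  qed
  finally show ?thesis .
qed

lemma tanh_hyp_dist_0:
  assumes "norm x < 1" shows "tanh (hyp_dist x 0 / 2) = norm x"
proof -
  have x: "x \<in> hyp_space" using assms by (simp add: hyp_space_def)
  define y where "y = (1 + norm x) / (1 - norm x)"
  have y: "y > 0" unfolding y_def using assms by (intro divide_pos_pos) (auto intro: add_pos_nonneg)
  have "hyp_dist x 0 / 2 = ln (sqrt y)" using y by (simp add: hyp_dist_0[OF x] y_def[symmetric] ln_sqrt)
  then have "tanh (hyp_dist x 0 / 2) = (y - 1) / (y + 1)" using y by (simp add: tanh_ln_real)
  also have "\<dots> = norm x" using assms y by (simp add: y_def field_simps)
  finally show ?thesis .
qed

lemma hyp_measurable [measurable]:
  "(\<lambda>x. hyp_dist x y) \<in> borel_measurable borel" "(sinh :: real \<Rightarrow> real) \<in> borel_measurable borel"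
  "(tanh :: real \<Rightarrow> real) \<in> borel_measurable borel" "X \<in> borel_measurable borel"
proof -
  show "(\<lambda>x. hyp_dist x y) \<in> borel_measurable borel" unfolding hyp_dist_def arcosh_def by measurable
  show "(sinh :: real \<Rightarrow> real) \<in> borel_measurable borel" "(tanh :: real \<Rightarrow> real) \<in> borel_measurable borel"
    by (auto intro!: borel_measurable_continuous_onI continuous_intros)
  show "X \<in> borel_measurable borel" unfolding X_def[abs_def] by measurable
qed

text \<open>The square is written as \<open>u x * G x * u x\<close> so that the product rule for
  \<open>C1c\<close> applies twice, with the possibly singular factor \<open>G\<close> in
  between.\<close>

lemma C1c_square_times:
  assumes u: "u \<in> C1c \<Omega>" and \<Omega>: "open \<Omega>" and G: "\<And>x. x \<in> \<Omega> \<Longrightarrow> (G has_derivative (\<lambda>h. G' x *\<^sub>R x \<bullet> h)) (at x)" "continuous_on \<Omega> G'"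
  shows "(\<lambda>x. u x * G x * u x) \<in> C1c \<Omega>"
    "\<And>x. x \<in> \<Omega> \<Longrightarrow> grad (\<lambda>x. u x * G x * u x) x = (2 * u x * G x) *\<^sub>R grad u x + ((u x)\<^sup>2 * G' x) *\<^sub>R x"
proof -
  have cG: "continuous_on \<Omega> (\<lambda>x. G' x *\<^sub>R x)" by (intro continuous_intros G)
  note 1 = C1c_mult[OF u \<Omega> G(1) cG]
  have du: "(u has_derivative (\<lambda>h. grad u x \<bullet> h)) (at x)" if "x \<in> \<Omega>" for x by (rule C1cD(1)[OF u])
  note 2 = C1c_mult[OF 1(1) \<Omega> du C1cD(2)[OF u]]
  show "(\<lambda>x. u x * G x * u x) \<in> C1c \<Omega>" by (rule 2(1))
  show "grad (\<lambda>x. u x * G x * u x) x = (2 * u x * G x) *\<^sub>R grad u x + ((u x)\<^sup>2 * G' x) *\<^sub>R x" if "x \<in> \<Omega>" for x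
  proof -
    have "grad (\<lambda>x. u x * G x * u x) x = (u x * G x) *\<^sub>R grad u x + u x *\<^sub>R grad (\<lambda>x. u x * G x) x"
      by (rule 2(2)) (use that in auto)
    moreover have "grad (\<lambda>x. u x * G x) x = u x *\<^sub>R (G' x *\<^sub>R x) + G x *\<^sub>R grad u x"
      by (rule 1(2)) (use that in auto)
    ultimately show ?thesis by (simp add: vec_eq_iff algebra_simps power2_eq_square)
  qed
qed

text \<open>The bracket is the radial logarithmic derivative of
  \<open>conf_factor x * norm x\<close>, divided by \<open>norm x\<close>. Both signs of
  \<open>m\<close> occur: positive in the ground state substitution, negative when it is undone for
  sharpness.\<close>

lemma conf_norm_powr_derivative:
  fixes x :: "real^'n::finite"
  shows "x \<in> ball 0 1 - {0} \<Longrightarrow> ((\<lambda>x. (conf_factor x * norm x) powr m) has_derivative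
      (\<lambda>h. (m * (conf_factor x * norm x) powr m * (conf_factor x + 1 / (norm x)\<^sup>2)) *\<^sub>R x \<bullet> h)) (at x)"
    "continuous_on (ball 0 1 - {0})
      (\<lambda>x::real^'n. (m * (conf_factor x * norm x) powr m * (conf_factor x + 1 / (norm x)\<^sup>2)) *\<^sub>R x)"
proof -
  assume "x \<in> ball 0 1 - {0}"
  then have l: "conf_factor x > 0" "x \<noteq> 0" "norm x > 0" "norm x < 1" using conf_factor_pos by auto
  have "((\<lambda>x. (conf_factor x * norm x)) has_derivative (\<lambda>h. (conf_factor x * (1 / norm x) + norm x * (conf_factor x)\<^sup>2) * (x \<bullet> h))) (at x)"
    by (rule has_derivative_mult_radial[OF conf_factor_has_derivative[OF l(4)] has_derivative_norm_inner[OF l(2)]])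
  from has_derivative_comp_radial[OF this has_real_derivative_powr, of m]
  have "((\<lambda>x. (conf_factor x * norm x) powr m) has_derivative (\<lambda>h. (m * (conf_factor x * norm x) powr (m - 1) * (conf_factor x * (1 / norm x) + norm x * (conf_factor x)\<^sup>2)) * (x \<bullet> h))) (at x)"
    using l by simp
  moreover have "m * (conf_factor x * norm x) powr (m - 1) * (conf_factor x * (1 / norm x) + norm x * (conf_factor x)\<^sup>2)
     = m * (conf_factor x * norm x) powr m * (conf_factor x + 1 / (norm x)\<^sup>2)"
  proof -
    have "(conf_factor x * norm x) powr (m - 1) = (conf_factor x * norm x) powr m / (conf_factor x * norm x)"
      using l by (subst powr_diff) auto
    then show ?thesis using l by (simp add: field_simps power2_eq_square)
  qed
  ultimately show "((\<lambda>x. (conf_factor x * norm x) powr m) has_derivative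
      (\<lambda>h. (m * (conf_factor x * norm x) powr m * (conf_factor x + 1 / (norm x)\<^sup>2)) *\<^sub>R x \<bullet> h)) (at x)"
    by (simp only: inner_scaleR_left)
next
  have c: "continuous_on (ball 0 1 - {0}) (conf_factor :: real^'n \<Rightarrow> real)"
    using continuous_on_conf_factor continuous_on_subset by blast
  have "conf_factor x * norm x \<noteq> 0" if "x \<in> ball 0 1 - {0}" for x :: "real^'n"
    using conf_factor_pos[of x] that by auto
  then show "continuous_on (ball 0 1 - {0})
      (\<lambda>x::real^'n. (m * (conf_factor x * norm x) powr m * (conf_factor x + 1 / (norm x)\<^sup>2)) *\<^sub>R x)"
    by (intro continuous_intros c) auto
qed

text \<open>Substitution of the ground state \<open>sinh \<rho> powr (-(n-2)/2)\<close>.\<close>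

lemma ground_state:
  fixes u :: "real^'n::finite \<Rightarrow> real"
  assumes u: "u \<in> C1c (ball 0 1 - {0})" and n: "n = real CARD('n)"
  defines "w \<equiv> \<lambda>x. u x * (conf_factor x * norm x) powr ((n - 2) / 2)"
  shows "w \<in> C1c (ball 0 1 - {0})" "hardy_energy 0 u = (LINT x|lborel. norm x powr (2 - n) * (norm (grad w x))\<^sup>2)"
    "weighted_term p \<alpha> 0 u = (LINT x|lborel. norm x powr (- n) * X (\<alpha> * norm x) powr ((p + 2) / 2) * \<bar>w x\<bar> powr p) powr (2 / p)"
proof -
  let ?\<Omega> = "ball 0 1 - {0} :: (real^'n) set"
  let ?cf = "conf_factor :: real^'n \<Rightarrow> real"
  define m where "m = (n - 2) / 2"
  have nm: "n = 2 * m + 2" by (simp add: m_def field_simps)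
  have op: "open ?\<Omega>" by auto
  have ccf: "continuous_on ?\<Omega> ?cf" using continuous_on_conf_factor continuous_on_subset by blast
  have lp: "?cf x > 0" "x \<noteq> 0" "norm x > 0" if "x \<in> ?\<Omega>" for x using that conf_factor_pos by auto
  define b where "b x = ?cf x + 1 / (norm x)\<^sup>2" for x
  define \<omega> where "\<omega> x = (?cf x * norm x) powr m" for x
  \<comment> \<open>Expanding the square of \<open>grad w x\<close> produces the mixed term
    \<open>2 * m * u x * b x\<close> times \<open>grad u x \<bullet> x\<close>. \<open>G\<close> is
    chosen so that the divergence of \<open>((u x)\<^sup>2 * G x) *\<^sub>R x\<close> has the same
    mixed term; \<open>G' x *\<^sub>R x\<close> is the gradient of \<open>G\<close>.\<close>
  define G where "G x = m * (?cf x powr (n - 2) * b x)" for x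
  define G' where "G' x = m * (?cf x powr (n - 2) * ((n - 2) * ?cf x * b x + ((?cf x)\<^sup>2 - 2 / (norm x) ^ 4)))" for x
  have cb: "continuous_on ?\<Omega> b" unfolding b_def by (intro continuous_intros ccf) auto
  have c\<omega>: "continuous_on ?\<Omega> \<omega>" unfolding \<omega>_def using lp by (intro continuous_intros ccf) force
  have dcf: "(?cf has_derivative (\<lambda>h. (?cf x)\<^sup>2 * (x \<bullet> h))) (at x)" if "x \<in> ?\<Omega>" for x
    using that by (intro conf_factor_has_derivative) auto
  have d\<omega>: "(\<omega> has_derivative (\<lambda>h. (m * \<omega> x * b x) *\<^sub>R x \<bullet> h)) (at x)" if x: "x \<in> ?\<Omega>" for x
    unfolding \<omega>_def b_def by (rule conf_norm_powr_derivative(1)[OF x])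
  have dG: "(G has_derivative (\<lambda>h. G' x *\<^sub>R x \<bullet> h)) (at x)" if x: "x \<in> ?\<Omega>" for x
  proof -
    note l = lp[OF x]
    have d1: "((\<lambda>x. ?cf x powr (n - 2)) has_derivative (\<lambda>h. ((n - 2) * ?cf x powr (n - 2 - 1) * (?cf x)\<^sup>2) * (x \<bullet> h))) (at x)"
      by (rule has_derivative_comp_radial[OF dcf[OF x] has_real_derivative_powr[OF l(1)]])
    have "((\<lambda>r. 1 / r\<^sup>2) has_real_derivative - 2 / norm x ^ 3) (at (norm x))"
      using l by (auto intro!: derivative_eq_intros simp: field_simps power2_eq_square power3_eq_cube)
    from has_derivative_add[OF dcf[OF x] has_derivative_comp_radial[OF has_derivative_norm_inner[OF l(2)] this]]
    have d2: "(b has_derivative (\<lambda>h. ((?cf x)\<^sup>2 - 2 / norm x ^ 4) * (x \<bullet> h))) (at x)"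
      unfolding b_def[abs_def] by (rule has_derivative_eq_rhs) (use l in \<open>auto simp: fun_eq_iff field_simps power3_eq_cube power4_eq_xxxx\<close>)
    from has_derivative_mult_right[OF has_derivative_mult_radial[OF d1 d2], of m]
    show ?thesis unfolding G_def[abs_def]
    proof (rule has_derivative_eq_rhs)
      have "?cf x powr (n - 2 - 1) * (?cf x)\<^sup>2 = ?cf x powr (n - 2) * ?cf x"
        using l by (simp add: powr_diff power2_eq_square power3_eq_cube)
      then have e: "(n - 2) * ?cf x powr (n - 2 - 1) * (?cf x)\<^sup>2 = (n - 2) * (?cf x powr (n - 2) * ?cf x)" by simp
      show "(\<lambda>h. m * ((?cf x powr (n - 2) * ((?cf x)\<^sup>2 - 2 / norm x ^ 4) + b x * ((n - 2) * ?cf x powr (n - 2 - 1) * (?cf x)\<^sup>2)) * (x \<bullet> h))) = (\<lambda>h. G' x *\<^sub>R x \<bullet> h)"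
        unfolding e G'_def by (auto simp: fun_eq_iff algebra_simps)
    qed
  qed
  have cG': "continuous_on ?\<Omega> G'" unfolding G'_def using lp by (intro continuous_intros ccf cb) force+
  have w: "w = (\<lambda>x. u x * \<omega> x)" by (simp add: w_def \<omega>_def m_def)
  have c\<omega>': "continuous_on ?\<Omega> (\<lambda>x. (m * \<omega> x * b x) *\<^sub>R x)" by (intro continuous_intros c\<omega> cb)
  note W = C1c_mult[OF u op d\<omega> c\<omega>']
  have W2: "grad w x = u x *\<^sub>R ((m * \<omega> x * b x) *\<^sub>R x) + \<omega> x *\<^sub>R grad u x" if "x \<in> ?\<Omega>" for x
    unfolding w by (rule W(2)) (use that in auto)
  show "w \<in> C1c ?\<Omega>" unfolding w by (rule W(1))
  obtain K where K: "compact K" "K \<subseteq> ?\<Omega>" "\<And>x. x \<notin> K \<Longrightarrow> u x = 0 \<and> grad u x = 0"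
    using C1c_support[OF u] by blast
  note U = C1cD[OF u]
  note [measurable] = U(4,5)
  define \<phi> where "\<phi> x = u x * G x * u x" for x
  have \<phi>: "\<phi> \<in> C1c ?\<Omega>" "x \<in> ?\<Omega> \<Longrightarrow> grad \<phi> x = (2 * u x * G x) *\<^sub>R grad u x + ((u x)\<^sup>2 * G' x) *\<^sub>R x" for x
    unfolding \<phi>_def by (rule C1c_square_times[OF u op dG cG'], assumption+)+
  note DIV = integral_div_radial_eq_0[OF \<phi>(1)]
  define E1 where "E1 x = ?cf x powr (n - 2) * (norm (grad u x))\<^sup>2" for x
  define E2 where "E2 x = ?cf x powr n * (u x)\<^sup>2" for x
  define E3 where "E3 x = (?cf x powr (n - 2) / (norm x)\<^sup>2) * (u x)\<^sup>2" for x
  have lpn: "?cf x powr n = ?cf x ^ CARD('n)" "?cf x powr (n - 2) = ?cf x ^ CARD('n) / (?cf x)\<^sup>2" if "x \<in> ball 0 1" for x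
    using conf_factor_pos[of x] that unfolding n by (auto simp: powr_diff powr_realpow)
  have I: "integrable lborel E1" "integrable lborel E2" "integrable lborel E3"
  proof -
    have cp: "continuous_on ?\<Omega> (\<lambda>x. ?cf x powr q)" for q
      using lp(1) by (intro continuous_on_powr ccf continuous_on_const) force
    have "continuous_on ?\<Omega> (\<lambda>x. ?cf x powr (n - 2) / (norm x)\<^sup>2)"
      by (intro continuous_intros cp) auto
    then show "integrable lborel E3" unfolding E3_def
      by (rule integrable_mult_support[OF op K(1,2)]) (use K(3) in \<open>auto intro!: continuous_intros U(3)\<close>)
    show "integrable lborel E1" "integrable lborel E2" unfolding E1_def E2_def
      by (rule integrable_mult_support[OF op K(1,2) cp]; use K(3) in \<open>auto intro!: continuous_intros U(2,3)\<close>)+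
  qed
  have z0: "u x = 0" "grad u x = 0" if "x \<notin> ?\<Omega>" for x using that K by blast+
  have e1: "(LINT x|hyp_volume. (hyp_norm x (hyp_grad u x))\<^sup>2) = (LINT x|lborel. E1 x)"
  proof -
    have m: "(\<lambda>x. (hyp_norm x (hyp_grad u x))\<^sup>2) \<in> borel_measurable borel"
      unfolding hyp_norm_def hyp_grad_def by measurable
    show ?thesis unfolding integral_hyp_volume[OF m]
    proof (intro Bochner_Integration.integral_cong refl)
      fix x
      show "indicator (ball 0 1) x * (?cf x ^ CARD('n) * (hyp_norm x (hyp_grad u x))\<^sup>2) = E1 x"
      proof (cases "x \<in> ?\<Omega>")
        case True
        then have "x \<in> ball 0 1" by simp
        then show ?thesis using lp[OF True] lpn(2)[of x]
          by (simp add: E1_def hyp_norm_def hyp_grad_def power_divide power_mult_distrib power2_eq_square field_simps)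
      next
        case False
        then show ?thesis using z0[OF False] by (simp add: E1_def hyp_norm_def hyp_grad_def)
      qed
    qed
  qed
  have e2: "(LINT x|hyp_volume. (u x)\<^sup>2) = (LINT x|lborel. E2 x)"
  proof -
    have m: "(\<lambda>x. (u x)\<^sup>2) \<in> borel_measurable borel" by measurable
    show ?thesis unfolding integral_hyp_volume[OF m]
    proof (intro Bochner_Integration.integral_cong refl)
      fix x
      show "indicator (ball 0 1) x * (?cf x ^ CARD('n) * (u x)\<^sup>2) = E2 x"
        using z0(1)[of x] lpn(1)[of x] by (cases "x \<in> ?\<Omega>") (auto simp: E2_def)
    qed
  qed
  have e3: "(LINT x|hyp_volume. (u x)\<^sup>2 / (sinh (hyp_dist x 0))\<^sup>2) = (LINT x|lborel. E3 x)"
  proof -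
    have m: "(\<lambda>x. (u x)\<^sup>2 / (sinh (hyp_dist x 0))\<^sup>2) \<in> borel_measurable borel" by measurable
    show ?thesis unfolding integral_hyp_volume[OF m]
    proof (intro Bochner_Integration.integral_cong refl)
      fix x
      show "indicator (ball 0 1) x * (?cf x ^ CARD('n) * ((u x)\<^sup>2 / (sinh (hyp_dist x 0))\<^sup>2)) = E3 x"
      proof (cases "x \<in> ?\<Omega>")
        case True
        then have "x \<in> ball 0 1" "norm x < 1" by auto
        then show ?thesis using lp[OF True] lpn(2)[of x]
          by (simp add: E3_def sinh_hyp_dist_0 power_mult_distrib field_simps)
      next
        case False
        then show ?thesis using z0[OF False] by (simp add: E3_def)
      qed
    qed
  qed
  \<comment> \<open>The substitution is exact pointwise: both sides agree up to the divergence of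
    \<open>\<phi> x *\<^sub>R x\<close>, whose integral is \<open>0\<close>.\<close>
  have key: "norm x powr (2 - n) * (norm (grad w x))\<^sup>2 =
     (E1 x - n * (n - 2) / 4 * E2 x - m\<^sup>2 * E3 x) + (grad \<phi> x \<bullet> x + n * \<phi> x)" for x
  proof (cases "x \<in> ?\<Omega>")
    case True
    note l = lp[OF True]
    define r where "r = norm x"
    define l' where "l' = ?cf x"
    define s where "s = grad u x \<bullet> x"
    have rl: "r > 0" "l' > 0" "r < 1" using l True by (auto simp: r_def l'_def)
    have "r\<^sup>2 < 1" using rl by (simp add: abs_square_less_1)
    then have "1 - r\<^sup>2 \<noteq> 0" by simp
    \<comment> \<open>The definition of the conformal factor enters the algebra below only through
      this relation.\<close>
    then have lr: "l' * (1 - r\<^sup>2) = 2"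
      unfolding l'_def conf_factor_def r_def[symmetric] by (rule nonzero_eq_divide_eq[THEN iffD1, OF _ refl])
    have gw: "grad w x = \<omega> x *\<^sub>R (grad u x + (m * u x * b x) *\<^sub>R x)"
      unfolding W2[OF True] by (simp add: algebra_simps)
    have "(norm (grad u x + (m * u x * b x) *\<^sub>R x))\<^sup>2 = (norm (grad u x))\<^sup>2 + 2 * m * u x * b x * s + (m * u x * b x)\<^sup>2 * r\<^sup>2"
      unfolding s_def r_def power2_norm_eq_inner by (simp add: inner_add_left inner_add_right inner_commute algebra_simps power2_eq_square)
    then have 1: "(norm (grad w x))\<^sup>2 = (\<omega> x)\<^sup>2 * ((norm (grad u x))\<^sup>2 + 2 * m * u x * b x * s + (m * u x * b x)\<^sup>2 * r\<^sup>2)"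
      unfolding gw by (simp add: power_mult_distrib)
    have "(\<omega> x)\<^sup>2 = (l' * r) powr (n - 2)"
      unfolding \<omega>_def l'_def[symmetric] r_def[symmetric] nm power2_eq_square by (subst powr_add[symmetric]) simp
    also have "\<dots> = l' powr (n - 2) * r powr (n - 2)" using rl by (simp add: powr_mult)
    finally have "r powr (2 - n) * (\<omega> x)\<^sup>2 = l' powr (n - 2) * (r powr (2 - n) * r powr (n - 2))" by simp
    also have "r powr (2 - n) * r powr (n - 2) = 1" using rl by (simp add: powr_add[symmetric])
    finally have 2: "r powr (2 - n) * (\<omega> x)\<^sup>2 = l' powr (n - 2)" by simp
    have 3: "norm x powr (2 - n) * (norm (grad w x))\<^sup>2 = l' powr (n - 2) * ((norm (grad u x))\<^sup>2 + 2 * m * u x * b x * s + (m * u x * b x)\<^sup>2 * r\<^sup>2)"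
      unfolding 1 r_def[symmetric] 2[symmetric] by simp
    have E2': "E2 x = l' powr (n - 2) * (l'\<^sup>2 * (u x)\<^sup>2)"
      using rl unfolding E2_def l'_def[symmetric] by (simp add: powr_diff)
    have bx: "b x = l' + 1 / r\<^sup>2" by (simp add: b_def l'_def r_def)
    have xx: "x \<bullet> x = r\<^sup>2" by (simp add: r_def power2_norm_eq_inner)
    have P: "grad \<phi> x \<bullet> x + n * \<phi> x = l' powr (n - 2) * (2 * u x * m * b x * s
       + (u x)\<^sup>2 * (m * ((n - 2) * l' * b x + (l'\<^sup>2 - 2 / r ^ 4)) * r\<^sup>2 + n * m * b x))"
      unfolding \<phi>(2)[OF True] \<phi>_def G_def G'_def l'_def[symmetric] r_def[symmetric] inner_add_left inner_scaleR_left s_def[symmetric] xx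
      by (simp add: algebra_simps power2_eq_square)
    \<comment> \<open>The zero-order coefficient that remains once the mixed terms have cancelled.
      That it is the sum of the two subtracted potentials is the origin of the constants
      \<open>n * (n - 2) / 4\<close> and \<open>m\<^sup>2\<close>.\<close>
    have alg: "m * ((n - 2) * l' * b x + (l'\<^sup>2 - 2 / r ^ 4)) * r\<^sup>2 + n * m * b x - (m * b x)\<^sup>2 * r\<^sup>2 = n * (n - 2) / 4 * l'\<^sup>2 + m\<^sup>2 / r\<^sup>2"
    proof -
      have r4: "r ^ 4 = r\<^sup>2 * r\<^sup>2" by (simp add: power4_eq_xxxx power2_eq_square)
      define q where "q = r\<^sup>2"
      have q: "q > 0" using rl by (simp add: q_def)
      have lq: "l' * q = l' - 2" using lr by (simp add: q_def algebra_simps)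
      have bq: "b x * q = l' - 1" unfolding bx q_def[symmetric] using q lq by (simp add: distrib_right)
      have "(m * ((n - 2) * l' * b x + (l'\<^sup>2 - 2 / (q * q))) * q + n * m * b x - (m * b x)\<^sup>2 * q) * q
          = (n * (n - 2) / 4 * l'\<^sup>2 + m\<^sup>2 / q) * q"
      proof -
        have "(m * ((n - 2) * l' * b x + (l'\<^sup>2 - 2 / (q * q))) * q + n * m * b x - (m * b x)\<^sup>2 * q) * q
           = m * ((2 * m) * (l' * q) * (b x * q) + ((l' * q)\<^sup>2 - 2)) + (2 * m + 2) * m * (b x * q) - m\<^sup>2 * (b x * q)\<^sup>2"
          unfolding nm using q by (simp add: field_simps power2_eq_square)
        also have "\<dots> = m * (m + 1) * l' * (l' - 2) + m\<^sup>2"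
          unfolding lq bq by (simp add: algebra_simps power2_eq_square)
        also have "\<dots> = (n * (n - 2) / 4 * l'\<^sup>2 + m\<^sup>2 / q) * q"
        proof -
          have "n * (n - 2) / 4 * l'\<^sup>2 * q = m * (m + 1) * l' * (l' * q)" unfolding nm by (simp add: field_simps power2_eq_square)
          then show ?thesis unfolding lq using q by (simp add: distrib_right)
        qed
        finally show ?thesis .
      qed
      then show ?thesis unfolding r4 q_def[symmetric] using q by simp
    qed
    have "(u x)\<^sup>2 * ((m * b x)\<^sup>2 * r\<^sup>2) = (u x)\<^sup>2 * (m * ((n - 2) * l' * b x + (l'\<^sup>2 - 2 / r ^ 4)) * r\<^sup>2 + n * m * b x) - (u x)\<^sup>2 * (n * (n - 2) / 4 * l'\<^sup>2 + m\<^sup>2 / r\<^sup>2)"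
      unfolding alg[symmetric] by (simp add: algebra_simps)
    then have "norm x powr (2 - n) * (norm (grad w x))\<^sup>2 = l' powr (n - 2) * ((norm (grad u x))\<^sup>2 + 2 * m * u x * b x * s +
      ((u x)\<^sup>2 * (m * ((n - 2) * l' * b x + (l'\<^sup>2 - 2 / r ^ 4)) * r\<^sup>2 + n * m * b x) - (u x)\<^sup>2 * (n * (n - 2) / 4 * l'\<^sup>2 + m\<^sup>2 / r\<^sup>2)))"
      unfolding 3 by (simp add: power_mult_distrib mult_ac)
    also have "\<dots> = (E1 x - n * (n - 2) / 4 * E2 x - m\<^sup>2 * E3 x) + (grad \<phi> x \<bullet> x + n * \<phi> x)"
      unfolding P E2' E1_def E3_def l'_def[symmetric] r_def[symmetric] by (simp add: distrib_left distrib_right right_diff_distrib left_diff_distrib mult_ac)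
    finally show ?thesis .
  next
    case False
    have "w x = 0" "grad w x = 0" "\<phi> x = 0" "grad \<phi> x = 0"
    proof -
      have wz: "w y = 0" "\<phi> y = 0" if "y \<notin> K" for y using K(3)[OF that] by (simp_all add: w \<phi>_def)
      have "x \<notin> K" using False K(2) by blast
      then show "w x = 0" "grad w x = 0" "\<phi> x = 0" "grad \<phi> x = 0"
        using grad_eq_0_outside(2)[OF compact_imp_closed[OF K(1)], of w x] grad_eq_0_outside(2)[OF compact_imp_closed[OF K(1)], of \<phi> x] wz by auto
    qed
    then show ?thesis using z0[OF False] by (simp add: E1_def E2_def E3_def)
  qed
  have "hardy_energy 0 u = (LINT x|lborel. E1 x - n * (n - 2) / 4 * E2 x - m\<^sup>2 * E3 x)"
    unfolding hardy_energy_def Let_def e1 e2 e3 using I by (simp add: n[symmetric] m_def)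
  also have "\<dots> = (LINT x|lborel. (E1 x - n * (n - 2) / 4 * E2 x - m\<^sup>2 * E3 x) + (grad \<phi> x \<bullet> x + n * \<phi> x))"
    using I DIV by (subst Bochner_Integration.integral_add) (auto simp: n)
  also have "\<dots> = (LINT x|lborel. norm x powr (2 - n) * (norm (grad w x))\<^sup>2)" unfolding key ..
  finally show "hardy_energy 0 u = (LINT x|lborel. norm x powr (2 - n) * (norm (grad w x))\<^sup>2)" .
  have mp: "(\<lambda>x. sinh (hyp_dist x 0) powr (p * (n - 2) / 2 - n) * X (\<alpha> * tanh (hyp_dist x 0 / 2)) powr ((p + 2) / 2) * \<bar>u x\<bar> powr p) \<in> borel_measurable borel"
    by measurable
  have "(LINT x|hyp_volume. sinh (hyp_dist x 0) powr (p * (n - 2) / 2 - n) * X (\<alpha> * tanh (hyp_dist x 0 / 2)) powr ((p + 2) / 2) * \<bar>u x\<bar> powr p)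
     = (LINT x|lborel. norm x powr (- n) * X (\<alpha> * norm x) powr ((p + 2) / 2) * \<bar>w x\<bar> powr p)"
    unfolding integral_hyp_volume[OF mp]
  proof (intro Bochner_Integration.integral_cong refl)
    fix x
    show "indicator (ball 0 1) x * (?cf x ^ CARD('n) * (sinh (hyp_dist x 0) powr (p * (n - 2) / 2 - n) * X (\<alpha> * tanh (hyp_dist x 0 / 2)) powr ((p + 2) / 2) * \<bar>u x\<bar> powr p))
       = norm x powr (- n) * X (\<alpha> * norm x) powr ((p + 2) / 2) * \<bar>w x\<bar> powr p"
    proof (cases "x \<in> ?\<Omega>")
      case True
      note l = lp[OF True]
      have x1: "norm x < 1" "x \<in> ball 0 1" using True by auto
      have "\<bar>w x\<bar> powr p = \<bar>u x\<bar> powr p * (?cf x * norm x) powr (p * (n - 2) / 2)"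
        unfolding w \<omega>_def m_def abs_mult using l by (simp add: powr_mult powr_powr mult.commute)
      moreover have "?cf x ^ CARD('n) * (?cf x * norm x) powr (p * (n - 2) / 2 - n) = norm x powr (- n) * (?cf x * norm x) powr (p * (n - 2) / 2)"
      proof -
        have "A powr n * (A * R) powr (q - n) = R powr (- n) * (A * R) powr q" if "A > 0" "R > 0" for A R q :: real
          using that by (simp add: powr_diff powr_minus powr_mult field_simps)
        from this[OF l(1,3)] show ?thesis unfolding lpn(1)[OF x1(2), symmetric] .
      qed
      ultimately show ?thesis
        unfolding sinh_hyp_dist_0[OF x1(1)] tanh_hyp_dist_0[OF x1(1)] using x1(2) by (simp add: mult_ac)
    qed (simp add: z0 w)
  qed
  then show "weighted_term p \<alpha> 0 u = (LINT x|lborel. norm x powr (- n) * X (\<alpha> * norm x) powr ((p + 2) / 2) * \<bar>w x\<bar> powr p) powr (2 / p)"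
    unfolding weighted_term_def Let_def n[symmetric] by simp
qed

subsection \<open>Logarithmic coordinates\<close>

text \<open>The radial change of variables \<open>r \<mapsto> X (\<alpha> r) powr (1/(n-2))\<close> turns the weighted energy of
  \<open>ground_state\<close> into the Dirichlet integral, up to the angular part, where \<open>X (\<alpha> r) \<le> n - 2\<close> is used.\<close>

locale log_coordinates =
  fixes n \<alpha> :: real and dim :: "'n::finite itself"
  assumes n_def: "n = real CARD('n)" and n3: "CARD('n) \<ge> 3" and \<alpha>: "0 < \<alpha>" "\<alpha> \<le> exp ((n - 3) / (n - 2))"
begin

definition s :: "real \<Rightarrow> real" where "s r = (1 - ln (\<alpha> * r)) powr (- 1 / (n - 2))"
text \<open>Inverse of \<open>s\<close>, found by solving
  \<open>\<sigma> powr (2 - n) = 1 - ln (\<alpha> * r)\<close> for \<open>r\<close>.\<close>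

definition t :: "real \<Rightarrow> real" where "t \<sigma> = exp (1 - \<sigma> powr (2 - n)) / \<alpha>"
abbreviation \<Omega> :: "(real^'n) set" where "\<Omega> \<equiv> ball 0 1 - {0}"
abbreviation \<Omega>' :: "(real^'n) set" where "\<Omega>' \<equiv> ball 0 (s 1) - {0}"
definition pull :: "(real^'n \<Rightarrow> real) \<Rightarrow> real^'n \<Rightarrow> real" where
  "pull z x = (if x \<in> \<Omega> then z (radial_map s x) else 0)"

lemma n_ge: "n \<ge> 3" "n - 2 > 0"
  using n3 by (simp_all add: n_def)

text \<open>The threshold for \<alpha> is the number with 1 - ln \<alpha> = 1 / (n - 2), and ln r is
  nonpositive on the unit interval. In terms of \<open>X\<close> the bound reads
  \<open>X (\<alpha> * r) \<le> n - 2\<close>.\<close>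

lemma ln_bound:
  assumes "0 < r" "r \<le> 1" shows "1 - ln (\<alpha> * r) \<ge> 1 / (n - 2)"
proof -
  have "ln \<alpha> \<le> (n - 3) / (n - 2)" using \<alpha> by (metis ln_exp ln_mono exp_gt_zero)
  moreover have "ln r \<le> 0" using assms by simp
  moreover have "ln (\<alpha> * r) = ln \<alpha> + ln r" using \<alpha>(1) assms(1) by (simp add: ln_mult)
  moreover have "1 / (n - 2) = 1 - (n - 3) / (n - 2)" using n_ge by (simp add: field_simps)
  ultimately show ?thesis by linarith
qed

lemma ln_pos: "0 < r \<Longrightarrow> r \<le> 1 \<Longrightarrow> 1 - ln (\<alpha> * r) > 0"
  using ln_bound[of r] n_ge by (smt (verit) divide_pos_pos)

lemma X_bounds:
  assumes "0 < r" "r \<le> 1" shows "0 < X (\<alpha> * r)" "X (\<alpha> * r) \<le> n - 2"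
proof -
  show "0 < X (\<alpha> * r)" using ln_pos[OF assms] by (simp add: X_def)
  show "X (\<alpha> * r) \<le> n - 2"
    using ln_bound[OF assms] ln_pos[OF assms] n_ge by (simp add: X_def field_simps)
qed

lemma s_pos: "0 < r \<Longrightarrow> r \<le> 1 \<Longrightarrow> s r > 0"
  using ln_pos[of r] by (simp add: s_def)

lemma s_powr: "0 < r \<Longrightarrow> r \<le> 1 \<Longrightarrow> s r powr (n - 2) = X (\<alpha> * r)" "0 < r \<Longrightarrow> r \<le> 1 \<Longrightarrow> s r powr (2 - n) = 1 - ln (\<alpha> * r)"
proof -
  assume r: "0 < r" "r \<le> 1"
  have e: "- 1 / (n - 2) * (n - 2) = -1" "- 1 / (n - 2) * (2 - n) = 1" using n_ge by (simp_all add: field_simps)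
  show "s r powr (n - 2) = X (\<alpha> * r)" "s r powr (2 - n) = 1 - ln (\<alpha> * r)"
    unfolding s_def powr_powr e using ln_pos[OF r] by (simp_all add: X_def powr_minus divide_inverse)
qed

lemma s_mono: "0 < r \<Longrightarrow> r < 1 \<Longrightarrow> s r < s 1"
proof -
  assume r: "0 < r" "r < 1"
  have "1 - ln (\<alpha> * 1) < 1 - ln (\<alpha> * r)" using \<alpha>(1) r by simp
  then show "s r < s 1" unfolding s_def using ln_pos[of 1] n_ge
    by (intro powr_less_mono2_neg) (auto simp: field_simps)
qed

lemma t_s: "0 < r \<Longrightarrow> r \<le> 1 \<Longrightarrow> t (s r) = r"
  unfolding t_def by (simp add: s_powr) (use \<alpha>(1) in simp)

lemma t_bounds:
  assumes "0 < \<sigma>" "\<sigma> < s 1" shows "0 < t \<sigma>" "t \<sigma> < 1" "s (t \<sigma>) = \<sigma>"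
proof -
  show "0 < t \<sigma>" using \<alpha>(1) by (simp add: t_def)
  have "1 - ln \<alpha> = s 1 powr (2 - n)" using s_powr(2)[of 1] by simp
  also have "\<dots> < \<sigma> powr (2 - n)" using assms n_ge by (intro powr_less_mono2_neg) auto
  finally have "exp (1 - \<sigma> powr (2 - n)) < exp (ln \<alpha>)" by simp
  then show "t \<sigma> < 1" using \<alpha>(1) by (simp add: t_def)
  have "ln (\<alpha> * t \<sigma>) = 1 - \<sigma> powr (2 - n)" using \<alpha>(1) by (simp add: t_def)
  then have "s (t \<sigma>) = \<sigma> powr ((2 - n) * (- 1 / (n - 2)))" unfolding s_def by (simp add: powr_powr)
  also have "(2 - n) * (- 1 / (n - 2)) = 1" using n_ge by (simp add: field_simps)
  finally show "s (t \<sigma>) = \<sigma>" using assms by simp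
qed

text \<open>The slope is \<open>s r / r\<close> times \<open>X (\<alpha> * r) / (n - 2)\<close>:
  relative to the tangential stretching, the radial one carries a factor that is at most 1 by
  \<open>X_bounds\<close>.\<close>

lemma s_derivative:
  assumes "0 < r" "r < 1"
  shows "(s has_real_derivative s r * X (\<alpha> * r) / ((n - 2) * r)) (at r)"
proof -
  have l: "1 - ln (\<alpha> * r) > 0" using ln_pos[of r] assms by simp
  have "(s has_real_derivative (- 1 / (n - 2)) * (1 - ln (\<alpha> * r)) powr (- 1 / (n - 2) - 1) * (- (1 / r))) (at r)"
    unfolding s_def[abs_def] using l \<alpha>(1) assms by (auto intro!: derivative_eq_intros)
  moreover have "(1 - ln (\<alpha> * r)) powr (- 1 / (n - 2) - 1) = s r * X (\<alpha> * r)"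
    using l by (simp add: powr_diff s_def X_def)
  moreover have "(- 1 / (n - 2)) * (s r * X (\<alpha> * r)) * (- (1 / r)) = s r * X (\<alpha> * r) / ((n - 2) * r)"
    by simp
  ultimately show ?thesis by simp
qed

lemma t_derivative:
  assumes "0 < \<sigma>"
  shows "(t has_real_derivative (n - 2) * \<sigma> powr (1 - n) * t \<sigma>) (at \<sigma>)"
proof -
  have "(t has_real_derivative exp (1 - \<sigma> powr (2 - n)) * (- ((2 - n) * \<sigma> powr (2 - n - 1))) / \<alpha>) (at \<sigma>)"
    unfolding t_def[abs_def] using assms \<alpha>(1) by (auto intro!: derivative_eq_intros)
  moreover have "2 - n - 1 = 1 - n" by simp
  moreover have "exp (1 - \<sigma> powr (2 - n)) * (- ((2 - n) * q)) / \<alpha> = (n - 2) * q * t \<sigma>" for q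
    by (simp add: t_def field_simps)
  ultimately show ?thesis by simp
qed

lemma radial_maps:
  "x \<in> \<Omega> \<Longrightarrow> radial_map s x \<in> \<Omega>' \<and> radial_map t (radial_map s x) = x"
  "y \<in> \<Omega>' \<Longrightarrow> radial_map t y \<in> \<Omega> \<and> radial_map s (radial_map t y) = y"
proof -
  assume x: "x \<in> \<Omega>"
  then have r: "x \<noteq> 0" "0 < norm x" "norm x < 1" by auto
  have n: "norm (radial_map s x) = s (norm x)" using s_pos[of "norm x"] r by (intro norm_radial_map) auto
  then have "radial_map s x \<noteq> 0" using s_pos[of "norm x"] r by (metis less_eq_real_def less_irrefl norm_zero)
  then show "radial_map s x \<in> \<Omega>' \<and> radial_map t (radial_map s x) = x"
    using n s_mono[of "norm x"] s_pos[of "norm x"] t_s[of "norm x"] r radial_map_inverse[of x s t] by simp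
next
  assume y: "y \<in> \<Omega>'"
  then have r: "y \<noteq> 0" "0 < norm y" "norm y < s 1" by auto
  note T = t_bounds[OF r(2,3)]
  have n: "norm (radial_map t y) = t (norm y)" using T r by (intro norm_radial_map) auto
  then have "radial_map t y \<noteq> 0" using T by (metis less_irrefl norm_zero)
  then show "radial_map t y \<in> \<Omega> \<and> radial_map s (radial_map t y) = y"
    using n T r radial_map_inverse[of y t s] by simp
qed

abbreviation cs :: "real^'n \<Rightarrow> real" where "cs x \<equiv> s (norm x) / norm x"
abbreviation ds :: "real^'n \<Rightarrow> real" where
  "ds x \<equiv> (s (norm x) * X (\<alpha> * norm x) / ((n - 2) * norm x) - s (norm x) / norm x) / (norm x)\<^sup>2"

lemma s_map_derivative:
  "x \<in> \<Omega> \<Longrightarrow> (radial_map s has_derivative (\<lambda>h. cs x *\<^sub>R h + (ds x * (x \<bullet> h)) *\<^sub>R x)) (at x)"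
  by (rule has_derivative_radial_map) (auto intro!: s_derivative)

lemma t_map_derivative:
  "y \<in> \<Omega>' \<Longrightarrow> (radial_map t has_derivative (\<lambda>h. (t (norm y) / norm y) *\<^sub>R h +
     (((n - 2) * norm y powr (1 - n) * t (norm y) - t (norm y) / norm y) / (norm y)\<^sup>2 * (y \<bullet> h)) *\<^sub>R y)) (at y)"
  by (rule has_derivative_radial_map) (auto intro!: t_derivative)

lemma continuous_s: "continuous_on {0<..<1} s"
  by (rule DERIV_continuous_on) (rule has_field_derivative_at_within[OF s_derivative], auto)

lemma continuous_t: "continuous_on {0<..} t"
  by (rule DERIV_continuous_on) (rule has_field_derivative_at_within[OF t_derivative], auto)

lemma continuous_coeffs:
  "continuous_on \<Omega> cs" "continuous_on \<Omega> ds" "continuous_on \<Omega> (radial_map s)" "continuous_on \<Omega>' (radial_map t)"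
proof -
  have cs: "continuous_on \<Omega> (\<lambda>x. s (norm x))"
    by (rule continuous_on_compose2[OF continuous_s]) (auto intro!: continuous_intros)
  have "continuous_on \<Omega> (\<lambda>x. X (\<alpha> * norm x))"
  proof -
    have "\<alpha> * norm x \<noteq> 0 \<and> 1 - ln (\<alpha> * norm x) \<noteq> 0" if "x \<in> \<Omega>" for x :: "real^'n"
      using ln_pos[of "norm x"] \<alpha>(1) that by auto
    then show ?thesis unfolding X_def by (intro continuous_intros) auto
  qed
  then show "continuous_on \<Omega> cs" "continuous_on \<Omega> ds"
    using n_ge by (auto intro!: continuous_intros cs)
  show "continuous_on \<Omega> (radial_map s)"
    by (rule has_derivative_continuous_on) (rule has_derivative_at_withinI[OF s_map_derivative])
  show "continuous_on \<Omega>' (radial_map t)"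
    by (rule has_derivative_continuous_on) (rule has_derivative_at_withinI[OF t_map_derivative])
qed

lemma pull_C1c:
  assumes z: "z \<in> C1c \<Omega>'"
  shows "pull z \<in> C1c \<Omega>"
    "\<And>x. x \<in> \<Omega> \<Longrightarrow> grad (pull z) x = cs x *\<^sub>R grad z (radial_map s x) + (ds x * (x \<bullet> grad z (radial_map s x))) *\<^sub>R x"
proof -
  have op: "open \<Omega>" by auto
  have e: "pull z = (\<lambda>x. if x \<in> \<Omega> then z (radial_map s x) else 0)" by (rule ext) (rule pull_def)
  note C = C1c_compose[OF z op s_map_derivative continuous_coeffs(1,2) continuous_on_id continuous_coeffs(4) radial_maps, folded e]
  show "pull z \<in> C1c \<Omega>" by (rule C)
  show "grad (pull z) x = cs x *\<^sub>R grad z (radial_map s x) + (ds x * (x \<bullet> grad z (radial_map s x))) *\<^sub>R x" if "x \<in> \<Omega>" for x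
    by (rule C) (use that in auto)
qed

text \<open>The inequality starts from an arbitrary function on the punctured ball, which has to be
  recognised as a pullback before the Euclidean inequality can be applied.\<close>

lemma pull_surj:
  assumes w: "w \<in> C1c \<Omega>"
  obtains z where "z \<in> C1c \<Omega>'" "w = pull z"
proof
  let ?z = "\<lambda>y. if y \<in> \<Omega>' then w (radial_map t y) else 0"
  have op: "open \<Omega>'" by auto
  have ct: "continuous_on \<Omega>' (\<lambda>y. t (norm y))"
    by (rule continuous_on_compose2[OF continuous_t]) (auto intro!: continuous_intros)
  have c1: "continuous_on \<Omega>' (\<lambda>y. t (norm y) / norm y)"
    "continuous_on \<Omega>' (\<lambda>y. ((n - 2) * norm y powr (1 - n) * t (norm y) - t (norm y) / norm y) / (norm y)\<^sup>2)"
    by (auto intro!: continuous_intros ct)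
  show "?z \<in> C1c \<Omega>'"
    by (rule C1c_compose(1)[OF w op t_map_derivative c1 continuous_on_id continuous_coeffs(3) radial_maps(2) radial_maps(1)])
  have w0: "w x = 0" if "x \<notin> \<Omega>" for x using C1c_support[OF w] that by blast
  show "w = pull ?z"
  proof
    fix x show "w x = pull ?z x"
      using radial_maps(1)[of x] w0[of x] by (cases "x \<in> \<Omega>") (simp_all add: pull_def)
  qed
qed

text \<open>The Jacobian is \<open>s r / r\<close> to the power n - 1 times the slope of
  \<open>s\<close>. Using \<open>s r powr (n - 2) = X (\<alpha> * r)\<close>, all but two of the
  powers of \<open>s r\<close> become a second factor \<open>X\<close>.\<close>

lemma change_of_variables_s:
  assumes [measurable]: "f \<in> borel_measurable borel" and z: "\<And>y. y \<notin> \<Omega>' \<Longrightarrow> f y = 0"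
  shows "(LINT y|lborel. f y) = (LINT x|lborel. indicator \<Omega> x *
     ((s (norm x))\<^sup>2 * (X (\<alpha> * norm x))\<^sup>2 * norm x powr (- n) / (n - 2) * f (radial_map s x)))"
proof -
  have im: "radial_map s ` \<Omega> = \<Omega>'"
  proof (intro equalityI subsetI)
    fix y assume "y \<in> \<Omega>'"
    then show "y \<in> radial_map s ` \<Omega>" using radial_maps(2) by (metis imageI)
  qed (use radial_maps(1) in auto)
  have inj: "inj_on (radial_map s) \<Omega>" by (rule inj_on_inverseI[of _ "radial_map t"]) (use radial_maps(1) in auto)
  have op: "open \<Omega>" "open (radial_map s ` \<Omega>)" unfolding im by auto
  have "(LINT y|lborel. f y) = (LINT y|lborel. indicator (radial_map s ` \<Omega>) y * f y)"
    unfolding im using z by (intro Bochner_Integration.integral_cong) (auto simp: indicator_def)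
  also have "\<dots> = (LINT x|lborel. indicator \<Omega> x * (\<bar>cs x ^ (CARD('n) - 1) * (cs x + ds x * (x \<bullet> x))\<bar> * f (radial_map s x)))"
    by (rule integral_change_of_variables_open[OF op s_map_derivative inj continuous_coeffs(1,2) continuous_on_id assms(1)])
  also have "\<dots> = (LINT x|lborel. indicator \<Omega> x * ((s (norm x))\<^sup>2 * (X (\<alpha> * norm x))\<^sup>2 * norm x powr (- n) / (n - 2) * f (radial_map s x)))"
  proof (intro Bochner_Integration.integral_cong refl)
    fix x :: "real^'n"
    show "indicator \<Omega> x * (\<bar>cs x ^ (CARD('n) - 1) * (cs x + ds x * (x \<bullet> x))\<bar> * f (radial_map s x)) =
      indicator \<Omega> x * ((s (norm x))\<^sup>2 * (X (\<alpha> * norm x))\<^sup>2 * norm x powr (- n) / (n - 2) * f (radial_map s x))"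
    proof (cases "x \<in> \<Omega>")
      case True
      define r where "r = norm x"
      have r: "0 < r" "r < 1" using True by (auto simp: r_def)
      define S where "S = s r"
      define Y where "Y = X (\<alpha> * r)"
      have S: "S > 0" and Y: "Y > 0" "S powr (n - 2) = Y"
        using s_pos[of r] X_bounds[of r] s_powr(1)[of r] r by (simp_all add: S_def Y_def)
      have "cs x + ds x * (x \<bullet> x) = S * Y / ((n - 2) * r)"
        unfolding r_def[symmetric] S_def[symmetric] Y_def[symmetric] using r by (simp add: dot_square_norm r_def[symmetric])
      moreover have "cs x ^ (CARD('n) - 1) * (S * Y / ((n - 2) * r)) = S\<^sup>2 * Y\<^sup>2 * r powr (- n) / (n - 2)"
      proof -
        have "(S / r) ^ (CARD('n) - 1) * (S / r) = (S / r) ^ CARD('n)"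
          using n3 by (metis One_nat_def Suc_pred mult.commute power_Suc zero_less_card_finite)
        also have "\<dots> = S powr n * r powr (- n)"
        proof -
          have "(S / r) ^ CARD('n) = (S / r) powr n" using S r by (simp add: n_def powr_realpow)
          also have "\<dots> = S powr n / r powr n" by (rule powr_divide)
          finally show ?thesis by (simp add: powr_minus divide_inverse)
        qed
        also have "S powr n = Y * S\<^sup>2"
        proof -
          have "S powr n = S powr (n - 2) * S powr 2" by (simp add: powr_add[symmetric])
          then show ?thesis using S Y by simp
        qed
        finally have "(S / r) ^ (CARD('n) - 1) * (S / r) * (Y / (n - 2)) = Y * S\<^sup>2 * r powr (- n) * (Y / (n - 2))" by simp
        then show ?thesis unfolding r_def[symmetric] S_def[symmetric] by (simp add: power2_eq_square mult_ac)
      qed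
      moreover have "S\<^sup>2 * Y\<^sup>2 * r powr (- n) / (n - 2) \<ge> 0" using n_ge by simp
      ultimately show ?thesis unfolding r_def[symmetric] S_def[symmetric] Y_def[symmetric] using n_ge by simp
    qed simp
  qed
  finally show ?thesis .
qed

text \<open>Put k = X / (n - 2). In the gradient of the pullback only the radial part carries k^2,
  whereas the Jacobian puts k^2 on both the radial and the angular part of the Dirichlet integral.
  The difference is 1 - k^2 times the angular part, which is nonnegative because k is at most 1 and
  vanishes for radial functions.\<close>

lemma
  assumes z: "z \<in> C1c \<Omega>'"
  shows energy_pull_ge: "(LINT x|lborel. norm x powr (2 - n) * (norm (grad (pull z) x))\<^sup>2) \<ge> dirichlet z / (n - 2)"
    and energy_pull_radial: "(\<And>x y. norm x = norm y \<Longrightarrow> z x = z y) \<Longrightarrow>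
       (LINT x|lborel. norm x powr (2 - n) * (norm (grad (pull z) x))\<^sup>2) = dirichlet z / (n - 2)"
    and mass_pull: "p > 0 \<Longrightarrow> (LINT x|lborel. norm x powr (- n) * X (\<alpha> * norm x) powr ((p + 2) / 2) * \<bar>pull z x\<bar> powr p) =
       (n - 2) * weighted_mass (p * (n - 2) / 2 - n) p z"
proof -
  note P = pull_C1c[OF z]
  obtain K where K: "compact K" "K \<subseteq> \<Omega>'" "\<And>x. x \<notin> K \<Longrightarrow> z x = 0 \<and> grad z x = 0"
    using C1c_support[OF z] by blast
  have z0: "z y = 0" "grad z y = 0" if "y \<notin> \<Omega>'" for y using K(2,3) that by blast+
  obtain K' where K': "compact K'" "K' \<subseteq> \<Omega>" "\<And>x. x \<notin> K' \<Longrightarrow> pull z x = 0 \<and> grad (pull z) x = 0"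
    using C1c_support[OF P(1)] by blast
  note [measurable] = C1cD(4,5)[OF z] C1cD(4,5)[OF P(1)]
  define g where "g x = grad z (radial_map s x)" for x
  define J where "J x = (s (norm x))\<^sup>2 * norm x powr (- n)" for x :: "real^'n"
  have D: "dirichlet z / (n - 2) = (LINT x|lborel. indicator \<Omega> x * (J x * (X (\<alpha> * norm x) / (n - 2))\<^sup>2 * (norm (g x))\<^sup>2))"
  proof -
    have "dirichlet z = (LINT x|lborel. indicator \<Omega> x * ((s (norm x))\<^sup>2 * (X (\<alpha> * norm x))\<^sup>2 * norm x powr (- n) / (n - 2) * (norm (grad z (radial_map s x)))\<^sup>2))"
      unfolding dirichlet_def by (rule change_of_variables_s) (measurable, simp add: z0)
    then have "dirichlet z / (n - 2) = (LINT x|lborel. indicator \<Omega> x * ((s (norm x))\<^sup>2 * (X (\<alpha> * norm x))\<^sup>2 * norm x powr (- n) / (n - 2) * (norm (grad z (radial_map s x)))\<^sup>2) / (n - 2))"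
      by simp
    then show ?thesis unfolding g_def J_def by (simp add: power_divide power2_eq_square mult_ac)
  qed
  have pt: "norm x powr (2 - n) * (norm (grad (pull z) x))\<^sup>2 =
      J x * (((norm (g x))\<^sup>2 - ((x \<bullet> g x) / norm x)\<^sup>2) + (X (\<alpha> * norm x) / (n - 2))\<^sup>2 * ((x \<bullet> g x) / norm x)\<^sup>2)" if x: "x \<in> \<Omega>" for x
  proof -
    define r where "r = norm x"
    have r: "0 < r" "r < 1" using x by (auto simp: r_def)
    define q where "q = x \<bullet> g x"
    define k where "k = X (\<alpha> * r) / (n - 2)"
    define S where "S = s r"
    have xx: "x \<bullet> x = r\<^sup>2" by (simp add: r_def power2_norm_eq_inner)
    have d: "ds x = (S * k / r - S / r) / r\<^sup>2" by (simp add: r_def[symmetric] k_def S_def)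
    have "(norm (grad (pull z) x))\<^sup>2 = (cs x)\<^sup>2 * (norm (g x))\<^sup>2 + 2 * cs x * ds x * q\<^sup>2 + (ds x)\<^sup>2 * q\<^sup>2 * r\<^sup>2"
    proof -
      have "(norm (c *\<^sub>R y + (e * (x \<bullet> y)) *\<^sub>R x))\<^sup>2 = c\<^sup>2 * (norm y)\<^sup>2 + 2 * c * e * (x \<bullet> y)\<^sup>2 + e\<^sup>2 * (x \<bullet> y)\<^sup>2 * (x \<bullet> x)"
        for c e and y :: "real^'n"
        unfolding power2_norm_eq_inner
        by (simp add: inner_add_left inner_add_right inner_commute power2_eq_square algebra_simps)
      then show ?thesis unfolding P(2)[OF x] g_def[symmetric] q_def xx[symmetric] by blast
    qed
    also have "\<dots> = (S / r)\<^sup>2 * (((norm (g x))\<^sup>2 - (q / r)\<^sup>2) + k\<^sup>2 * (q / r)\<^sup>2)"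
      unfolding d unfolding r_def[symmetric] unfolding S_def[symmetric] using r by (simp add: field_simps power2_eq_square)
    finally have 1: "(norm (grad (pull z) x))\<^sup>2 = (S / r)\<^sup>2 * (((norm (g x))\<^sup>2 - (q / r)\<^sup>2) + k\<^sup>2 * (q / r)\<^sup>2)" .
    have 2: "r powr (2 - n) * (S / r)\<^sup>2 = S\<^sup>2 * r powr (- n)"
    proof -
      have "r powr (2 - n) = r powr 2 * r powr (- n)" by (simp add: powr_add[symmetric])
      then show ?thesis using r by (simp add: power_divide)
    qed
    show ?thesis unfolding 1 J_def q_def[symmetric] r_def[symmetric] k_def[symmetric] S_def[symmetric]
      by (simp add: mult.assoc[symmetric] 2)
  qed
  have out: "norm x powr (2 - n) * (norm (grad (pull z) x))\<^sup>2 = 0" if "x \<notin> \<Omega>" for x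
  proof -
    have "grad (pull z) x = 0" using K'(2,3) that by blast
    then show ?thesis by simp
  qed
  have CS: "((x \<bullet> g x) / norm x)\<^sup>2 \<le> (norm (g x))\<^sup>2" if "x \<in> \<Omega>" for x
  proof -
    have "\<bar>(x \<bullet> g x) / norm x\<bar> \<le> norm (g x)"
      using that Cauchy_Schwarz_ineq2[of x "g x"] by (simp add: field_simps)
    then show ?thesis by (metis abs_le_square_iff abs_norm_cancel)
  qed
  have k1: "(X (\<alpha> * norm x) / (n - 2))\<^sup>2 \<le> 1" if "x \<in> \<Omega>" for x :: "real^'n"
    using X_bounds[of "norm x"] that n_ge by (intro power_le_one) (auto simp: field_simps)
  have J0: "J x \<ge> 0" for x by (simp add: J_def)
  have le: "indicator \<Omega> x * (J x * (X (\<alpha> * norm x) / (n - 2))\<^sup>2 * (norm (g x))\<^sup>2) \<le> norm x powr (2 - n) * (norm (grad (pull z) x))\<^sup>2" for x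
  proof (cases "x \<in> \<Omega>")
    case True
    have "(1 - (X (\<alpha> * norm x) / (n - 2))\<^sup>2) * ((norm (g x))\<^sup>2 - ((x \<bullet> g x) / norm x)\<^sup>2) \<ge> 0"
      using CS[OF True] k1[OF True] by (intro mult_nonneg_nonneg) auto
    then have "(X (\<alpha> * norm x) / (n - 2))\<^sup>2 * (norm (g x))\<^sup>2 \<le> ((norm (g x))\<^sup>2 - ((x \<bullet> g x) / norm x)\<^sup>2) + (X (\<alpha> * norm x) / (n - 2))\<^sup>2 * ((x \<bullet> g x) / norm x)\<^sup>2"
      by (simp add: algebra_simps)
    from mult_left_mono[OF this J0[of x]] show ?thesis unfolding pt[OF True] using True by (simp add: mult.assoc)
  qed (use out in simp)
  have int: "integrable lborel (\<lambda>x. norm x powr (2 - n) * (norm (grad (pull z) x))\<^sup>2)"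
  proof (rule integrable_mult_support[OF _ K'(1,2)])
    show "continuous_on \<Omega> (\<lambda>x. norm x powr (2 - n))" by (intro continuous_intros) auto
  qed (use K'(3) C1cD(2)[OF P(1)] in \<open>auto intro!: continuous_intros\<close>)
  show "dirichlet z / (n - 2) \<le> (LINT x|lborel. norm x powr (2 - n) * (norm (grad (pull z) x))\<^sup>2)"
    unfolding D
  proof (rule integral_mono'[OF int le])
    show "0 \<le> norm x powr (2 - n) * (norm (grad (pull z) x))\<^sup>2" for x by simp
  qed
  show "(LINT x|lborel. norm x powr (2 - n) * (norm (grad (pull z) x))\<^sup>2) = dirichlet z / (n - 2)"
    if rad: "\<And>x y. norm x = norm y \<Longrightarrow> z x = z y"
    unfolding D
  proof (intro Bochner_Integration.integral_cong refl)
    fix x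
    show "norm x powr (2 - n) * (norm (grad (pull z) x))\<^sup>2 = indicator \<Omega> x * (J x * (X (\<alpha> * norm x) / (n - 2))\<^sup>2 * (norm (g x))\<^sup>2)"
    proof (cases "x \<in> \<Omega>")
      case True
      have nz: "radial_map s x \<noteq> 0" using radial_maps(1)[OF True] by auto
      have "(radial_map s x \<bullet> g x)\<^sup>2 = (norm (radial_map s x))\<^sup>2 * (norm (g x))\<^sup>2"
        unfolding g_def by (rule radial_gradient[OF C1cD(1)[OF z] rad nz])
      then have "(cs x)\<^sup>2 * (x \<bullet> g x)\<^sup>2 = (cs x)\<^sup>2 * ((norm x)\<^sup>2 * (norm (g x))\<^sup>2)"
        by (simp add: radial_map_def power_mult_distrib power_divide)
      moreover have "(cs x)\<^sup>2 \<noteq> 0" using s_pos[of "norm x"] True by auto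
      ultimately have "(x \<bullet> g x)\<^sup>2 = (norm x)\<^sup>2 * (norm (g x))\<^sup>2" by (metis mult_left_cancel)
      then have "((x \<bullet> g x) / norm x)\<^sup>2 = (norm (g x))\<^sup>2" using True by (simp add: power_divide)
      then show ?thesis unfolding pt[OF True] using True by simp
    qed (use out in simp)
  qed
  assume p: "p > 0"
  have "weighted_mass (p * (n - 2) / 2 - n) p z = (LINT x|lborel. indicator \<Omega> x * ((s (norm x))\<^sup>2 * (X (\<alpha> * norm x))\<^sup>2 * norm x powr (- n) / (n - 2) *
      (norm (radial_map s x) powr (p * (n - 2) / 2 - n) * \<bar>z (radial_map s x)\<bar> powr p)))"
    unfolding weighted_mass_def by (rule change_of_variables_s) (measurable, simp add: z0)
  then have "(n - 2) * weighted_mass (p * (n - 2) / 2 - n) p z = (LINT x|lborel. (n - 2) * (indicator \<Omega> x * ((s (norm x))\<^sup>2 * (X (\<alpha> * norm x))\<^sup>2 * norm x powr (- n) / (n - 2) *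
      (norm (radial_map s x) powr (p * (n - 2) / 2 - n) * \<bar>z (radial_map s x)\<bar> powr p))))"
    by (simp only: Bochner_Integration.integral_mult_right_zero)
  also have "\<dots> = (LINT x|lborel. norm x powr (- n) * X (\<alpha> * norm x) powr ((p + 2) / 2) * \<bar>pull z x\<bar> powr p)"
  proof (intro Bochner_Integration.integral_cong refl)
    fix x
    show "(n - 2) * (indicator \<Omega> x * ((s (norm x))\<^sup>2 * (X (\<alpha> * norm x))\<^sup>2 * norm x powr (- n) / (n - 2) *
      (norm (radial_map s x) powr (p * (n - 2) / 2 - n) * \<bar>z (radial_map s x)\<bar> powr p))) =
      norm x powr (- n) * X (\<alpha> * norm x) powr ((p + 2) / 2) * \<bar>pull z x\<bar> powr p"
    proof (cases "x \<in> \<Omega>")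
      case True
      define r where "r = norm x"
      have r: "0 < r" "r < 1" using True by (auto simp: r_def)
      define S where "S = s r"
      define Y where "Y = X (\<alpha> * r)"
      have S: "S > 0" and Y: "Y > 0" "S powr (n - 2) = Y"
        using s_pos[of r] X_bounds[of r] s_powr(1)[of r] r by (simp_all add: S_def Y_def)
      have nS: "norm (radial_map s x) = S"
        using norm_radial_map[of x s] S True by (simp add: S_def r_def)
      \<comment> \<open>Origin of the exponent (p + 2) / 2: two powers of \<open>X\<close> come from
        the Jacobian and p / 2 - 1 from the remaining powers of \<open>s r\<close>.\<close>
      have "S\<^sup>2 * Y\<^sup>2 * S powr (p * (n - 2) / 2 - n) = Y\<^sup>2 * (S powr 2 * S powr (p * (n - 2) / 2 - n))"
        using S by simp
      also have "S powr 2 * S powr (p * (n - 2) / 2 - n) = S powr ((n - 2) * (p / 2 - 1))"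
        unfolding powr_add[symmetric] by (rule arg_cong[where f = "(powr) S"]) (simp add: field_simps)
      also have "\<dots> = Y powr (p / 2 - 1)" unfolding powr_powr[symmetric] Y(2) ..
      also have "Y\<^sup>2 * Y powr (p / 2 - 1) = Y powr 2 * Y powr (p / 2 - 1)" using Y by simp
      also have "\<dots> = Y powr ((p + 2) / 2)"
        unfolding powr_add[symmetric] by (rule arg_cong[where f = "(powr) Y"]) (simp add: field_simps)
      finally have e: "S\<^sup>2 * Y\<^sup>2 * S powr (p * (n - 2) / 2 - n) = Y powr ((p + 2) / 2)" .
      have "(n - 2) * (S\<^sup>2 * Y\<^sup>2 * r powr (- n) / (n - 2) * (S powr (p * (n - 2) / 2 - n) * Z)) = r powr (- n) * (S\<^sup>2 * Y\<^sup>2 * S powr (p * (n - 2) / 2 - n)) * Z" for Z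
        using n_ge by simp
      then show ?thesis unfolding nS e using True
        by (simp add: pull_def r_def[symmetric] S_def[symmetric] Y_def[symmetric] nS)
    qed (auto simp: pull_def)
  qed
  finally show "(LINT x|lborel. norm x powr (- n) * X (\<alpha> * norm x) powr ((p + 2) / 2) * \<bar>pull z x\<bar> powr p) =
       (n - 2) * weighted_mass (p * (n - 2) / 2 - n) p z" by simp
qed

end

subsection \<open>Cutting off a point\<close>

lemma positive_part_square_derivative:
  "((\<lambda>y. (max 0 y)\<^sup>2) has_real_derivative 2 * max 0 y) (at (y::real))"
proof -
  consider "y > 0" | "y < 0" | "y = 0" by linarith
  then show ?thesis
  proof cases
    case 1
    have "((\<lambda>y. y\<^sup>2) has_real_derivative 2 * max 0 y) (at y)" using 1 by (auto intro!: derivative_eq_intros)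
    then show ?thesis
      by (rule has_field_derivative_transform_within_open[of _ _ _ "{0<..}"]) (use 1 in auto)
  next
    case 2
    have "((\<lambda>y. 0) has_real_derivative 2 * max 0 y) (at y)" using 2 by simp
    then show ?thesis
      by (rule has_field_derivative_transform_within_open[of _ _ _ "{..<0}"]) (use 2 in auto)
  next
    case 3
    have "((\<lambda>h. (max 0 (0 + h))\<^sup>2 / h) \<longlongrightarrow> 0) (at (0::real))"
    proof (rule Lim_null_comparison)
      show "((\<lambda>h. \<bar>h\<bar>) \<longlongrightarrow> 0) (at (0::real))" by (auto intro: tendsto_eq_intros)
      show "eventually (\<lambda>h. norm ((max 0 (0 + h))\<^sup>2 / h) \<le> \<bar>h\<bar>) (at (0::real))"
        by (intro always_eventually) (auto simp: max_def power2_eq_square)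
    qed
    then show ?thesis unfolding 3 DERIV_def by simp
  qed
qed

text \<open>The fraction depends on \<open>norm x / \<delta>\<close> only, so the gradient is
  bounded by a multiple of \<open>1 / norm x\<close> uniformly in \<delta>. Squaring the positive
  part makes the function continuously differentiable.\<close>

definition cutoff :: "real \<Rightarrow> real^'n::finite \<Rightarrow> real" where
  "cutoff \<delta> x = (max 0 (((norm x)\<^sup>2 - \<delta>\<^sup>2) / ((norm x)\<^sup>2 + \<delta>\<^sup>2)))\<^sup>2"

definition cutoff_slope :: "real \<Rightarrow> real^'n::finite \<Rightarrow> real" where
  "cutoff_slope \<delta> x = 8 * max 0 (((norm x)\<^sup>2 - \<delta>\<^sup>2) / ((norm x)\<^sup>2 + \<delta>\<^sup>2)) * \<delta>\<^sup>2 / ((norm x)\<^sup>2 + \<delta>\<^sup>2)\<^sup>2"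

lemma cutoff_facts:
  fixes x :: "real^'n::finite"
  assumes \<delta>: "\<delta> > 0"
  shows "(cutoff \<delta> has_derivative (\<lambda>h. (cutoff_slope \<delta> x *\<^sub>R x) \<bullet> h)) (at x)"
    "continuous_on UNIV (\<lambda>x. cutoff_slope \<delta> x *\<^sub>R (x :: real^'n))"
    "0 \<le> cutoff \<delta> x" "cutoff \<delta> x \<le> 1" "norm x \<le> \<delta> \<Longrightarrow> cutoff \<delta> x = 0"
    "x \<noteq> 0 \<Longrightarrow> norm (cutoff_slope \<delta> x *\<^sub>R x) \<le> 8 / norm x"
proof -
  have pos: "(norm x)\<^sup>2 + \<delta>\<^sup>2 > 0" for x :: "real^'n" using \<delta> by (simp add: add_nonneg_pos)
  define y where "y x = ((norm x)\<^sup>2 - \<delta>\<^sup>2) / ((norm x)\<^sup>2 + \<delta>\<^sup>2)" for x :: "real^'n"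
  have y1: "y x \<le> 1" using pos[of x] by (simp add: y_def field_simps)
  have "((\<lambda>x. (norm x)\<^sup>2) has_derivative (\<lambda>h. 2 * (x \<bullet> h))) (at x)"
    unfolding power2_norm_eq_inner by (auto intro!: derivative_eq_intros simp: inner_commute)
  moreover have "((\<lambda>s. (s - \<delta>\<^sup>2) / (s + \<delta>\<^sup>2)) has_real_derivative 2 * \<delta>\<^sup>2 / ((norm x)\<^sup>2 + \<delta>\<^sup>2)\<^sup>2) (at ((norm x)\<^sup>2))"
  proof -
    have gen: "((\<lambda>s. (s - D) / (s + D)) has_real_derivative 2 * D / (s0 + D)\<^sup>2) (at s0)" if "s0 + D \<noteq> 0" for s0 D :: real
      by (rule DERIV_cong[OF DERIV_divide[OF DERIV_diff[OF DERIV_ident DERIV_const] DERIV_add[OF DERIV_ident DERIV_const] that]])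
         (simp add: power2_eq_square algebra_simps)
    show ?thesis by (rule gen) (rule less_imp_neq[OF pos, symmetric])
  qed
  ultimately have "(y has_derivative (\<lambda>h. (2 * \<delta>\<^sup>2 / ((norm x)\<^sup>2 + \<delta>\<^sup>2)\<^sup>2 * 2) * (x \<bullet> h))) (at x)"
    unfolding y_def[abs_def] by (rule has_derivative_comp_radial)
  from has_derivative_comp_radial[OF this positive_part_square_derivative]
  show "(cutoff \<delta> has_derivative (\<lambda>h. (cutoff_slope \<delta> x *\<^sub>R x) \<bullet> h)) (at x)"
    unfolding cutoff_def[abs_def] y_def[symmetric] by (rule has_derivative_eq_rhs) (simp add: cutoff_slope_def y_def fun_eq_iff mult_ac)
  show "continuous_on UNIV (\<lambda>x. cutoff_slope \<delta> x *\<^sub>R (x :: real^'n))"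
    unfolding cutoff_slope_def
    by (intro continuous_intros) (use \<delta> pos[THEN less_imp_neq, THEN not_sym] in \<open>auto simp: power2_eq_square\<close>)
  show "0 \<le> cutoff \<delta> x" by (simp add: cutoff_def)
  show "cutoff \<delta> x \<le> 1" unfolding cutoff_def y_def[symmetric] using y1 by (intro power_le_one) auto
  show "cutoff \<delta> x = 0" if "norm x \<le> \<delta>"
  proof -
    have "(norm x)\<^sup>2 \<le> \<delta>\<^sup>2" using that \<delta> by (intro power_mono) auto
    then have "y x \<le> 0" using pos[of x] by (simp add: y_def divide_le_0_iff)
    then show ?thesis unfolding cutoff_def y_def[symmetric] by simp
  qed
  show "norm (cutoff_slope \<delta> x *\<^sub>R x) \<le> 8 / norm x" if "x \<noteq> 0"
  proof -
    define D where "D = (norm x)\<^sup>2 + \<delta>\<^sup>2"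
    have D: "D > 0" using pos[of x] by (simp add: D_def)
    have m: "0 \<le> max 0 (y x)" "max 0 (y x) \<le> 1" using y1 by auto
    have "\<delta>\<^sup>2 * (norm x)\<^sup>2 \<le> D\<^sup>2"
      unfolding D_def power2_sum by (simp add: mult.commute)
    then have "\<delta>\<^sup>2 / D\<^sup>2 * norm x \<le> 1 / norm x"
      using that D by (simp add: field_simps power2_eq_square)
    then have "max 0 (y x) * (\<delta>\<^sup>2 / D\<^sup>2 * norm x) \<le> 1 * (1 / norm x)"
      using m by (intro mult_mono) auto
    moreover have "norm (cutoff_slope \<delta> x *\<^sub>R x) = 8 * (max 0 (y x) * (\<delta>\<^sup>2 / D\<^sup>2 * norm x))"
      using m unfolding cutoff_slope_def y_def[symmetric] unfolding D_def[symmetric] by (simp add: abs_mult)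
    ultimately show ?thesis by simp
  qed
qed

lemma cutoff_limits:
  fixes x :: "real^'n::finite"
  assumes "x \<noteq> 0" "d \<longlonglongrightarrow> 0"
  shows "(\<lambda>j. cutoff (d j) x) \<longlonglongrightarrow> 1" "(\<lambda>j. cutoff_slope (d j) x *\<^sub>R x) \<longlonglongrightarrow> 0"
proof -
  have p: "(norm x)\<^sup>2 + 0\<^sup>2 \<noteq> 0" "((norm x)\<^sup>2 + 0\<^sup>2)\<^sup>2 \<noteq> 0" using assms(1) by auto
  have "(\<lambda>j. cutoff (d j) x) \<longlonglongrightarrow> (max 0 (((norm x)\<^sup>2 - 0\<^sup>2) / ((norm x)\<^sup>2 + 0\<^sup>2)))\<^sup>2"
    unfolding cutoff_def by (intro tendsto_intros assms(2) p)
  then show "(\<lambda>j. cutoff (d j) x) \<longlonglongrightarrow> 1" using assms(1) by simp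
  have "(\<lambda>j. cutoff_slope (d j) x *\<^sub>R x) \<longlonglongrightarrow> (8 * max 0 (((norm x)\<^sup>2 - 0\<^sup>2) / ((norm x)\<^sup>2 + 0\<^sup>2)) * 0\<^sup>2 / ((norm x)\<^sup>2 + 0\<^sup>2)\<^sup>2) *\<^sub>R x"
    unfolding cutoff_slope_def by (intro tendsto_intros assms(2) p)
  then show "(\<lambda>j. cutoff_slope (d j) x *\<^sub>R x) \<longlonglongrightarrow> 0" by simp
qed

text \<open>The square of the gradients is dominated by \<open>norm x powr (-2)\<close>, which is locally integrable in
  dimension at least three.\<close>

lemma cutoff_approximation:
  fixes v :: "real^'n::finite \<Rightarrow> real"
  assumes v: "v \<in> C1c \<Omega>" and \<Omega>: "open \<Omega>"
  obtains V K M where "compact K" "K \<subseteq> \<Omega>" "M > 0" "\<And>j. V j \<in> C1c (\<Omega> - {0})"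
    "\<And>j x. x \<notin> K \<Longrightarrow> V j x = 0 \<and> grad (V j) x = 0" "\<And>x. x \<notin> K \<Longrightarrow> v x = 0 \<and> grad v x = 0"
    "\<And>j x. \<bar>V j x\<bar> \<le> M" "\<And>x. x \<noteq> 0 \<Longrightarrow> (\<lambda>j. V j x) \<longlonglongrightarrow> v x"
    "\<And>x. x \<noteq> 0 \<Longrightarrow> (\<lambda>j. grad (V j) x) \<longlonglongrightarrow> grad v x"
    "\<And>j x. x \<noteq> 0 \<Longrightarrow> (norm (grad (V j) x))\<^sup>2 \<le> M * norm x powr (-2)"
    "(\<forall>x y. norm x = norm y \<longrightarrow> v x = v y) \<Longrightarrow> (\<forall>j x y. norm x = norm y \<longrightarrow> V j x = V j y)"
proof -
  obtain K where K: "compact K" "K \<subseteq> \<Omega>" "\<And>x. x \<notin> K \<Longrightarrow> v x = 0 \<and> grad v x = 0"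
    using C1c_support[OF v] by blast
  obtain R M where RM: "R > 0" "M > 0" "\<And>x. norm x > R \<Longrightarrow> v x = 0 \<and> grad v x = 0"
    "\<And>x. \<bar>v x\<bar> \<le> M" "\<And>x. norm (grad v x) \<le> M"
    using C1c_bounds[OF v] by metis
  define d where "d j = 1 / real (Suc j)" for j
  have d: "d j > 0" for j by (simp add: d_def)
  have d0: "d \<longlonglongrightarrow> 0" unfolding d_def using LIMSEQ_inverse_real_of_nat by (simp add: inverse_eq_divide)
  define V where "V j x = v x * cutoff (d j) x" for j x
  have C: "V j \<in> C1c \<Omega>" "grad (V j) x = v x *\<^sub>R (cutoff_slope (d j) x *\<^sub>R x) + cutoff (d j) x *\<^sub>R grad v x" for j x
  proof -
    have vU: "v \<in> C1c UNIV" using v C1c_subset by blast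
    have co: "continuous_on S (\<lambda>x. cutoff_slope (d j) x *\<^sub>R (x :: real^'n))" for S
      using cutoff_facts(2)[OF d] continuous_on_subset by blast
    show "V j \<in> C1c \<Omega>" unfolding V_def by (rule C1c_mult(1)[OF v \<Omega> cutoff_facts(1)[OF d] co])
    show "grad (V j) x = v x *\<^sub>R (cutoff_slope (d j) x *\<^sub>R x) + cutoff (d j) x *\<^sub>R grad v x"
      unfolding V_def by (rule C1c_mult(2)[OF vU open_UNIV cutoff_facts(1)[OF d] co]) simp
  qed
  have C0: "V j \<in> C1c (\<Omega> - {0})" for j
  proof (rule C1cI[OF C1cD(1)[OF C(1)] C1cD(2)[OF C(1)]])
    have "closed {x::real^'n. norm x \<ge> d j}" by (intro closed_Collect_le continuous_intros)
    then show "compact (K \<inter> {x. norm x \<ge> d j})" by (rule compact_Int_closed[OF K(1)])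
    show "K \<inter> {x. norm x \<ge> d j} \<subseteq> \<Omega> - {0}" using K(2) d[of j] by auto
    show "V j x = 0" if "x \<notin> K \<inter> {x. norm x \<ge> d j}" for x
      using that K(3)[of x] cutoff_facts(5)[OF d, of x j] by (auto simp: V_def)
  qed
  \<comment> \<open>One constant for the values and the gradients: where
    \<open>norm x \<le> R\<close>, the product rule gives \<open>M * (8 / norm x) + M\<close>, which
    is at most \<open>M * (R + 8) / norm x\<close>.\<close>
  define M' where "M' = max M ((M * (R + 8))\<^sup>2)"
  show thesis
  proof (rule that[where V = V and K = K and M = M'])
    show "compact K" "K \<subseteq> \<Omega>" "V j \<in> C1c (\<Omega> - {0})" for j by fact+
    show "M' > 0" using RM(2) by (simp add: M'_def less_max_iff_disj)
    show "V j x = 0 \<and> grad (V j) x = 0" if "x \<notin> K" for j x using K(3)[OF that] unfolding C(2) by (simp add: V_def)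
    show "v x = 0 \<and> grad v x = 0" if "x \<notin> K" for x by (rule K(3)[OF that])
    show "\<bar>V j x\<bar> \<le> M'" for j x
    proof -
      have "\<bar>V j x\<bar> \<le> M * 1" unfolding V_def abs_mult
        using RM(4)[of x] cutoff_facts(3,4)[OF d[of j], of x] by (intro mult_mono) auto
      then show ?thesis by (simp add: M'_def)
    qed
    show "(\<lambda>j. V j x) \<longlonglongrightarrow> v x" if "x \<noteq> 0" for x
      using tendsto_mult[OF tendsto_const[of "v x"] cutoff_limits(1)[OF that d0]] by (simp add: V_def)
    show "(\<lambda>j. grad (V j) x) \<longlonglongrightarrow> grad v x" if "x \<noteq> 0" for x
    proof -
      have "(\<lambda>j. v x *\<^sub>R (cutoff_slope (d j) x *\<^sub>R x) + cutoff (d j) x *\<^sub>R grad v x) \<longlonglongrightarrow> v x *\<^sub>R 0 + 1 *\<^sub>R grad v x"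
        by (intro tendsto_intros cutoff_limits[OF that d0])
      then show ?thesis unfolding C(2) by simp
    qed
    show "(norm (grad (V j) x))\<^sup>2 \<le> M' * norm x powr (-2)" if "x \<noteq> 0" for j x
    proof (cases "norm x > R")
      case True
      then show ?thesis using RM(2) RM(3)[of x] unfolding C(2) by (simp add: M'_def)
    next
      case False
      have "norm (grad (V j) x) \<le> \<bar>v x\<bar> * norm (cutoff_slope (d j) x *\<^sub>R x) + \<bar>cutoff (d j) x\<bar> * norm (grad v x)"
        unfolding C(2) by (rule order_trans[OF norm_triangle_ineq]) (simp add: abs_mult)
      also have "\<dots> \<le> M * (8 / norm x) + 1 * M"
        using RM(2) cutoff_facts(3,4,6)[OF d[of j], of x] that by (intro add_mono mult_mono RM) auto
      also have "\<dots> \<le> (M * (R + 8)) / norm x"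
        using False that RM(2) mult_left_mono[of "norm x" R M] by (simp add: field_simps)
      finally have "(norm (grad (V j) x))\<^sup>2 \<le> ((M * (R + 8)) / norm x)\<^sup>2" by (intro power_mono) auto
      also have "\<dots> = (M * (R + 8))\<^sup>2 * norm x powr (-2)"
        using that by (simp add: powr_minus divide_inverse power_mult_distrib power_inverse)
      also have "\<dots> \<le> M' * norm x powr (-2)" by (intro mult_right_mono) (auto simp: M'_def)
      finally show ?thesis .
    qed
    show "\<forall>j x y. norm x = norm y \<longrightarrow> V j x = V j y" if "\<forall>x y. norm x = norm y \<longrightarrow> v x = v y"
      unfolding V_def cutoff_def using that by metis
  qed
qed

subsection \<open>Moving the base point to the origin\<close>

locale sphere_inversion =
  fixes x0 :: "real^'n::finite"
  assumes x0: "x0 \<noteq> 0" "norm x0 < 1"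
begin

text \<open>Center of the inversion: the image of \<open>x0\<close> under inversion in the unit
  sphere. With squared radius \<open>R2\<close> the sphere about \<open>a\<close> meets the unit
  sphere orthogonally, so inversion in it preserves the ball; it exchanges \<open>0\<close> and
  \<open>x0\<close>.\<close>

definition a :: "real^'n" where "a = x0 /\<^sub>R (norm x0)\<^sup>2"
definition R2 :: real where "R2 = (norm a)\<^sup>2 - 1"
definition \<mu> :: "real^'n \<Rightarrow> real" where "\<mu> x = R2 / (norm (x - a))\<^sup>2"
definition inver :: "real^'n \<Rightarrow> real^'n" where "inver x = a + \<mu> x *\<^sub>R (x - a)"

lemma norm_a: "(norm a)\<^sup>2 = 1 / (norm x0)\<^sup>2" "norm a > 1" "R2 > 0" "a \<noteq> 0"
proof -
  have n: "norm a = 1 / norm x0" using x0 by (simp add: a_def power2_eq_square field_simps)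
  then show "(norm a)\<^sup>2 = 1 / (norm x0)\<^sup>2" by (simp add: power_divide)
  show a1: "norm a > 1" using x0 unfolding n by simp
  then show "R2 > 0" unfolding R2_def by (simp add: one_less_power)
  show "a \<noteq> 0" using a1 by auto
qed

lemma not_a: "x \<in> ball 0 1 \<Longrightarrow> x - a \<noteq> 0" "x \<in> ball 0 1 \<Longrightarrow> \<mu> x > 0"
proof -
  assume x: "x \<in> ball 0 1"
  then show "x - a \<noteq> 0" using norm_a by auto
  then show "\<mu> x > 0" using norm_a by (simp add: \<mu>_def)
qed

text \<open>As \<open>\<mu> x\<close> is the local scaling factor of the inversion, this identity
  says that the conformal factor transforms as it must under an isometry of the hyperbolic
  metric.\<close>

lemma one_minus_norm_inver:
  assumes "x - a \<noteq> 0" shows "1 - (norm (inver x))\<^sup>2 = \<mu> x * (1 - (norm x)\<^sup>2)"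
proof -
  define y where "y = x - a"
  have xy: "x = a + y" by (simp add: y_def)
  have \<mu>y: "\<mu> x * (norm y)\<^sup>2 = R2" using assms by (simp add: \<mu>_def y_def)
  have 1: "(norm x)\<^sup>2 = (norm a)\<^sup>2 + 2 * (a \<bullet> y) + (norm y)\<^sup>2"
    unfolding xy power2_norm_eq_inner by (simp add: inner_add_left inner_add_right inner_commute)
  have "(norm (inver x))\<^sup>2 = (norm a)\<^sup>2 + \<mu> x * (2 * (a \<bullet> y)) + \<mu> x * (\<mu> x * (norm y)\<^sup>2)"
    unfolding inver_def y_def[symmetric] power2_norm_eq_inner by (simp add: inner_add_left inner_add_right inner_commute)
  also have "2 * (a \<bullet> y) = (norm x)\<^sup>2 - (norm a)\<^sup>2 - (norm y)\<^sup>2" using 1 by simp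
  also have "\<mu> x * (\<mu> x * (norm y)\<^sup>2) = \<mu> x * R2" by (simp only: \<mu>y)
  finally have E: "(norm (inver x))\<^sup>2 = (norm a)\<^sup>2 + \<mu> x * ((norm x)\<^sup>2 - (norm a)\<^sup>2 + R2) - \<mu> x * (norm y)\<^sup>2"
    by (simp add: algebra_simps)
  show ?thesis unfolding E \<mu>y by (simp add: R2_def algebra_simps)
qed

lemma inver_ball: "x \<in> ball 0 1 \<Longrightarrow> inver x \<in> ball 0 1"
proof -
  assume x: "x \<in> ball 0 1"
  have "(norm x)\<^sup>2 < 1" using x by (simp add: abs_square_less_1)
  then have "0 < 1 - (norm (inver x))\<^sup>2"
    unfolding one_minus_norm_inver[OF not_a(1)[OF x]] using not_a(2)[OF x] by simp
  then show "inver x \<in> ball 0 1" by (simp add: abs_square_less_1)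
qed

lemma inver_inver: "x - a \<noteq> 0 \<Longrightarrow> inver (inver x) = x"
proof -
  assume x: "x - a \<noteq> 0"
  define y where "y = x - a"
  have y: "y \<noteq> 0" "x = a + y" using x by (simp_all add: y_def)
  have e: "inver x - a = \<mu> x *\<^sub>R y" by (simp add: inver_def y_def)
  have "\<mu> (inver x) * \<mu> x = 1"
    unfolding \<mu>_def[of "inver x"] e using y(1) norm_a(3) by (simp add: \<mu>_def y_def[symmetric] power_mult_distrib power_divide power2_eq_square)
  then have "\<mu> (inver x) *\<^sub>R (\<mu> x *\<^sub>R y) = y" by simp
  then have "a + \<mu> (inver x) *\<^sub>R (inver x - a) = x" unfolding e using y(2) by simp
  then show "inver (inver x) = x" by (simp only: inver_def[of "inver x"])
qed

lemma conf_factor_inver: "x \<in> ball 0 1 \<Longrightarrow> conf_factor (inver x) = conf_factor x / \<mu> x"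
  unfolding conf_factor_def using one_minus_norm_inver[OF not_a(1)] by simp

text \<open>The derivative is \<open>\<mu> x\<close> times the reflection in the direction
  \<open>x - a\<close>.\<close>

lemma inver_has_derivative:
  assumes "x - a \<noteq> 0"
  shows "(inver has_derivative (\<lambda>h. \<mu> x *\<^sub>R h + ((- 2 * \<mu> x / (norm (x - a))\<^sup>2) * ((x - a) \<bullet> h)) *\<^sub>R (x - a))) (at x)"
proof -
  have nz: "(x - a) \<bullet> (x - a) \<noteq> 0" using assms by simp
  have "(\<mu> has_derivative (\<lambda>h. (- 2 * \<mu> x / (norm (x - a))\<^sup>2) * ((x - a) \<bullet> h))) (at x)"
    unfolding \<mu>_def[abs_def] power2_norm_eq_inner using nz
    by (auto intro!: derivative_eq_intros simp: inner_commute power2_eq_square field_simps)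
  from has_derivative_add[OF has_derivative_const has_derivative_scaleR[OF this has_derivative_diff[OF has_derivative_ident has_derivative_const]]]
  have "(inver has_derivative (\<lambda>h. 0 + (\<mu> x *\<^sub>R (h - 0) + ((- 2 * \<mu> x / (norm (x - a))\<^sup>2) * ((x - a) \<bullet> h)) *\<^sub>R (x - a)))) (at x)"
    unfolding inver_def[abs_def] .
  then show ?thesis by simp
qed

lemma inver_0: "inver 0 = x0"
proof -
  have "x0 = a /\<^sub>R (norm a)\<^sup>2" unfolding norm_a(1) using x0 by (simp add: a_def)
  also have "\<dots> = a - (R2 / (norm a)\<^sup>2) *\<^sub>R a"
    using norm_a(4) by (simp add: R2_def diff_divide_distrib scaleR_left_diff_distrib inverse_eq_divide)
  finally have "a + \<mu> 0 *\<^sub>R (0 - a) = x0" by (simp add: \<mu>_def)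
  then show ?thesis by (simp only: inver_def)
qed

text \<open>Since \<open>x0\<close> is the image of \<open>0\<close>, numerator and denominator of
  the fraction in \<open>hyp_dist\<close> both acquire the factor
  \<open>\<mu> x * \<mu> 0\<close>.\<close>

lemma hyp_dist_inver:
  assumes "x \<in> ball 0 1" shows "hyp_dist (inver x) x0 = hyp_dist x 0"
proof -
  define y where "y = x - a"
  have y: "y \<noteq> 0" "x = a + y" using not_a(1)[OF assms] by (simp_all add: y_def)
  have z: "0 - a \<noteq> 0" using norm_a by simp
  have d: "(norm (inver x - x0))\<^sup>2 = R2\<^sup>2 * (norm x)\<^sup>2 / ((norm y)\<^sup>2 * (norm a)\<^sup>2)"
  proof -
    have "inver x - inver 0 = R2 *\<^sub>R ((1 / (norm y)\<^sup>2) *\<^sub>R y + (1 / (norm a)\<^sup>2) *\<^sub>R a)"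
      unfolding inver_def \<mu>_def y_def[symmetric] by (simp add: scaleR_add_right)
    note e = this[unfolded inver_0]
    define A where "A = (norm a)\<^sup>2"
    define Y where "Y = (norm y)\<^sup>2"
    have AY: "A > 0" "Y > 0" using norm_a(4) y(1) by (simp_all add: A_def Y_def)
    have AY': "a \<bullet> a = A" "y \<bullet> y = Y" by (simp_all add: A_def Y_def power2_norm_eq_inner)
    have "(norm (inver x - x0))\<^sup>2 = R2\<^sup>2 * (1 / Y + 2 * (a \<bullet> y) / (Y * A) + 1 / A)"
      unfolding e norm_scaleR power_mult_distrib A_def[symmetric] Y_def[symmetric] unfolding power2_norm_eq_inner
      using AY by (simp add: inner_add_left inner_add_right inner_commute AY')
    also have "1 / Y + 2 * (a \<bullet> y) / (Y * A) + 1 / A = (A + 2 * (a \<bullet> y) + Y) / (Y * A)"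
      using AY by (simp add: field_simps)
    also have "A + 2 * (a \<bullet> y) + Y = (norm x)\<^sup>2"
      unfolding y(2) power2_norm_eq_inner by (simp add: inner_add_left inner_add_right inner_commute AY')
    finally show ?thesis by (simp add: A_def Y_def)
  qed
  have e1: "1 - (norm (inver x))\<^sup>2 = R2 / (norm y)\<^sup>2 * (1 - (norm x)\<^sup>2)"
    using one_minus_norm_inver[OF not_a(1)[OF assms]] by (simp add: \<mu>_def y_def)
  have e0: "1 - (norm x0)\<^sup>2 = R2 / (norm a)\<^sup>2"
    using one_minus_norm_inver[OF z, unfolded inver_0] by (simp add: \<mu>_def)
  have "2 * (norm (inver x - x0))\<^sup>2 / ((1 - (norm (inver x))\<^sup>2) * (1 - (norm x0)\<^sup>2)) = 2 * (norm x)\<^sup>2 / (1 - (norm x)\<^sup>2)"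
  proof -
    have gen: "2 * (R\<^sup>2 * Z / (Y * A)) / ((R / Y * D) * (R / A)) = 2 * Z / D" if "R \<noteq> 0" "Y \<noteq> 0" "A \<noteq> 0" for R Z Y A D :: real
      using that by (cases "D = 0") (simp_all add: power2_eq_square)
    show ?thesis unfolding d e1 e0 by (rule gen) (use y(1) norm_a(3,4) in auto)
  qed
  then show ?thesis unfolding hyp_dist_def by simp
qed

definition transport :: "(real^'n \<Rightarrow> real) \<Rightarrow> real^'n \<Rightarrow> real" where
  "transport u x = (if x \<in> ball 0 1 then u (inver x) else 0)"

lemma continuous_inver: "continuous_on (ball 0 1) inver" "continuous_on (ball 0 1) \<mu>"
proof -
  show "continuous_on (ball 0 1) inver"
    by (rule has_derivative_continuous_on) (rule has_derivative_at_withinI[OF inver_has_derivative[OF not_a(1)]])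
  show "continuous_on (ball 0 1) \<mu>"
    unfolding \<mu>_def using not_a(1) by (intro continuous_intros) auto
qed

lemma continuous_inver_slope: "continuous_on (ball 0 1) (\<lambda>x. - 2 * \<mu> x / (norm (x - a))\<^sup>2)"
  using not_a(1) by (intro continuous_intros continuous_inver) auto

text \<open>\<open>S\<close> is a set avoided by the support: empty in the inequality, and
  \<open>{0}\<close> in the sharpness argument, where support away from \<open>0\<close> becomes
  support away from \<open>x0\<close>. The gradient is scaled by \<open>\<mu> x\<close> because a
  reflection preserves lengths.\<close>

lemma transport_C1c:
  assumes u: "u \<in> C1c (ball 0 1 - S)" and S: "closed S" "S' = inver ` (S \<inter> ball 0 1)" "closed S'"
  shows "transport u \<in> C1c (ball 0 1 - S')"
    "\<And>x. x \<in> ball 0 1 \<Longrightarrow> norm (grad (transport u) x) = \<mu> x * norm (grad u (inver x))"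
proof -
  have c: "continuous_on (ball 0 1) (\<lambda>x. x - a)" by (intro continuous_intros)
  have maps: "x \<in> ball 0 1 \<Longrightarrow> inver x \<in> ball 0 1 \<and> inver (inver x) = x" for x
    using inver_ball inver_inver not_a(1) by blast
  have uB: "u \<in> C1c (ball 0 1)" using u C1c_subset[of "ball 0 1 - S" "ball 0 1"] by auto
  have e: "transport u = (\<lambda>x. if x \<in> ball 0 1 then u (inver x) else 0)" by (rule ext) (rule transport_def)
  note T = C1c_compose[OF uB open_ball inver_has_derivative[OF not_a(1)] continuous_inver(2) continuous_inver_slope c continuous_inver(1) maps maps, folded e]
  have TB: "transport u \<in> C1c (ball 0 1)" by (rule T)
  obtain K where K: "compact K" "K \<subseteq> ball 0 1 - S" "\<And>x. x \<notin> K \<Longrightarrow> u x = 0" using C1c_support[OF u] by blast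
  show "transport u \<in> C1c (ball 0 1 - S')"
  proof (rule C1cI[OF C1cD(1)[OF TB] C1cD(2)[OF TB]])
    show "compact (inver ` K)"
      using K by (intro compact_continuous_image continuous_on_subset[OF continuous_inver(1)]) auto
    show "inver ` K \<subseteq> ball 0 1 - S'"
    proof
      fix y assume "y \<in> inver ` K"
      then obtain x where x: "x \<in> K" "y = inver x" by blast
      then have xb: "x \<in> ball 0 1" "x \<notin> S" using K(2) by auto
      have "y \<notin> S'"
      proof
        assume "y \<in> S'"
        then obtain x' where "x' \<in> S" "x' \<in> ball 0 1" "inver x' = inver x" using S(2) x(2) by auto
        then have "x' = x" using maps xb(1) by metis
        then show False using \<open>x' \<in> S\<close> xb(2) by simp
      qed
      then show "y \<in> ball 0 1 - S'" using inver_ball[OF xb(1)] x(2) by simp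
    qed
    show "transport u x = 0" if "x \<notin> inver ` K" for x
    proof (cases "x \<in> ball 0 1")
      case True
      then have "inver x \<notin> K" using maps[OF True] that by (metis imageI)
      then show ?thesis using K(3) by (simp add: transport_def)
    qed (simp add: transport_def)
  qed
  show "norm (grad (transport u) x) = \<mu> x * norm (grad u (inver x))" if x: "x \<in> ball 0 1" for x
  proof -
    define y where "y = x - a"
    define g where "g = grad u (inver x)"
    have yy: "(norm y)\<^sup>2 \<noteq> 0" "y \<bullet> y = (norm y)\<^sup>2" using not_a(1)[OF x] by (simp_all add: y_def power2_norm_eq_inner)
    have "grad (transport u) x = \<mu> x *\<^sub>R g + ((- 2 * \<mu> x / (norm y)\<^sup>2) * (y \<bullet> g)) *\<^sub>R y"
      unfolding y_def g_def by (rule T) (use x in auto)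
    also have "\<dots> = \<mu> x *\<^sub>R (g - (2 * (y \<bullet> g) / (norm y)\<^sup>2) *\<^sub>R y)"
      by (simp add: algebra_simps)
    finally have 1: "grad (transport u) x = \<mu> x *\<^sub>R (g - (2 * (y \<bullet> g) / (norm y)\<^sup>2) *\<^sub>R y)" .
    have "(norm (g - (2 * (y \<bullet> g) / (norm y)\<^sup>2) *\<^sub>R y))\<^sup>2 = (norm g)\<^sup>2"
      unfolding power2_norm_eq_inner[of "g - _"] power2_norm_eq_inner[of g]
      using yy by (simp add: inner_diff_left inner_diff_right inner_commute field_simps power2_eq_square)
    then have "norm (g - (2 * (y \<bullet> g) / (norm y)\<^sup>2) *\<^sub>R y) = norm g" by simp
    then show ?thesis unfolding 1 g_def using not_a(2)[OF x] by simp
  qed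
qed

text \<open>The modulus of the Jacobian is \<open>\<mu> x ^ CARD('n)\<close>, which cancels against
  the change of the conformal factor.\<close>

lemma integral_hyp_volume_inver:
  fixes f g :: "real^'n \<Rightarrow> real"
  assumes [measurable]: "f \<in> borel_measurable borel" "g \<in> borel_measurable borel"
    and fg: "\<And>x. x \<in> ball 0 1 \<Longrightarrow> g x = f (inver x)"
  shows "(LINT x|hyp_volume. f x) = (LINT x|hyp_volume. g x)"
proof -
  have im: "inver ` ball 0 1 = ball 0 1"
    using inver_ball inver_inver not_a(1) by (metis (no_types, lifting) image_subsetI image_eqI subsetI subset_antisym)
  have inj: "inj_on inver (ball 0 1)" by (rule inj_on_inverseI[of _ inver]) (use inver_inver not_a(1) in auto)
  have op: "open (inver ` ball 0 1)" unfolding im by simp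
  have c: "continuous_on (ball 0 1) (\<lambda>x. x - a)" by (intro continuous_intros)
  have "(LINT x|hyp_volume. f x) = (LINT y|lborel. indicator (inver ` ball 0 1) y * (conf_factor y ^ CARD('n) * f y))"
    unfolding im by (rule integral_hyp_volume) measurable
  also have "\<dots> = (LINT x|lborel. indicator (ball 0 1) x * (\<bar>\<mu> x ^ (CARD('n) - 1) * (\<mu> x + (- 2 * \<mu> x / (norm (x - a))\<^sup>2) * ((x - a) \<bullet> (x - a)))\<bar> *
      (conf_factor (inver x) ^ CARD('n) * f (inver x))))"
    by (rule integral_change_of_variables_open[OF open_ball op inver_has_derivative[OF not_a(1)] inj continuous_inver(2) continuous_inver_slope c]) measurable
  also have "\<dots> = (LINT x|lborel. indicator (ball 0 1) x * (conf_factor x ^ CARD('n) * g x))"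
  proof (intro Bochner_Integration.integral_cong refl)
    fix x :: "real^'n"
    show "indicator (ball 0 1) x * (\<bar>\<mu> x ^ (CARD('n) - 1) * (\<mu> x + (- 2 * \<mu> x / (norm (x - a))\<^sup>2) * ((x - a) \<bullet> (x - a)))\<bar> *
      (conf_factor (inver x) ^ CARD('n) * f (inver x))) = indicator (ball 0 1) x * (conf_factor x ^ CARD('n) * g x)"
    proof (cases "x \<in> ball 0 1")
      case True
      have "\<mu> x + (- 2 * \<mu> x / (norm (x - a))\<^sup>2) * ((x - a) \<bullet> (x - a)) = - \<mu> x"
        using not_a(1)[OF True] by (simp add: power2_norm_eq_inner)
      moreover have "\<bar>\<mu> x ^ (CARD('n) - 1) * (- \<mu> x)\<bar> = \<mu> x ^ CARD('n)"
      proof -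
        have "\<mu> x ^ CARD('n) = \<mu> x ^ (CARD('n) - 1) * \<mu> x"
          by (metis One_nat_def Suc_pred power_Suc2 zero_less_card_finite)
        then show ?thesis using not_a(2)[OF True] by (simp add: abs_mult)
      qed
      moreover have "\<mu> x ^ CARD('n) * (conf_factor (inver x) ^ CARD('n) * f (inver x)) = conf_factor x ^ CARD('n) * g x"
        unfolding conf_factor_inver[OF True] using not_a(2)[OF True] fg[OF True] by (simp add: power_divide)
      ultimately show ?thesis by simp
    qed simp
  qed
  also have "\<dots> = (LINT x|hyp_volume. g x)" by (rule integral_hyp_volume[symmetric]) measurable
  finally show ?thesis .
qed

lemma transport_energies:
  assumes u: "u \<in> C1c (ball 0 1)"
  shows "hardy_energy x0 u = hardy_energy 0 (transport u)" "weighted_term p \<alpha> x0 u = weighted_term p \<alpha> 0 (transport u)"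
proof -
  have u': "u \<in> C1c (ball 0 1 - {})" using u by simp
  note T = transport_C1c[OF u' closed_empty, of "{}"]
  have TC: "transport u \<in> C1c (ball 0 1)" using T(1) by simp
  note [measurable] = C1cD(4,5)[OF u] C1cD(4,5)[OF TC]
  have hg [measurable]: "(\<lambda>x. (hyp_norm x (hyp_grad u x))\<^sup>2) \<in> borel_measurable borel"
    "(\<lambda>x. (hyp_norm x (hyp_grad (transport u) x))\<^sup>2) \<in> borel_measurable borel"
    unfolding hyp_norm_def hyp_grad_def by measurable
  have ti: "transport u x = u (inver x)" if "x \<in> ball 0 1" for x using that by (simp add: transport_def)
  have e1: "(LINT x|hyp_volume. (hyp_norm x (hyp_grad u x))\<^sup>2) = (LINT x|hyp_volume. (hyp_norm x (hyp_grad (transport u) x))\<^sup>2)"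
  proof (rule integral_hyp_volume_inver[OF hg])
    fix x :: "real^'n" assume x: "x \<in> ball 0 1"
    have "conf_factor x > 0" using x by (intro conf_factor_pos) simp
    moreover have "norm (grad (transport u) x) = \<mu> x * norm (grad u (inver x))" using T(2)[OF _ _ x] by simp
    ultimately show "(hyp_norm x (hyp_grad (transport u) x))\<^sup>2 = (hyp_norm (inver x) (hyp_grad u (inver x)))\<^sup>2"
      using not_a(2)[OF x] by (simp add: hyp_norm_def hyp_grad_def conf_factor_inver[OF x] power2_eq_square field_simps)
  qed
  have e2: "(LINT x|hyp_volume. (u x)\<^sup>2) = (LINT x|hyp_volume. (transport u x)\<^sup>2)"
    by (rule integral_hyp_volume_inver) (measurable, simp add: ti)
  have e3: "(LINT x|hyp_volume. (u x)\<^sup>2 / (sinh (hyp_dist x x0))\<^sup>2) = (LINT x|hyp_volume. (transport u x)\<^sup>2 / (sinh (hyp_dist x 0))\<^sup>2)"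
    by (rule integral_hyp_volume_inver) (measurable, simp add: ti hyp_dist_inver)
  show "hardy_energy x0 u = hardy_energy 0 (transport u)" unfolding hardy_energy_def Let_def e1 e2 e3 ..
  have "(LINT x|hyp_volume. sinh (hyp_dist x x0) powr q * X (\<alpha> * tanh (hyp_dist x x0 / 2)) powr ((p + 2) / 2) * \<bar>u x\<bar> powr p) =
    (LINT x|hyp_volume. sinh (hyp_dist x 0) powr q * X (\<alpha> * tanh (hyp_dist x 0 / 2)) powr ((p + 2) / 2) * \<bar>transport u x\<bar> powr p)" for q
    by (rule integral_hyp_volume_inver) (measurable, simp add: ti hyp_dist_inver)
  then show "weighted_term p \<alpha> x0 u = weighted_term p \<alpha> 0 (transport u)"
    unfolding weighted_term_def Let_def by simp
qed

lemma transport_transport: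
  assumes "u \<in> C1c (ball 0 1)" shows "transport (transport u) = u"
proof
  fix x
  have "u x = 0" if "x \<notin> ball 0 1" using C1c_support[OF assms] that by blast
  then show "transport (transport u) x = u x"
    using inver_ball[of x] inver_inver[OF not_a(1), of x] by (cases "x \<in> ball 0 1") (simp_all add: transport_def)
qed

end

subsection \<open>Passing to the limit in the energies\<close>

lemma tendsto_integral_compact:
  fixes A f :: "real^'n::finite \<Rightarrow> real"
  assumes \<Omega>: "open \<Omega>" "compact K" "K \<subseteq> \<Omega>" and A: "continuous_on \<Omega> A"
    and F: "\<And>j. continuous_on UNIV (F j)" "continuous_on UNIV f"
    and z: "\<And>j x. x \<notin> K \<Longrightarrow> F j x = 0" "\<And>x. x \<notin> K \<Longrightarrow> f x = 0"
    and lim: "\<And>x. (\<lambda>j. F j x) \<longlonglongrightarrow> f x" and B: "\<And>j x. \<bar>F j x\<bar> \<le> B"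
  shows "(\<lambda>j. LINT x|lborel. A x * F j x) \<longlonglongrightarrow> (LINT x|lborel. A x * f x)"
proof -
  have "compact (A ` K)" using \<Omega> A by (intro compact_continuous_image continuous_on_subset[OF A])
  then have "bounded (A ` K)" by (rule compact_imp_bounded)
  then obtain C where C: "\<And>x. x \<in> K \<Longrightarrow> \<bar>A x\<bar> \<le> C" unfolding bounded_iff by (metis imageI real_norm_def)
  show ?thesis
  proof (rule integral_dominated_convergence[where w = "\<lambda>x. C * B * indicator K x"])
    show "(\<lambda>x. A x * f x) \<in> borel_measurable lborel" "\<And>j. (\<lambda>x. A x * F j x) \<in> borel_measurable lborel"
      using integrable_mult_support[OF \<Omega> A F(2) z(2)] integrable_mult_support[OF \<Omega> A F(1) z(1)]
      by (auto dest: borel_measurable_integrable)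
    have "emeasure lborel K < \<infinity>" using \<Omega>(2) by (intro emeasure_bounded_finite compact_imp_bounded)
    then show "integrable lborel (\<lambda>x. C * B * indicator K x)"
      using \<Omega>(2) by (intro integrable_mult_right integrable_real_indicator) (auto simp: compact_imp_closed)
    show "AE x in lborel. (\<lambda>j. A x * F j x) \<longlonglongrightarrow> A x * f x" by (intro AE_I2 tendsto_intros lim)
    show "AE x in lborel. norm (A x * F j x) \<le> C * B * indicator K x" for j
    proof (intro AE_I2)
      fix x show "norm (A x * F j x) \<le> C * B * indicator K x"
      proof (cases "x \<in> K")
        case True
        have "\<bar>A x\<bar> * \<bar>F j x\<bar> \<le> C * B" using C[OF True] B[of j x] by (intro mult_mono) auto
        then show ?thesis using True by (simp add: abs_mult)
      qed (simp add: z)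
    qed
  qed
qed

lemma tendsto_integral_powr:
  fixes g :: "real^'n::finite \<Rightarrow> real"
  assumes meas: "\<And>j. G j \<in> borel_measurable borel" "g \<in> borel_measurable borel"
    and lim: "\<And>x. x \<noteq> 0 \<Longrightarrow> (\<lambda>j. G j x) \<longlonglongrightarrow> g x" and b: "b > - real CARD('n)"
    and B: "\<And>j x. x \<noteq> 0 \<Longrightarrow> norm x \<le> R \<Longrightarrow> \<bar>G j x\<bar> \<le> B * norm x powr b"
    and R: "\<And>j x. norm x > R \<Longrightarrow> G j x = 0"
  shows "(\<lambda>j. LINT x|lborel. G j x) \<longlonglongrightarrow> (LINT x|lborel. g x)"
proof (rule integral_dominated_convergence[where w = "\<lambda>x. B * (indicator (cball 0 R) x * norm x powr b)"])
  show "integrable lborel (\<lambda>x::real^'n. B * (indicator (cball 0 R) x * norm x powr b))"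
    by (intro integrable_mult_right integrable_norm_powr_cball b)
  show "AE x in lborel. (\<lambda>j. G j x) \<longlonglongrightarrow> g x"
    using AE_norm_pos by eventually_elim (use lim in auto)
  show "AE x in lborel. norm (G j x) \<le> B * (indicator (cball 0 R) x * norm x powr b)" for j
    using AE_norm_pos
  proof eventually_elim
    case (elim x)
    then show ?case using B[of x j] R[of x j] by (cases "norm x \<le> R") auto
  qed
qed (use meas in auto)

lemma tendsto_inverse_Suc:
  fixes F :: "nat \<Rightarrow> 'a \<Rightarrow> 'b::real_normed_vector"
  assumes "\<And>j x. norm (F j x - f x) \<le> 1 / real (Suc j)"
  shows "(\<lambda>j. F j x) \<longlonglongrightarrow> f x"
proof (rule LIM_zero_cancel, rule Lim_null_comparison[OF always_eventually])
  show "\<forall>j. norm (F j x - f x) \<le> 1 / real (Suc j)" using assms by simp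
  show "(\<lambda>j. 1 / real (Suc j)) \<longlonglongrightarrow> 0" using LIMSEQ_inverse_real_of_nat by (simp add: inverse_eq_divide)
qed

text \<open>One sequence serves all these functionals. Weights that are merely continuous on
  \<open>\<Omega>\<close> may be unbounded near its boundary, which does no harm because all
  supports lie in a fixed compact subset.\<close>

lemma approximation_limits:
  fixes f A :: "real^'n::finite \<Rightarrow> real"
  assumes f: "f \<in> C1c \<Omega>" and \<Omega>: "open \<Omega>" and p: "p > 0"
  obtains F where "\<And>j. F j \<in> test_functions \<Omega>" "\<And>x. (\<lambda>j. F j x) \<longlonglongrightarrow> f x"
    "\<And>A. continuous_on \<Omega> A \<Longrightarrow> (\<lambda>j. LINT x|lborel. A x * (norm (grad (F j) x))\<^sup>2) \<longlonglongrightarrow> (LINT x|lborel. A x * (norm (grad f x))\<^sup>2)"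
    "\<And>A. continuous_on \<Omega> A \<Longrightarrow> (\<lambda>j. LINT x|lborel. A x * (F j x)\<^sup>2) \<longlonglongrightarrow> (LINT x|lborel. A x * (f x)\<^sup>2)"
    "\<And>A. continuous_on \<Omega> A \<Longrightarrow> (\<lambda>j. LINT x|lborel. A x * \<bar>F j x\<bar> powr p) \<longlonglongrightarrow> (LINT x|lborel. A x * \<bar>f x\<bar> powr p)"
    "\<And>a. a > - real CARD('n) \<Longrightarrow> (\<lambda>j. weighted_mass a p (F j)) \<longlonglongrightarrow> weighted_mass a p f"
proof -
  obtain F K where FK: "compact K" "K \<subseteq> \<Omega>" "\<And>j. F j \<in> test_functions \<Omega>"
    "\<And>j x. x \<notin> K \<Longrightarrow> F j x = 0 \<and> grad (F j) x = 0" "\<And>x. x \<notin> K \<Longrightarrow> f x = 0 \<and> grad f x = 0"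
    "\<And>j x. \<bar>F j x - f x\<bar> \<le> 1 / Suc j" "\<And>j x. norm (grad (F j) x - grad f x) \<le> 1 / Suc j"
    by (rule C1c_approximation[OF f \<Omega>], rule that)
  obtain M where M: "M > 0" "\<And>x. \<bar>f x\<bar> \<le> M" "\<And>x. norm (grad f x) \<le> M" using C1c_bounds[OF f] by metis
  obtain R where R: "\<And>x. x \<in> K \<Longrightarrow> norm x \<le> R" using compact_imp_bounded[OF FK(1)] bounded_iff by blast
  have F1: "F j \<in> C1c \<Omega>" for j using FK(3) test_functions_subset_C1c by blast
  have l1: "(\<lambda>j. F j x) \<longlonglongrightarrow> f x" for x by (rule tendsto_inverse_Suc) (use FK(6) in simp)
  have l2: "(\<lambda>j. grad (F j) x) \<longlonglongrightarrow> grad f x" for x by (rule tendsto_inverse_Suc[where F = "\<lambda>j. grad (F j)"]) (rule FK(7))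
  have s: "1 / real (Suc j) \<le> 1" for j by simp
  have b1: "\<bar>F j x\<bar> \<le> M + 1" for j x
    using M(2)[of x] FK(6)[of j x] s[of j] by linarith
  have b2: "norm (grad (F j) x) \<le> M + 1" for j x
    using M(3)[of x] FK(7)[of j x] s[of j] norm_triangle_sub[of "grad (F j) x" "grad f x"] by linarith
  show thesis
  proof (rule that[of F])
    show "F j \<in> test_functions \<Omega>" for j by fact
    show "(\<lambda>j. F j x) \<longlonglongrightarrow> f x" for x by (rule l1)
    show "(\<lambda>j. LINT x|lborel. A x * (norm (grad (F j) x))\<^sup>2) \<longlonglongrightarrow> (LINT x|lborel. A x * (norm (grad f x))\<^sup>2)"
      if A: "continuous_on \<Omega> A" for A
    proof (rule tendsto_integral_compact[OF \<Omega> FK(1,2) A, where B = "(M + 1)\<^sup>2"])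
      show "continuous_on UNIV (\<lambda>x. (norm (grad (F j) x))\<^sup>2)" for j by (intro continuous_intros C1cD(2)[OF F1])
      show "continuous_on UNIV (\<lambda>x. (norm (grad f x))\<^sup>2)" by (intro continuous_intros C1cD(2)[OF f])
      show "(\<lambda>j. (norm (grad (F j) x))\<^sup>2) \<longlonglongrightarrow> (norm (grad f x))\<^sup>2" for x by (intro tendsto_intros l2)
      show "\<bar>(norm (grad (F j) x))\<^sup>2\<bar> \<le> (M + 1)\<^sup>2" for j x using b2 by (simp add: power_mono)
    qed (use FK(4,5) in auto)
    show "(\<lambda>j. LINT x|lborel. A x * (F j x)\<^sup>2) \<longlonglongrightarrow> (LINT x|lborel. A x * (f x)\<^sup>2)"
      if A: "continuous_on \<Omega> A" for A
    proof (rule tendsto_integral_compact[OF \<Omega> FK(1,2) A, where B = "(M + 1)\<^sup>2"])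
      show "continuous_on UNIV (\<lambda>x. (F j x)\<^sup>2)" for j by (intro continuous_intros C1cD(3)[OF F1])
      show "continuous_on UNIV (\<lambda>x. (f x)\<^sup>2)" by (intro continuous_intros C1cD(3)[OF f])
      show "(\<lambda>j. (F j x)\<^sup>2) \<longlonglongrightarrow> (f x)\<^sup>2" for x by (intro tendsto_intros l1)
      show "\<bar>(F j x)\<^sup>2\<bar> \<le> (M + 1)\<^sup>2" for j x
        using power_mono[OF b1[of j x] abs_ge_zero, of 2] by simp
    qed (use FK(4,5) in auto)
    show "(\<lambda>j. LINT x|lborel. A x * \<bar>F j x\<bar> powr p) \<longlonglongrightarrow> (LINT x|lborel. A x * \<bar>f x\<bar> powr p)"
      if A: "continuous_on \<Omega> A" for A
    proof (rule tendsto_integral_compact[OF \<Omega> FK(1,2) A, where B = "(M + 1) powr p"])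
      have c: "continuous_on UNIV (\<lambda>x. \<bar>h x\<bar> powr p)" if "continuous_on UNIV h" for h :: "real^'n \<Rightarrow> real"
        using that p by (intro continuous_on_powr' continuous_on_rabs continuous_on_const) auto
      show "continuous_on UNIV (\<lambda>x. \<bar>F j x\<bar> powr p)" for j by (rule c[OF C1cD(3)[OF F1]])
      show "continuous_on UNIV (\<lambda>x. \<bar>f x\<bar> powr p)" by (rule c[OF C1cD(3)[OF f]])
      show "(\<lambda>j. \<bar>F j x\<bar> powr p) \<longlonglongrightarrow> \<bar>f x\<bar> powr p" for x
        by (rule tendsto_powr'[OF tendsto_rabs[OF l1] tendsto_const]) (use p in auto)
      show "\<bar>\<bar>F j x\<bar> powr p\<bar> \<le> (M + 1) powr p" for j x using b1[of j x] p by (simp add: powr_mono2)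
    qed (use FK(4,5) p in auto)
    show "(\<lambda>j. weighted_mass a p (F j)) \<longlonglongrightarrow> weighted_mass a p f" if "a > - real CARD('n)" for a
    proof (rule weighted_mass_tendsto[OF that p C1cD(4)[OF F1] C1cD(4)[OF f] l1 _ b1])
      show "F j x = 0" if "norm x > R" for j x using FK(4)[of x j] R[of x] that by (meson not_le)
    qed
  qed
qed

subsection \<open>The Hardy-Sobolev constant\<close>

locale hardy_sobolev_exponents = log_coordinates n \<alpha> dim for n \<alpha> and dim :: "'n::finite itself" +
  fixes p a :: real
  assumes p: "p > 2" "p \<le> 2 * n / (n - 2)" and a_def: "a = p * (n - 2) / 2 - n"
begin

text \<open>\<open>a \<le> 0\<close> is a reformulation of \<open>p \<le> 2 * n / (n - 2)\<close>
  and makes the weight radially nonincreasing; \<open>a > - n\<close> makes it locally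
  integrable.\<close>

lemma exponents: "n \<ge> 3" "a \<le> 0" "a > - n"
proof -
  show n3': "n \<ge> 3" using n3 n_def by simp
  show "a \<le> 0" using p(2) n3' by (simp add: a_def field_simps)
  show "a > - n" using p(1) n3' by (simp add: a_def)
qed

definition admissible :: "real set" where
  "admissible = {C. \<forall>u \<in> test_functions (UNIV :: (real^'n) set). C * weighted_mass a p u powr (2 / p) \<le> dirichlet u}"

lemma S_const_eq: "S_const TYPE('n) p = Sup admissible"
  unfolding S_const_def Let_def admissible_def weighted_mass_def dirichlet_def n_def[symmetric] a_def[symmetric] ..

lemma dirichlet_nonneg: "dirichlet u \<ge> 0"
  unfolding dirichlet_def by (intro Bochner_Integration.integral_nonneg) auto

lemma admissible_0: "0 \<in> admissible"
  by (simp add: admissible_def dirichlet_nonneg)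

text \<open>A function of positive mass bounds \<open>admissible\<close> from above. If the mass
  vanished for all test functions, every real number would be admissible and \<open>Sup\<close>
  would carry no information.\<close>

lemma positive_mass: "\<exists>u \<in> test_functions (UNIV :: (real^'n) set). weighted_mass a p u > 0"
proof
  let ?u = "mollifier 1 :: real^'n \<Rightarrow> real"
  have u: "?u x \<ge> 0" for x by (rule mollifier_nonneg) simp
  have C: "C_k k ?u" for k by (rule C_k_mollifier) simp
  show T: "?u \<in> test_functions UNIV"
    by (rule test_functionsI[OF C compact_cball[of 0 1]]) (auto intro!: mollifier_eq_0)
  have c: "continuous_on UNIV ?u" by (rule mollifier_continuous) simp
  have m: "?u \<in> borel_measurable borel" by (rule borel_measurable_continuous_onI[OF c])
  have "?u \<in> C1c UNIV" using T test_functions_subset_C1c by blast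
  then obtain R M where RM: "\<And>x. norm x > R \<Longrightarrow> ?u x = 0 \<and> grad ?u x = 0" "M > 0" "\<And>x. \<bar>?u x\<bar> \<le> M"
    using C1c_bounds[of ?u] by metis
  have i: "integrable lborel (\<lambda>x. norm x powr a * \<bar>?u x\<bar> powr p)"
    using exponents n_def p RM m by (intro integrable_norm_powr_times[of a _ R "M powr p"]) (auto intro!: powr_mono2)
  have "weighted_mass a p ?u \<noteq> 0"
  proof
    assume "weighted_mass a p ?u = 0"
    then have "AE x in lborel. norm x powr a * \<bar>?u x\<bar> powr p = 0"
      unfolding weighted_mass_def using integral_nonneg_eq_0_iff_AE[OF i] by simp
    then have e: "AE x in lborel. ?u x = 0"
      using AE_norm_pos by eventually_elim auto
    have "(LINT x|lborel. ?u x) = 0" by (rule integral_eq_zero_AE[OF e])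
    then show False using mollifier_integral[of 1, where 'n = 'n] by simp
  qed
  then show "weighted_mass a p ?u > 0" using weighted_mass_nonneg[of a p ?u] by linarith
qed

lemma S_const_properties:
  "bdd_above admissible" "S_const TYPE('n) p \<ge> 0"
  "C > S_const TYPE('n) p \<Longrightarrow> \<exists>u \<in> test_functions (UNIV :: (real^'n) set). dirichlet u < C * weighted_mass a p u powr (2 / p)"
proof -
  obtain u where u: "u \<in> test_functions (UNIV :: (real^'n) set)" "weighted_mass a p u > 0" using positive_mass by blast
  show b: "bdd_above admissible"
  proof (rule bdd_aboveI)
    fix C assume "C \<in> admissible"
    then have "C * weighted_mass a p u powr (2 / p) \<le> dirichlet u" using u(1) by (simp add: admissible_def)
    then show "C \<le> dirichlet u / weighted_mass a p u powr (2 / p)" using u(2) by (simp add: pos_le_divide_eq)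
  qed
  show "S_const TYPE('n) p \<ge> 0" unfolding S_const_eq by (rule cSup_upper[OF admissible_0 b])
  assume "C > S_const TYPE('n) p"
  then have "C \<notin> admissible" using cSup_upper[OF _ b, of C] unfolding S_const_eq by auto
  then show "\<exists>u \<in> test_functions (UNIV :: (real^'n) set). dirichlet u < C * weighted_mass a p u powr (2 / p)"
    unfolding admissible_def by (auto simp: not_le)
qed

text \<open>A test function of positive mass bounds every admissible constant by its quotient, hence
  also their supremum; for zero mass the left-hand side is \<open>0\<close>.\<close>

lemma S_const_test:
  assumes u: "u \<in> test_functions (UNIV :: (real^'n) set)"
  shows "S_const TYPE('n) p * weighted_mass a p u powr (2 / p) \<le> dirichlet u"
proof (cases "weighted_mass a p u powr (2 / p) = 0")
  case False
  then have pos: "weighted_mass a p u powr (2 / p) > 0" by (metis powr_ge_zero less_eq_real_def)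
  have "Sup admissible \<le> dirichlet u / weighted_mass a p u powr (2 / p)"
  proof (rule cSup_least)
    fix C assume "C \<in> admissible"
    then have "C * weighted_mass a p u powr (2 / p) \<le> dirichlet u" using u by (simp add: admissible_def)
    then show "C \<le> dirichlet u / weighted_mass a p u powr (2 / p)" using pos by (simp add: pos_le_divide_eq)
  qed (use admissible_0 in auto)
  then show ?thesis unfolding S_const_eq using pos by (simp add: pos_le_divide_eq)
qed (simp add: dirichlet_nonneg)

lemma S_const_C1c:
  assumes z: "z \<in> C1c (UNIV :: (real^'n) set)"
  shows "S_const TYPE('n) p * weighted_mass a p z powr (2 / p) \<le> dirichlet z"
proof -
  have p0: "p > 0" using p by simp
  obtain F where F: "\<And>j. F j \<in> test_functions (UNIV :: (real^'n) set)"
    "\<And>A. continuous_on UNIV A \<Longrightarrow> (\<lambda>j. LINT x|lborel. A x * (norm (grad (F j) x))\<^sup>2) \<longlonglongrightarrow> (LINT x|lborel. A x * (norm (grad z x))\<^sup>2)"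
    "\<And>a. a > - real CARD('n) \<Longrightarrow> (\<lambda>j. weighted_mass a p (F j)) \<longlonglongrightarrow> weighted_mass a p z"
    by (rule approximation_limits[OF z open_UNIV p0], rule that)
  have "(\<lambda>j. dirichlet (F j)) \<longlonglongrightarrow> dirichlet z" using F(2)[of "\<lambda>_. 1"] by (simp add: dirichlet_def)
  moreover have "(\<lambda>j. weighted_mass a p (F j)) \<longlonglongrightarrow> weighted_mass a p z" using F(3)[of a] exponents n_def by simp
  then have "(\<lambda>j. S_const TYPE('n) p * weighted_mass a p (F j) powr (2 / p)) \<longlonglongrightarrow> S_const TYPE('n) p * weighted_mass a p z powr (2 / p)"
    using p0 by (intro tendsto_mult tendsto_const tendsto_powr') (auto simp: weighted_mass_nonneg)
  ultimately show ?thesis using S_const_test[OF F(1)] by (intro LIMSEQ_le[of _ _ "\<lambda>j. dirichlet (F j)"]) auto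
qed

subsection \<open>The inequality\<close>

text \<open>The factor \<open>n - 2\<close> of the mass enters with the power 2 / p, and - (p + 2) /
  p + 2 / p = - 1 leaves the factor \<open>1 / (n - 2)\<close> that belongs to the energy.\<close>

lemma constant_identity:
  assumes "W \<ge> 0"
  shows "(n - 2) powr (- (p + 2) / p) * S * ((n - 2) * W) powr (2 / p) = S * W powr (2 / p) / (n - 2)"
proof -
  have n2: "n - 2 > 0" using exponents by simp
  have "(n - 2) powr (- (p + 2) / p) * (n - 2) powr (2 / p) = (n - 2) powr (- (p + 2) / p + 2 / p)"
    by (rule powr_add[symmetric])
  also have "- (p + 2) / p + 2 / p = - 1" using p by (simp add: field_simps)
  also have "(n - 2) powr (- 1) = 1 / (n - 2)" using n2 by (simp add: powr_minus divide_inverse)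
  finally have e: "(n - 2) powr (- (p + 2) / p) * (n - 2) powr (2 / p) = 1 / (n - 2)" .
  have "(n - 2) powr (- (p + 2) / p) * S * ((n - 2) * W) powr (2 / p)
     = ((n - 2) powr (- (p + 2) / p) * (n - 2) powr (2 / p)) * S * W powr (2 / p)"
    using n2 assms by (simp add: powr_mult)
  then show ?thesis unfolding e by simp
qed

text \<open>With support away from the origin both substitutions are available. The estimate is a
  chain: exact change of the mass, \<open>S_const_C1c\<close> for the Euclidean function, then the
  inequality that discards the excess angular energy.\<close>

lemma hardy_sobolev_punctured:
  assumes u: "u \<in> C1c (ball 0 1 - {0} :: (real^'n) set)"
  shows "(n - 2) powr (- (p + 2) / p) * S_const TYPE('n) p * weighted_term p \<alpha> 0 u \<le> hardy_energy 0 u"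
proof -
  define w where "w = (\<lambda>x. u x * (conf_factor x * norm x) powr ((n - 2) / 2))"
  note G = ground_state(1,2)[OF u n_def, folded w_def]
  have G3: "weighted_term p \<alpha> 0 u = (LINT x|lborel. norm x powr (- n) * X (\<alpha> * norm x) powr ((p + 2) / 2) * \<bar>w x\<bar> powr p) powr (2 / p)"
    unfolding w_def by (rule ground_state(3)[OF u n_def])
  obtain z where z: "z \<in> C1c \<Omega>'" "w = pull z" using pull_surj[OF G(1)] .
  have zU: "z \<in> C1c UNIV" using z(1) C1c_subset by blast
  have p0: "p > 0" using p by simp
  have n2: "n - 2 > 0" using exponents by simp
  have "weighted_term p \<alpha> 0 u = ((n - 2) * weighted_mass a p z) powr (2 / p)"
    unfolding G3 z(2) a_def mass_pull[OF z(1) p0] ..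
  then have "(n - 2) powr (- (p + 2) / p) * S_const TYPE('n) p * weighted_term p \<alpha> 0 u
     = S_const TYPE('n) p * weighted_mass a p z powr (2 / p) / (n - 2)"
    by (simp only: constant_identity weighted_mass_nonneg)
  also have "\<dots> \<le> dirichlet z / (n - 2)" using S_const_C1c[OF zU] n2 by (intro divide_right_mono) auto
  also have "\<dots> \<le> hardy_energy 0 u" unfolding G(2) z(2) by (rule energy_pull_ge[OF z(1)])
  finally show ?thesis .
qed

text \<open>Removes the restriction on the support. Cutting off near the origin costs gradients of
  size 1 / norm x, whose square is locally integrable in dimension at least three, so every term of
  the inequality passes to the limit.\<close>

lemma cutoff_limits_energy:
  assumes u: "u \<in> C1c (ball 0 1 :: (real^'n) set)"
  obtains V where "\<And>j. V j \<in> C1c (ball 0 1 - {0} :: (real^'n) set)" "(\<lambda>j. hardy_energy 0 (V j)) \<longlonglongrightarrow> hardy_energy 0 u"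
    "(\<lambda>j. weighted_term p \<alpha> 0 (V j)) \<longlonglongrightarrow> weighted_term p \<alpha> 0 u"
proof -
  obtain V K M where V: "compact K" "K \<subseteq> ball (0::real^'n) 1" "M > 0" "\<And>j. V j \<in> C1c (ball 0 1 - {0})"
    "\<And>j x. x \<notin> K \<Longrightarrow> V j x = 0 \<and> grad (V j) x = 0" "\<And>x. x \<notin> K \<Longrightarrow> u x = 0 \<and> grad u x = 0"
    "\<And>j x. \<bar>V j x\<bar> \<le> M" "\<And>x. x \<noteq> 0 \<Longrightarrow> (\<lambda>j. V j x) \<longlonglongrightarrow> u x"
    "\<And>x. x \<noteq> 0 \<Longrightarrow> (\<lambda>j. grad (V j) x) \<longlonglongrightarrow> grad u x"
    "\<And>j x. x \<noteq> 0 \<Longrightarrow> (norm (grad (V j) x))\<^sup>2 \<le> M * norm x powr (-2)"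
    by (rule cutoff_approximation[OF u open_ball], rule that)
  note [measurable] = C1cD(4,5)[OF u] C1cD(4,5)[OF V(4)]
  have p0: "p > 0" using p by simp
  have nn: "- 2 > - real CARD('n)" "0 > - real CARD('n)" "a > - real CARD('n)" using exponents n_def by auto
  have "compact (conf_factor ` K)" using V(1,2) continuous_on_conf_factor
    by (intro compact_continuous_image) (auto intro: continuous_on_subset)
  then obtain B where "B > 0" and B: "\<And>x. x \<in> K \<Longrightarrow> \<bar>conf_factor x\<bar> \<le> B"
    by (auto simp: bounded_pos dest!: compact_imp_bounded)
  have cf: "1 \<le> conf_factor x" "conf_factor x ^ CARD('n) \<le> B ^ CARD('n)" "norm x < 1" if "x \<in> K" for x
  proof -
    show x1: "norm x < 1" using that V(2) by auto
    then have "(norm x)\<^sup>2 < 1" by (simp add: abs_square_less_1)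
    then show c1: "1 \<le> conf_factor x" by (auto simp: conf_factor_def intro: order_trans[of _ 0])
    show "conf_factor x ^ CARD('n) \<le> B ^ CARD('n)" using B[OF that] c1 by (intro power_mono) auto
  qed
  have B0: "B ^ CARD('n) \<ge> 0" using \<open>B > 0\<close> by simp
  \<comment> \<open>On the common compact support the volume density is bounded, so a majorant
    \<open>D * norm x powr b\<close> suffices. The exponent is \<open>- 2\<close> for the gradient
    and the Hardy term, \<open>0\<close> for the square and \<open>a\<close> for the weighted
    term.\<close>
  have L: "(\<lambda>j. LINT x|hyp_volume. G j x) \<longlonglongrightarrow> (LINT x|hyp_volume. g x)"
    if m: "\<And>j. G j \<in> borel_measurable borel" "g \<in> borel_measurable borel" and l: "\<And>x. x \<noteq> 0 \<Longrightarrow> (\<lambda>j. G j x) \<longlonglongrightarrow> g x"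
      and bb: "b > - real CARD('n)" and D: "D \<ge> 0" "\<And>j x. x \<in> K \<Longrightarrow> x \<noteq> 0 \<Longrightarrow> \<bar>G j x\<bar> \<le> D * norm x powr b"
      and z: "\<And>j x. x \<notin> K \<Longrightarrow> G j x = 0" for G and g :: "real^'n \<Rightarrow> real" and b D
    unfolding integral_hyp_volume[OF m(1)] integral_hyp_volume[OF m(2)]
  proof (rule tendsto_integral_powr[OF _ _ _ bb, where R = 1 and B = "B ^ CARD('n) * D"])
    have meas: "(\<lambda>x. indicator (ball 0 1) x * (conf_factor x ^ CARD('n) * h x)) \<in> borel_measurable borel"
      if "h \<in> borel_measurable borel" for h :: "real^'n \<Rightarrow> real"
      by (intro borel_measurable_times borel_measurable_indicator borel_open borel_measurable_power conf_factor_measurable that open_ball)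
    show "(\<lambda>x. indicator (ball 0 1) x * (conf_factor x ^ CARD('n) * G j x)) \<in> borel_measurable borel" for j by (rule meas[OF m(1)])
    show "(\<lambda>x. indicator (ball 0 1) x * (conf_factor x ^ CARD('n) * g x)) \<in> borel_measurable borel" by (rule meas[OF m(2)])
    show "(\<lambda>j. indicator (ball 0 1) x * (conf_factor x ^ CARD('n) * G j x)) \<longlonglongrightarrow> indicator (ball 0 1) x * (conf_factor x ^ CARD('n) * g x)" if "x \<noteq> 0" for x
      by (intro tendsto_intros l that)
    show "\<bar>indicator (ball 0 1) x * (conf_factor x ^ CARD('n) * G j x)\<bar> \<le> B ^ CARD('n) * D * norm x powr b" if "x \<noteq> 0" for j x
    proof (cases "x \<in> K")
      case True
      have "conf_factor x ^ CARD('n) * \<bar>G j x\<bar> \<le> B ^ CARD('n) * (D * norm x powr b)"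
        using cf[OF True] D(2)[OF True that] B0 by (intro mult_mono) auto
      then show ?thesis using cf[OF True] by (simp add: abs_mult mult.assoc)
    qed (use z D B0 in simp)
    show "indicator (ball 0 1) x * (conf_factor x ^ CARD('n) * G j x) = 0" if "norm x > 1" for j x
      using that by simp
  qed
  have e1: "(\<lambda>j. LINT x|hyp_volume. (hyp_norm x (hyp_grad (V j) x))\<^sup>2) \<longlonglongrightarrow> (LINT x|hyp_volume. (hyp_norm x (hyp_grad u x))\<^sup>2)"
  proof (rule L[OF _ _ _ nn(1), where D = M])
    show "(\<lambda>x. (hyp_norm x (hyp_grad (V j) x))\<^sup>2) \<in> borel_measurable borel" for j
      unfolding hyp_norm_def hyp_grad_def by measurable
    show "(\<lambda>x. (hyp_norm x (hyp_grad u x))\<^sup>2) \<in> borel_measurable borel"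
      unfolding hyp_norm_def hyp_grad_def by measurable
    show "(\<lambda>j. (hyp_norm x (hyp_grad (V j) x))\<^sup>2) \<longlonglongrightarrow> (hyp_norm x (hyp_grad u x))\<^sup>2" if "x \<noteq> 0" for x
      unfolding hyp_norm_def hyp_grad_def by (intro tendsto_intros V(9)[OF that])
    show "\<bar>(hyp_norm x (hyp_grad (V j) x))\<^sup>2\<bar> \<le> M * norm x powr - 2" if "x \<in> K" "x \<noteq> 0" for j x
    proof -
      have "hyp_norm x (hyp_grad (V j) x) = norm (grad (V j) x) / conf_factor x"
        using cf(1)[OF that(1)] by (simp add: hyp_norm_def hyp_grad_def power2_eq_square)
      moreover have "norm (grad (V j) x) / conf_factor x \<le> norm (grad (V j) x)"
        using cf(1)[OF that(1)] by (simp add: divide_le_eq mult_le_cancel_left1)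
      ultimately have "(hyp_norm x (hyp_grad (V j) x))\<^sup>2 \<le> (norm (grad (V j) x))\<^sup>2"
        using cf(1)[OF that(1)] by (intro power_mono) auto
      then show ?thesis using V(10)[OF that(2), of j] by simp
    qed
    show "(hyp_norm x (hyp_grad (V j) x))\<^sup>2 = 0" if "x \<notin> K" for j x using V(5)[OF that] by (simp add: hyp_norm_def hyp_grad_def)
  qed (use V(3) in simp)
  have sq: "(V j x)\<^sup>2 \<le> M\<^sup>2" for j x using power_mono[OF V(7)[of j x] abs_ge_zero, of 2] by simp
  have e2: "(\<lambda>j. LINT x|hyp_volume. (V j x)\<^sup>2) \<longlonglongrightarrow> (LINT x|hyp_volume. (u x)\<^sup>2)"
  proof (rule L[OF _ _ _ nn(2), where D = "M\<^sup>2"])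
    show "(\<lambda>j. (V j x)\<^sup>2) \<longlonglongrightarrow> (u x)\<^sup>2" if "x \<noteq> 0" for x by (intro tendsto_intros V(8)[OF that])
  qed (use sq V(5) in auto)
  have e3: "(\<lambda>j. LINT x|hyp_volume. (V j x)\<^sup>2 / (sinh (hyp_dist x 0))\<^sup>2) \<longlonglongrightarrow> (LINT x|hyp_volume. (u x)\<^sup>2 / (sinh (hyp_dist x 0))\<^sup>2)"
  proof (rule L[OF _ _ _ nn(1), where D = "M\<^sup>2"])
    show "(\<lambda>j. (V j x)\<^sup>2 / (sinh (hyp_dist x 0))\<^sup>2) \<longlonglongrightarrow> (u x)\<^sup>2 / (sinh (hyp_dist x 0))\<^sup>2" if "x \<noteq> 0" for x
      unfolding divide_inverse by (intro tendsto_intros V(8)[OF that])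
    show "\<bar>(V j x)\<^sup>2 / (sinh (hyp_dist x 0))\<^sup>2\<bar> \<le> M\<^sup>2 * norm x powr - 2" if "x \<in> K" "x \<noteq> 0" for j x
    proof -
      have "norm x * 1 \<le> norm x * conf_factor x" using cf(1)[OF that(1)] by (intro mult_left_mono) auto
      then have "(norm x)\<^sup>2 \<le> (sinh (hyp_dist x 0))\<^sup>2"
        unfolding sinh_hyp_dist_0[OF cf(3)[OF that(1)]] by (intro power_mono) (simp_all add: mult.commute)
      then have "(V j x)\<^sup>2 / (sinh (hyp_dist x 0))\<^sup>2 \<le> M\<^sup>2 / (norm x)\<^sup>2"
        using sq that(2) by (intro frac_le) auto
      then show ?thesis using that(2) by (simp add: powr_minus divide_inverse)
    qed
  qed (use V(5) in auto)
  show thesis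
  proof (rule that[OF V(4)])
    show "(\<lambda>j. hardy_energy 0 (V j)) \<longlonglongrightarrow> hardy_energy 0 u"
      unfolding hardy_energy_def Let_def by (intro tendsto_intros e1 e2 e3)
    have "(\<lambda>j. LINT x|hyp_volume. sinh (hyp_dist x 0) powr a * X (\<alpha> * tanh (hyp_dist x 0 / 2)) powr ((p + 2) / 2) * \<bar>V j x\<bar> powr p)
       \<longlonglongrightarrow> (LINT x|hyp_volume. sinh (hyp_dist x 0) powr a * X (\<alpha> * tanh (hyp_dist x 0 / 2)) powr ((p + 2) / 2) * \<bar>u x\<bar> powr p)"
    proof (rule L[OF _ _ _ nn(3), where D = "(n - 2) powr ((p + 2) / 2) * M powr p"])
      show "(\<lambda>j. sinh (hyp_dist x 0) powr a * X (\<alpha> * tanh (hyp_dist x 0 / 2)) powr ((p + 2) / 2) * \<bar>V j x\<bar> powr p)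
        \<longlonglongrightarrow> sinh (hyp_dist x 0) powr a * X (\<alpha> * tanh (hyp_dist x 0 / 2)) powr ((p + 2) / 2) * \<bar>u x\<bar> powr p" if "x \<noteq> 0" for x
      proof (intro tendsto_mult tendsto_const)
        show "(\<lambda>j. \<bar>V j x\<bar> powr p) \<longlonglongrightarrow> \<bar>u x\<bar> powr p"
          by (rule tendsto_powr'[OF tendsto_rabs[OF V(8)[OF that]] tendsto_const]) (use p0 in auto)
      qed
      show "\<bar>sinh (hyp_dist x 0) powr a * X (\<alpha> * tanh (hyp_dist x 0 / 2)) powr ((p + 2) / 2) * \<bar>V j x\<bar> powr p\<bar>
        \<le> (n - 2) powr ((p + 2) / 2) * M powr p * norm x powr a" if x: "x \<in> K" "x \<noteq> 0" for j x
      proof -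
        have 1: "\<bar>V j x\<bar> powr p \<le> M powr p" using V(7)[of j x] p0 by (intro powr_mono2) auto
        have 2: "X (\<alpha> * norm x) powr ((p + 2) / 2) \<le> (n - 2) powr ((p + 2) / 2)"
          using X_bounds[of "norm x"] x cf(3)[OF x(1)] p0 by (intro powr_mono2) auto
        \<comment> \<open>\<open>sinh\<close> of the distance is at least \<open>norm x\<close>, and
          \<open>a \<le> 0\<close> reverses the comparison for the powers.\<close>
        have "norm x * 1 \<le> conf_factor x * norm x" using cf(1)[OF x(1)] mult_right_mono[of 1 "conf_factor x" "norm x"] by simp
        then have 3: "(conf_factor x * norm x) powr a \<le> norm x powr a"
          using x exponents by (intro powr_antimono) auto
        have "(conf_factor x * norm x) powr a * X (\<alpha> * norm x) powr ((p + 2) / 2) * \<bar>V j x\<bar> powr p \<le> norm x powr a * (n - 2) powr ((p + 2) / 2) * M powr p"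
          by (intro mult_mono 1 2 3) auto
        then show ?thesis
          unfolding sinh_hyp_dist_0[OF cf(3)[OF x(1)]] tanh_hyp_dist_0[OF cf(3)[OF x(1)]] by (simp add: abs_mult mult_ac)
      qed
    qed (use V(5) p0 in auto)
    then show "(\<lambda>j. weighted_term p \<alpha> 0 (V j)) \<longlonglongrightarrow> weighted_term p \<alpha> 0 u"
      unfolding weighted_term_def Let_def n_def[symmetric] a_def[symmetric] using p0
      by (intro tendsto_powr') (auto intro!: always_eventually Bochner_Integration.integral_nonneg)
  qed
qed

lemma hardy_sobolev_origin:
  assumes u: "u \<in> C1c (ball 0 1 :: (real^'n) set)"
  shows "(n - 2) powr (- (p + 2) / p) * S_const TYPE('n) p * weighted_term p \<alpha> 0 u \<le> hardy_energy 0 u"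
proof -
  obtain V where V: "\<And>j. V j \<in> C1c (ball 0 1 - {0} :: (real^'n) set)" "(\<lambda>j. hardy_energy 0 (V j)) \<longlonglongrightarrow> hardy_energy 0 u"
    "(\<lambda>j. weighted_term p \<alpha> 0 (V j)) \<longlonglongrightarrow> weighted_term p \<alpha> 0 u"
    by (rule cutoff_limits_energy[OF u], rule that)
  show ?thesis
    by (rule LIMSEQ_le[OF tendsto_mult[OF tendsto_const V(3)] V(2)]) (use hardy_sobolev_punctured[OF V(1)] in auto)
qed

lemma hardy_sobolev:
  assumes x0: "x0 \<in> hyp_space" and u: "u \<in> test_functions (hyp_space :: (real^'n) set)"
  shows "(n - 2) powr (- (p + 2) / p) * S_const TYPE('n) p * weighted_term p \<alpha> x0 u \<le> hardy_energy x0 u"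
proof -
  have uC: "u \<in> C1c (ball 0 1)" using u test_functions_subset_C1c by (auto simp: hyp_space_def)
  show ?thesis
  proof (cases "x0 = 0")
    case True
    then show ?thesis using hardy_sobolev_origin[OF uC] by simp
  next
    case False
    then interpret sphere_inversion x0 using x0 by unfold_locales (auto simp: hyp_space_def)
    have "transport u \<in> C1c (ball 0 1)" using transport_C1c(1)[of u "{}" "{}"] uC by simp
    from hardy_sobolev_origin[OF this] show ?thesis unfolding transport_energies[OF uC] .
  qed
qed

end

subsection \<open>Sharpness\<close>

context hardy_sobolev_exponents
begin

text \<open>A test function violating the Euclidean inequality with the larger constant
  \<open>C\<close> is made radial and then multiplied by a radial cutoff near the origin; the strict
  inequality survives both steps.\<close>

lemma radial_near_optimizer:
  assumes C: "C > S_const TYPE('n) p"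
  obtains V where "V \<in> C1c (UNIV - {0} :: (real^'n) set)" "\<And>x y. norm x = norm y \<Longrightarrow> V x = V y"
    "dirichlet V < C * weighted_mass a p V powr (2 / p)"
proof -
  have p0: "p > 0" using p by simp
  have C0: "C \<ge> 0" using S_const_properties(2) C by linarith
  have nn: "- 2 > - real CARD('n)" "a > - real CARD('n)" using exponents n_def n3 by auto
  obtain u where u: "u \<in> test_functions (UNIV :: (real^'n) set)" "dirichlet u < C * weighted_mass a p u powr (2 / p)"
    using S_const_properties(3)[OF C] by blast
  have uC: "u \<in> C1c UNIV" using u(1) test_functions_subset_C1c by blast
  have q: "2 / p > 0" using p0 by simp
  obtain v where v: "v \<in> C1c (UNIV :: (real^'n) set)" "\<And>x y. norm x = norm y \<Longrightarrow> v x = v y"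
    "dirichlet v < C * weighted_mass a p v powr (2 / p)"
    by (rule radial_competitor[OF uC exponents(2) nn(2) p0 q u(2) C0], rule that)
  obtain V K M where V: "compact K" "K \<subseteq> (UNIV :: (real^'n) set)" "M > 0" "\<And>j. V j \<in> C1c (UNIV - {0})"
    "\<And>j x. x \<notin> K \<Longrightarrow> V j x = 0 \<and> grad (V j) x = 0" "\<And>x. x \<notin> K \<Longrightarrow> v x = 0 \<and> grad v x = 0"
    "\<And>j x. \<bar>V j x\<bar> \<le> M" "\<And>x. x \<noteq> 0 \<Longrightarrow> (\<lambda>j. V j x) \<longlonglongrightarrow> v x"
    "\<And>x. x \<noteq> 0 \<Longrightarrow> (\<lambda>j. grad (V j) x) \<longlonglongrightarrow> grad v x"
    "\<And>j x. x \<noteq> 0 \<Longrightarrow> (norm (grad (V j) x))\<^sup>2 \<le> M * norm x powr (-2)"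
    "(\<forall>x y. norm x = norm y \<longrightarrow> v x = v y) \<Longrightarrow> (\<forall>j x y. norm x = norm y \<longrightarrow> V j x = V j y)"
    by (rule cutoff_approximation[OF v(1) open_UNIV], rule that)
  note [measurable] = C1cD(4,5)[OF v(1)] C1cD(4,5)[OF V(4)]
  obtain R where R: "\<And>x. x \<in> K \<Longrightarrow> norm x \<le> R" using compact_imp_bounded[OF V(1)] bounded_iff by blast
  have out: "V j x = 0" "grad (V j) x = 0" if "norm x > R" for j x using V(5)[of x j] R[of x] that by force+
  have d: "(\<lambda>j. dirichlet (V j)) \<longlonglongrightarrow> dirichlet v"
    unfolding dirichlet_def
  proof (rule tendsto_integral_powr[OF _ _ _ nn(1), where B = M and R = R])
    show "(\<lambda>j. (norm (grad (V j) x))\<^sup>2) \<longlonglongrightarrow> (norm (grad v x))\<^sup>2" if "x \<noteq> 0" for x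
      by (intro tendsto_intros V(9)[OF that])
  qed (use V(10) out in auto)
  have w: "(\<lambda>j. weighted_mass a p (V j)) \<longlonglongrightarrow> weighted_mass a p v"
    unfolding weighted_mass_def
  proof (rule tendsto_integral_powr[OF _ _ _ nn(2), where B = "M powr p" and R = R])
    show "(\<lambda>j. norm x powr a * \<bar>V j x\<bar> powr p) \<longlonglongrightarrow> norm x powr a * \<bar>v x\<bar> powr p" if "x \<noteq> 0" for x
      by (intro tendsto_mult tendsto_const tendsto_powr'[OF tendsto_rabs[OF V(8)[OF that]] tendsto_const]) (use p0 in auto)
    show "\<bar>norm x powr a * \<bar>V j x\<bar> powr p\<bar> \<le> M powr p * norm x powr a" for j x
    proof -
      have "\<bar>V j x\<bar> powr p \<le> M powr p" using V(7)[of j x] p0 by (intro powr_mono2) auto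
      then show ?thesis by (simp add: abs_mult mult.commute[of "M powr p"] mult_left_mono)
    qed
  qed (use out p0 in auto)
  have "(\<lambda>j. weighted_mass a p (V j) powr (2 / p)) \<longlonglongrightarrow> weighted_mass a p v powr (2 / p)"
    by (rule tendsto_powr'[OF w tendsto_const]) (simp add: weighted_mass_nonneg p0)
  from tendsto_diff[OF tendsto_mult[OF tendsto_const[of C] this] d]
  have "(\<lambda>j. C * weighted_mass a p (V j) powr (2 / p) - dirichlet (V j)) \<longlonglongrightarrow> C * weighted_mass a p v powr (2 / p) - dirichlet v"
    .
  then have "eventually (\<lambda>j. C * weighted_mass a p (V j) powr (2 / p) - dirichlet (V j) > 0) sequentially"
    by (rule order_tendstoD) (use v(3) in simp)
  then obtain j where "C * weighted_mass a p (V j) powr (2 / p) - dirichlet (V j) > 0"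
    unfolding eventually_sequentially by blast
  then have lt: "dirichlet (V j) < C * weighted_mass a p (V j) powr (2 / p)" by simp
  have "\<forall>x y. norm x = norm y \<longrightarrow> v x = v y" by (intro allI impI v(2))
  note rad = V(11)[OF this]
  have "V j x = V j y" if "norm x = norm y" for x y by (rule rad[rule_format, OF that])
  from that[OF V(4) this lt] show thesis .
qed

text \<open>Under dilation both sides scale with the same power \<open>2 - n\<close> of the factor,
  so the support can be shrunk into the image of the unit ball.\<close>

lemma near_optimizer_small_support:
  assumes C: "C > S_const TYPE('n) p"
  obtains z where "z \<in> C1c \<Omega>'" "\<And>x y. norm x = norm y \<Longrightarrow> z x = z y"
    "dirichlet z < C * weighted_mass a p z powr (2 / p)"
proof -
  have p0: "p > 0" using p by simp
  obtain V where V: "V \<in> C1c (UNIV - {0} :: (real^'n) set)" "\<And>x y. norm x = norm y \<Longrightarrow> V x = V y"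
    "dirichlet V < C * weighted_mass a p V powr (2 / p)"
    by (rule radial_near_optimizer[OF C], rule that)
  obtain K where K: "compact K" "K \<subseteq> UNIV - {0}" "\<And>x. x \<notin> K \<Longrightarrow> V x = 0" using C1c_support[OF V(1)] by blast
  obtain R where R: "R > 0" "\<And>x. x \<in> K \<Longrightarrow> norm x \<le> R" using compact_imp_bounded[OF K(1)] bounded_pos by blast
  have s1: "s 1 > 0" by (rule s_pos) auto
  \<comment> \<open>The factor 2 places the rescaled support within radius \<open>s 1 / 2\<close>,
    strictly inside the ball of \<open>\<Omega>'\<close>.\<close>
  define \<kappa> where "\<kappa> = 2 * R / s 1"
  have \<kappa>: "\<kappa> > 0" using R(1) s1 by (simp add: \<kappa>_def)
  define z where "z y = V (\<kappa> *\<^sub>R y)" for y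
  have dz: "(z has_derivative (\<lambda>h. (\<kappa> *\<^sub>R grad V (\<kappa> *\<^sub>R y)) \<bullet> h)) (at y)" for y
  proof -
    have "((\<lambda>y. \<kappa> *\<^sub>R y) has_derivative (\<lambda>h. \<kappa> *\<^sub>R h)) (at y)" by (auto intro!: derivative_eq_intros)
    from has_derivative_compose[OF this C1cD(1)[OF V(1), of "\<kappa> *\<^sub>R y"]] show ?thesis by (simp add: z_def[abs_def])
  qed
  have gz: "grad z y = \<kappa> *\<^sub>R grad V (\<kappa> *\<^sub>R y)" for y by (rule grad_eqI[OF dz])
  have z: "z \<in> C1c \<Omega>'"
  proof (rule C1cI[OF dz])
    show "continuous_on UNIV (\<lambda>y. \<kappa> *\<^sub>R grad V (\<kappa> *\<^sub>R y))"
      by (intro continuous_on_scaleR continuous_on_const continuous_on_compose2[OF C1cD(2)[OF V(1)]] continuous_on_id) auto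
    show "compact ((\<lambda>x. (1 / \<kappa>) *\<^sub>R x) ` K)" by (rule compact_scaling[OF K(1)])
    show "(\<lambda>x. (1 / \<kappa>) *\<^sub>R x) ` K \<subseteq> \<Omega>'"
    proof
      fix y assume "y \<in> (\<lambda>x. (1 / \<kappa>) *\<^sub>R x) ` K"
      then obtain x where x: "x \<in> K" "y = (1 / \<kappa>) *\<^sub>R x" by blast
      have "norm y \<le> R / \<kappa>" using R(2)[OF x(1)] \<kappa> unfolding x(2) by (simp add: divide_right_mono)
      also have "R / \<kappa> < s 1" using R(1) s1 by (simp add: \<kappa>_def)
      finally show "y \<in> \<Omega>'" using x K(2) \<kappa> by auto
    qed
    show "z y = 0" if "y \<notin> (\<lambda>x. (1 / \<kappa>) *\<^sub>R x) ` K" for y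
    proof -
      have "y = (1 / \<kappa>) *\<^sub>R (\<kappa> *\<^sub>R y)" using \<kappa> by simp
      then have "\<kappa> *\<^sub>R y \<notin> K" using that by blast
      then show ?thesis unfolding z_def by (rule K(3))
    qed
  qed
  note [measurable] = C1cD(4,5)[OF V(1)]
  have N: "\<bar>\<kappa>\<bar> ^ DIM(real^'n) = \<kappa> powr n" using \<kappa> by (simp add: n_def powr_realpow)
  have \<kappa>0: "\<kappa> \<noteq> 0" using \<kappa> by simp
  have "dirichlet V = \<kappa> powr n * (LINT x|lborel. (norm (grad V (0 + \<kappa> *\<^sub>R x)))\<^sup>2)"
    unfolding dirichlet_def N[symmetric] by (rule integral_affine[OF _ \<kappa>0]) measurable
  moreover have "dirichlet z = \<kappa> powr 2 * (LINT x|lborel. (norm (grad V (0 + \<kappa> *\<^sub>R x)))\<^sup>2)"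
    unfolding dirichlet_def gz using \<kappa> by (simp add: power_mult_distrib)
  ultimately have D: "dirichlet z = \<kappa> powr (2 - n) * dirichlet V" using \<kappa> by (simp add: powr_diff)
  have "weighted_mass a p V = \<kappa> powr n * (LINT x|lborel. norm (0 + \<kappa> *\<^sub>R x) powr a * \<bar>V (0 + \<kappa> *\<^sub>R x)\<bar> powr p)"
    unfolding weighted_mass_def N[symmetric] by (rule integral_affine[OF _ \<kappa>0]) measurable
  also have "(LINT x|lborel. norm (0 + \<kappa> *\<^sub>R x) powr a * \<bar>V (0 + \<kappa> *\<^sub>R x)\<bar> powr p) = \<kappa> powr a * weighted_mass a p z"
    unfolding weighted_mass_def integral_mult_right_zero[symmetric] z_def using \<kappa> by (simp add: powr_mult mult.assoc)
  finally have "weighted_mass a p V = (\<kappa> powr n * \<kappa> powr a) * weighted_mass a p z" by simp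
  also have "\<kappa> powr n * \<kappa> powr a = \<kappa> powr (p * (n - 2) / 2)" unfolding powr_add[symmetric] a_def by simp
  finally have "weighted_mass a p V powr (2 / p) = \<kappa> powr (p * (n - 2) / 2 * (2 / p)) * weighted_mass a p z powr (2 / p)"
    using weighted_mass_nonneg[of a p z] by (simp add: powr_mult powr_powr)
  also have "p * (n - 2) / 2 * (2 / p) = n - 2" using p0 by simp
  finally have W: "weighted_mass a p z powr (2 / p) = \<kappa> powr (2 - n) * weighted_mass a p V powr (2 / p)"
    using \<kappa> by (simp add: powr_diff)
  show thesis
  proof (rule that[OF z])
    show "z x = z y" if "norm x = norm y" for x y unfolding z_def using that by (intro V(2)) simp
    have "\<kappa> powr (2 - n) * dirichlet V < \<kappa> powr (2 - n) * (C * weighted_mass a p V powr (2 / p))"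
      using V(3) \<kappa> by (intro mult_strict_left_mono) auto
    then show "dirichlet z < C * weighted_mass a p z powr (2 / p)" unfolding D W by (simp add: mult_ac)
  qed
qed

text \<open>The substitutions are run backwards: the radial near-optimizer is pulled back to the
  unit ball and multiplied by the ground state. By radiality the energy estimate of the inequality
  is an equality here.\<close>

lemma near_optimizer_origin:
  assumes C: "C > (n - 2) powr (- (p + 2) / p) * S_const TYPE('n) p"
  obtains u where "u \<in> C1c (ball 0 1 - {0} :: (real^'n) set)" "hardy_energy 0 u < C * weighted_term p \<alpha> 0 u"
proof -
  have p0: "p > 0" using p by simp
  have n2: "n - 2 > 0" using exponents by simp
  define k where "k = (n - 2) powr (- (p + 2) / p)"
  have k: "k > 0" using n2 by (simp add: k_def)
  have Ck: "C / k > S_const TYPE('n) p" using C k unfolding k_def[symmetric] by (simp add: pos_less_divide_eq mult.commute)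
 obtain z where z: "z \<in> C1c \<Omega>'" "\<And>x y. norm x = norm y \<Longrightarrow> z x = z y"
    "dirichlet z < C / k * weighted_mass a p z powr (2 / p)"
    by (rule near_optimizer_small_support[OF Ck], rule that)
  define u where "u = (\<lambda>x. pull z x * (conf_factor x * norm x) powr (- ((n - 2) / 2)))"
  have op: "open (ball 0 1 - {0} :: (real^'n) set)" by auto
  have u: "u \<in> C1c (ball 0 1 - {0})"
    unfolding u_def by (rule C1c_mult(1)[OF pull_C1c(1)[OF z(1)] op conf_norm_powr_derivative])
  have w: "(\<lambda>x. u x * (conf_factor x * norm x) powr ((n - 2) / 2)) = pull z"
  proof
    fix x show "u x * (conf_factor x * norm x) powr ((n - 2) / 2) = pull z x"
    proof (cases "x \<in> \<Omega>")
      case True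
      define b where "b = conf_factor x * norm x"
      have "b > 0" using True conf_factor_pos[of x] by (auto simp: b_def)
      then show ?thesis unfolding u_def b_def[symmetric] by (simp add: powr_minus)
    next
      case False
      then have "pull z x = 0" unfolding pull_def by (rule if_not_P)
      then show ?thesis by (simp add: u_def)
    qed
  qed
  note G = ground_state[OF u n_def]
  have w': "u x * (conf_factor x * norm x) powr ((n - 2) / 2) = pull z x" for x using w by (rule fun_cong)
  have "hardy_energy 0 u = dirichlet z / (n - 2)"
    unfolding G(2) w by (rule energy_pull_radial[OF z(1,2)])
  also have "\<dots> < C / k * weighted_mass a p z powr (2 / p) / (n - 2)"
    using z(3) n2 by (rule divide_strict_right_mono)
  also have "\<dots> = k * (C / k) * ((n - 2) * weighted_mass a p z) powr (2 / p)"
    unfolding k_def by (rule constant_identity[symmetric, OF weighted_mass_nonneg])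
  also have "\<dots> = C * weighted_term p \<alpha> 0 u"
    unfolding G(3) w' a_def mass_pull[OF z(1) p0] using k by simp
  finally show thesis using that[OF u] by blast
qed

lemma hyp_distance_off_center:
  fixes x0 :: "real^'n"
  assumes x0: "norm x0 < 1"
  shows "continuous_on (ball 0 1) (\<lambda>x. hyp_dist x x0)"
    "x \<in> ball 0 1 - {x0} \<Longrightarrow> hyp_dist x x0 > 0"
proof -
  define h where "h x = 1 + 2 * (norm (x - x0))\<^sup>2 / ((1 - (norm x)\<^sup>2) * (1 - (norm x0)\<^sup>2))" for x
  have e: "(\<lambda>x. hyp_dist x x0) = (\<lambda>x. arcosh (h x))" by (simp add: hyp_dist_def h_def)
  have pos: "(1 - (norm x)\<^sup>2) * (1 - (norm x0)\<^sup>2) > 0" if "x \<in> ball 0 1" for x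
    using that x0 by (intro mult_pos_pos) (simp_all add: abs_square_less_1)
  have h1: "h x \<ge> 1" if "x \<in> ball 0 1" for x
    using pos[OF that] unfolding h_def by (simp add: less_imp_le)
  have "continuous_on (ball 0 1) h"
    unfolding h_def by (intro continuous_intros) (use pos in force)
  then show "continuous_on (ball 0 1) (\<lambda>x. hyp_dist x x0)"
    unfolding e by (intro continuous_on_compose2[OF continuous_on_arcosh[OF order.refl]]) (use h1 in auto)
  assume x: "x \<in> ball 0 1 - {x0}"
  then have "2 * (norm (x - x0))\<^sup>2 / ((1 - (norm x)\<^sup>2) * (1 - (norm x0)\<^sup>2)) > 0"
    using pos[of x] by (intro divide_pos_pos) auto
  then have "h x \<noteq> 1" unfolding h_def by linarith
  then have "arcosh (h x) > 0" using h1[of x] x by simp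
  then show "hyp_dist x x0 > 0" unfolding h_def hyp_dist_def .
qed

text \<open>Near-optimizers are only of class C1 and have to be replaced by smooth functions.
  Because \<open>f\<close> vanishes near \<open>x0\<close>, all weights, including the singular
  ones, are continuous on the set \<open>\<Gamma>\<close> that carries the supports.\<close>

lemma energy_approximation:
  assumes x0: "x0 \<in> hyp_space" and f: "f \<in> C1c (ball 0 1 - {x0} :: (real^'n) set)"
  obtains F where "\<And>j. F j \<in> test_functions (hyp_space :: (real^'n) set)"
    "(\<lambda>j. hardy_energy x0 (F j)) \<longlonglongrightarrow> hardy_energy x0 f" "(\<lambda>j. weighted_term p \<alpha> x0 (F j)) \<longlonglongrightarrow> weighted_term p \<alpha> x0 f"
proof -
  define \<Gamma> where "\<Gamma> = ball 0 1 - {x0}"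
  have p0: "p > 0" using p by simp
  have op: "open \<Gamma>" by (auto simp: \<Gamma>_def)
  have x1: "norm x0 < 1" using x0 by (simp add: hyp_space_def)
  define A2 where "A2 x = conf_factor x ^ CARD('n)" for x :: "real^'n"
  define A1 where "A1 x = A2 x / (conf_factor x)\<^sup>2" for x
  define A3 where "A3 x = A2 x / (sinh (hyp_dist x x0))\<^sup>2" for x
  define A4 where "A4 x = A2 x * (sinh (hyp_dist x x0) powr a * X (\<alpha> * tanh (hyp_dist x x0 / 2)) powr ((p + 2) / 2))" for x
  have cf: "conf_factor x > 0" if "x \<in> \<Gamma>" for x using that conf_factor_pos[of x] by (auto simp: \<Gamma>_def)
  have dp: "hyp_dist x x0 > 0" if "x \<in> \<Gamma>" for x using that hyp_distance_off_center(2)[OF x1] by (simp add: \<Gamma>_def)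
  have sub: "\<Gamma> \<subseteq> ball 0 1" by (auto simp: \<Gamma>_def)
  have cc: "continuous_on \<Gamma> conf_factor" "continuous_on \<Gamma> (\<lambda>x. hyp_dist x x0)"
    using continuous_on_conf_factor hyp_distance_off_center(1)[OF x1] sub by (auto intro: continuous_on_subset)
  have A2c: "continuous_on \<Gamma> A2" unfolding A2_def by (intro continuous_intros cc)
  have A1c: "continuous_on \<Gamma> A1"
    unfolding A1_def by (intro continuous_intros cc A2c) (use cf in force)
  have A3c: "continuous_on \<Gamma> A3"
    unfolding A3_def by (intro continuous_intros cc A2c) (use dp in force)
  have A4c: "continuous_on \<Gamma> A4"
  proof -
    have sp: "sinh (hyp_dist x x0) > 0" if "x \<in> \<Gamma>" for x using dp[OF that] by simp
    have tp: "tanh (hyp_dist x x0 / 2) > 0" "tanh (hyp_dist x x0 / 2) \<le> 1" if "x \<in> \<Gamma>" for x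
      using dp[OF that] tanh_real_lt_1[of "hyp_dist x x0 / 2"] by simp_all
    have ap: "\<alpha> * tanh (hyp_dist x x0 / 2) > 0" if "x \<in> \<Gamma>" for x using tp(1)[OF that] \<alpha>(1) by (rule mult_pos_pos[rotated])
    have lp: "1 - ln (\<alpha> * tanh (hyp_dist x x0 / 2)) > 0" if "x \<in> \<Gamma>" for x by (rule ln_pos[OF tp[OF that]])
    have c1: "continuous_on \<Gamma> (\<lambda>x. \<alpha> * tanh (hyp_dist x x0 / 2))"
      by (intro continuous_intros cc(2)) (auto simp: less_imp_neq[OF cosh_real_pos, symmetric])
    have "continuous_on \<Gamma> (\<lambda>x. 1 - ln (\<alpha> * tanh (hyp_dist x x0 / 2)))"
      by (intro continuous_on_diff continuous_on_const continuous_on_ln c1) (use ap in force)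
    then have "continuous_on \<Gamma> (\<lambda>x. X (\<alpha> * tanh (hyp_dist x x0 / 2)))"
      unfolding X_def by (intro continuous_on_divide continuous_on_const) (use lp in force)+
    moreover have "X (\<alpha> * tanh (hyp_dist x x0 / 2)) \<noteq> 0" if "x \<in> \<Gamma>" for x
      using lp[OF that] by (simp add: X_def)
    ultimately have "continuous_on \<Gamma> (\<lambda>x. X (\<alpha> * tanh (hyp_dist x x0 / 2)) powr ((p + 2) / 2))"
      by (intro continuous_on_powr continuous_on_const) auto
    moreover have "continuous_on \<Gamma> (\<lambda>x. sinh (hyp_dist x x0) powr a)"
      by (intro continuous_on_powr continuous_on_const continuous_on_sinh cc(2)) (use sp in force)
    ultimately show ?thesis unfolding A4_def by (intro continuous_on_mult A2c)
  qed
  have rep: "(LINT x|hyp_volume. (hyp_norm x (hyp_grad g x))\<^sup>2) = (LINT x|lborel. A1 x * (norm (grad g x))\<^sup>2)"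
    "(LINT x|hyp_volume. (g x)\<^sup>2) = (LINT x|lborel. A2 x * (g x)\<^sup>2)"
    "(LINT x|hyp_volume. (g x)\<^sup>2 / (sinh (hyp_dist x x0))\<^sup>2) = (LINT x|lborel. A3 x * (g x)\<^sup>2)"
    "(LINT x|hyp_volume. sinh (hyp_dist x x0) powr a * X (\<alpha> * tanh (hyp_dist x x0 / 2)) powr ((p + 2) / 2) * \<bar>g x\<bar> powr p)
      = (LINT x|lborel. A4 x * \<bar>g x\<bar> powr p)" if g: "g \<in> C1c \<Gamma>" for g
  proof -
    note [measurable] = C1cD(4,5)[OF g]
    have z: "g x = 0" "grad g x = 0" if "x \<notin> ball 0 1" for x using C1c_support[OF g] sub that by blast+
    have r: "(LINT x|hyp_volume. G x) = (LINT x|lborel. H x)"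
      if "G \<in> borel_measurable borel" "\<And>x. x \<in> ball 0 1 \<Longrightarrow> A2 x * G x = H x" "\<And>x. x \<notin> ball 0 1 \<Longrightarrow> H x = 0" for G H :: "real^'n \<Rightarrow> real"
      unfolding integral_hyp_volume[OF that(1)]
    proof (intro Bochner_Integration.integral_cong refl)
      fix x show "indicator (ball 0 1) x * (conf_factor x ^ CARD('n) * G x) = H x"
        using that(2,3)[of x] by (cases "x \<in> ball 0 1") (auto simp: A2_def)
    qed
    show "(LINT x|hyp_volume. (hyp_norm x (hyp_grad g x))\<^sup>2) = (LINT x|lborel. A1 x * (norm (grad g x))\<^sup>2)"
    proof (rule r)
      show "(\<lambda>x. (hyp_norm x (hyp_grad g x))\<^sup>2) \<in> borel_measurable borel" unfolding hyp_norm_def hyp_grad_def by measurable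
      show "A2 x * (hyp_norm x (hyp_grad g x))\<^sup>2 = A1 x * (norm (grad g x))\<^sup>2" if "x \<in> ball 0 1" for x
        using conf_factor_pos[of x] that by (simp add: A1_def hyp_norm_def hyp_grad_def power2_eq_square)
    qed (simp add: z)
    show "(LINT x|hyp_volume. (g x)\<^sup>2) = (LINT x|lborel. A2 x * (g x)\<^sup>2)"
      by (rule r) (measurable, simp_all add: z)
    show "(LINT x|hyp_volume. (g x)\<^sup>2 / (sinh (hyp_dist x x0))\<^sup>2) = (LINT x|lborel. A3 x * (g x)\<^sup>2)"
      by (rule r) (measurable, simp_all add: z A3_def)
    show "(LINT x|hyp_volume. sinh (hyp_dist x x0) powr a * X (\<alpha> * tanh (hyp_dist x x0 / 2)) powr ((p + 2) / 2) * \<bar>g x\<bar> powr p)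
      = (LINT x|lborel. A4 x * \<bar>g x\<bar> powr p)"
      by (rule r) (measurable, simp_all add: z A4_def)
  qed
  have f\<Gamma>: "f \<in> C1c \<Gamma>" using f by (simp add: \<Gamma>_def)
  obtain F where F: "\<And>j. F j \<in> test_functions \<Gamma>"
    "\<And>A. continuous_on \<Gamma> A \<Longrightarrow> (\<lambda>j. LINT x|lborel. A x * (norm (grad (F j) x))\<^sup>2) \<longlonglongrightarrow> (LINT x|lborel. A x * (norm (grad f x))\<^sup>2)"
    "\<And>A. continuous_on \<Gamma> A \<Longrightarrow> (\<lambda>j. LINT x|lborel. A x * (F j x)\<^sup>2) \<longlonglongrightarrow> (LINT x|lborel. A x * (f x)\<^sup>2)"
    "\<And>A. continuous_on \<Gamma> A \<Longrightarrow> (\<lambda>j. LINT x|lborel. A x * \<bar>F j x\<bar> powr p) \<longlonglongrightarrow> (LINT x|lborel. A x * \<bar>f x\<bar> powr p)"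
    by (rule approximation_limits[OF f\<Gamma> op p0], rule that)
  have F1: "F j \<in> C1c \<Gamma>" for j using F(1) test_functions_subset_C1c by blast
  show thesis
  proof (rule that)
    show "F j \<in> test_functions hyp_space" for j using F(1)[of j] sub by (auto simp: test_functions_def hyp_space_def)
    show "(\<lambda>j. hardy_energy x0 (F j)) \<longlonglongrightarrow> hardy_energy x0 f"
      unfolding hardy_energy_def Let_def rep(1-3)[OF f\<Gamma>] rep(1-3)[OF F1]
      by (intro tendsto_diff tendsto_mult tendsto_const F(2)[OF A1c] F(3)[OF A2c] F(3)[OF A3c])
    have "(LINT x|lborel. A4 x * \<bar>F j x\<bar> powr p) \<ge> 0" for j
      unfolding rep(4)[OF F1, symmetric] by (intro Bochner_Integration.integral_nonneg) auto
    then show "(\<lambda>j. weighted_term p \<alpha> x0 (F j)) \<longlonglongrightarrow> weighted_term p \<alpha> x0 f"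
      unfolding weighted_term_def Let_def n_def[symmetric] a_def[symmetric] rep(4)[OF f\<Gamma>] rep(4)[OF F1]
      by (intro tendsto_powr'[OF F(4)[OF A4c] tendsto_const]) (simp add: p0)
  qed
qed

lemma sharpness:
  assumes C: "C > (n - 2) powr (- (p + 2) / p) * S_const TYPE('n) p" and x0: "x0 \<in> hyp_space"
  shows "\<exists>u \<in> test_functions (hyp_space :: (real^'n) set). hardy_energy x0 u < C * weighted_term p \<alpha> x0 u"
proof -
  obtain u where u: "u \<in> C1c (ball 0 1 - {0} :: (real^'n) set)" "hardy_energy 0 u < C * weighted_term p \<alpha> 0 u"
    by (rule near_optimizer_origin[OF C], rule that)
  obtain v where v: "v \<in> C1c (ball 0 1 - {x0})" "hardy_energy x0 v < C * weighted_term p \<alpha> x0 v"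
  proof (cases "x0 = 0")
    case True
    then show thesis using that u by simp
  next
    case False
    then interpret inv: sphere_inversion x0 using x0 by unfold_locales (auto simp: hyp_space_def)
    have uB: "u \<in> C1c (ball 0 1)" using u(1) C1c_subset by blast
    \<comment> \<open>The inversion takes \<open>0\<close> to \<open>x0\<close>, so the transported
      function vanishes near \<open>x0\<close>, as \<open>energy_approximation\<close>
      requires.\<close>
    have "{x0} = inv.inver ` ({0} \<inter> ball 0 1)" by (simp add: inv.inver_0)
    note T = inv.transport_C1c(1)[OF u(1) closed_singleton this closed_singleton]
    have TB: "inv.transport u \<in> C1c (ball 0 1)" using T C1c_subset by blast
    \<comment> \<open>\<open>transport\<close> is an involution, so the energies of the transported
      function at \<open>x0\<close> are those of \<open>u\<close> itself at the origin.\<close>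
    show thesis
      by (rule that[OF T]) (use u(2) in \<open>simp add: inv.transport_energies[OF TB] inv.transport_transport[OF uB]\<close>)
  qed
  obtain F where F: "\<And>j. F j \<in> test_functions (hyp_space :: (real^'n) set)"
    "(\<lambda>j. hardy_energy x0 (F j)) \<longlonglongrightarrow> hardy_energy x0 v" "(\<lambda>j. weighted_term p \<alpha> x0 (F j)) \<longlonglongrightarrow> weighted_term p \<alpha> x0 v"
    by (rule energy_approximation[OF x0 v(1)], rule that)
  have "(\<lambda>j. C * weighted_term p \<alpha> x0 (F j) - hardy_energy x0 (F j)) \<longlonglongrightarrow> C * weighted_term p \<alpha> x0 v - hardy_energy x0 v"
    by (rule tendsto_diff[OF tendsto_mult[OF tendsto_const F(3)] F(2)])
  then have "eventually (\<lambda>j. C * weighted_term p \<alpha> x0 (F j) - hardy_energy x0 (F j) > 0) sequentially"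
    by (rule order_tendstoD) (use v(2) in simp)
  then obtain j where "C * weighted_term p \<alpha> x0 (F j) - hardy_energy x0 (F j) > 0"
    unfolding eventually_sequentially by blast
  then show ?thesis by (intro bexI[OF _ F(1)[of j]]) simp
qed

end

theorem theorem1:
  fixes x0 :: "real^'n::finite" and n p \<alpha> c :: real
  defines "n \<equiv> real CARD('n)"
  defines "c \<equiv> (n - 2) powr (- (p + 2) / p) * S_const TYPE('n) p"
  assumes "CARD('n) \<ge> 3"
    and "2 < p" and "p \<le> 2 * n / (n - 2)"
    and "x0 \<in> hyp_space"
    and "0 < \<alpha>" and "\<alpha> \<le> exp ((n - 3) / (n - 2))"
  shows "(\<forall>u \<in> test_functions hyp_space. hardy_energy x0 u \<ge> c * weighted_term p \<alpha> x0 u)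
    \<and> (\<forall>C > c. \<exists>u \<in> test_functions hyp_space. hardy_energy x0 u < C * weighted_term p \<alpha> x0 u)"
proof -
  interpret hardy_sobolev_exponents n \<alpha> "TYPE('n)" p "p * (n - 2) / 2 - n"
    using assms by unfold_locales auto
  show ?thesis using hardy_sobolev[OF assms(6)] sharpness[OF _ assms(6)] unfolding c_def by blast
qed

end
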